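(* Let $f$ be a complex-valued harmonic mapping on $\mathbb{C}$ of finite valence. Let $\Omega_+$ and $\Omega_-$ be distinct connected components of $\mathbb{C}\setminus(f(S)\cup C(f,\infty))$ that share a common non-degenerate boundary arc $\beta_0$, and suppose $\operatorname{int}\beta_0$ does not lie entirely in $C(f,\infty)$. Then there is a non-degenerate subarc $\beta$ of $\beta_0$ that lies outside $C(f,\infty)$ and satisfies $f^{-1}(\beta)\cap(F\cup N)=\varnothing$. Choose $w_0\in\operatorname{int}\beta$ and label the two components so that $\Omega_+$ is the one containing the tangent to $\beta$ at $w_0$. Suppose $w_0$ has $N_0\ge0$ distinct preimages off $S$ and $N_1>0$ distinct preimages in $S$. Then $\mathrm{Val}(f,\Omega_-)=N_0$ and $\mathrm{Val}(f,\Omega_+)=N_0+2N_1$.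
   Context: Finite valence means $\sup_{w\in\mathbb{C}}\mathrm{Val}(f,w)<\infty$, where $\mathrm{Val}(f,w)=\#\{z\in\mathbb{C}:f(z)=w\}$; for a set $\Omega$, $\mathrm{Val}(f,\Omega)=\sup_{w\in\Omega}\mathrm{Val}(f,w)$. Writing $f=u+iv$, $J_f=u_xv_y-u_yv_x$ and $S=\{z: J_f(z)=0\}$. $C(f,\infty)$ is the set of finite $\zeta$ for which there is a sequence $|z_n|\to\infty$ with $f(z_n)\to\zeta$. An arc is non-degenerate if it is not a single point. Write $f=h+\overline{g}$ with $h,g$ entire and $\psi=h'/g'$. The non-folding critical points are $N=\{z\in S:|\psi(z)|\neq1\}$ (at such points $h'=g'=0$); let $\Gamma_f=S\setminus N$. If $z_0\in\Gamma_f$ and $\psi'(z_0)\neq0$, then $z_0$ is interior to a Jordan subarc of $\Gamma_f$ with analytic parametrization $z(t)$, $t\in[0,1]$, $z_0=z(t_0)$, $0<t_0<1$, and a continuous increasing $\phi$ with $\psi(z(t))=\exp(i\phi(t))$; set $\omega(t)=h'(z(t))z'(t)\exp(-i\phi(t)/2)$. Then $z_0\in F_1$ if $\mathrm{Re}\,\omega$ changes sign at $t_0$, and $z_0\in F_2$ if $z_0\notin F_1$ and $h'(z_0)=0$. $F_3$ is the set of $z_0\in\Gamma_f$ with $\psi'(z_0)=0$, and $F=F_1\cup F_2\cup F_3$ (this classification is independent of the choice of arc and parametrization). The image under $f$ of such an arc of $\Gamma_f$ avoiding $F\cup N$ is locally convex, so near $w_0$ the tangent line to $\beta$ at $w_0$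 (apart from $w_0$) lies on one side of $\beta$, i.e. in one of $\Omega_\pm$. *)

theory Defs
  imports "HOL-Complex_Analysis.Complex_Analysis"
begin

text \<open>Jacobian J_f = u_x v_y - u_y v_x of f = u + i v, via the real (Frechet) derivative Df:
  Df 1 = u_x + i v_x, Df i = u_y + i v_y.\<close>
definition jac :: "(complex \<Rightarrow> complex) \<Rightarrow> complex \<Rightarrow> real" where
  "jac f z = (let D = frechet_derivative f (at z) in
      Re (D 1) * Im (D \<i>) - Re (D \<i>) * Im (D 1))"

definition crit_set :: "(complex \<Rightarrow> complex) \<Rightarrow> complex set" where
  "crit_set f = {z. jac f z = 0}"

definition cluster_inf :: "(complex \<Rightarrow> complex) \<Rightarrow> complex set" where
  "cluster_inf f = {\<zeta>. \<exists>zs :: nat \<Rightarrow> complex.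
      filterlim (\<lambda>n. norm (zs n)) at_top sequentially \<and> (\<lambda>n. f (zs n)) \<longlonglongrightarrow> \<zeta>}"

definition Val :: "(complex \<Rightarrow> complex) \<Rightarrow> complex \<Rightarrow> enat" where
  "Val f w = (if finite {z. f z = w} then enat (card {z. f z = w}) else \<infinity>)"

definition Val_on :: "(complex \<Rightarrow> complex) \<Rightarrow> complex set \<Rightarrow> enat" where
  "Val_on f \<Omega> = (SUP w\<in>\<Omega>. Val f w)"

definition finite_valence :: "(complex \<Rightarrow> complex) \<Rightarrow> bool" where
  "finite_valence f \<longleftrightarrow> (\<exists>M::nat. \<forall>w. Val f w \<le> enat M)"

definition psi :: "(complex \<Rightarrow> complex) \<Rightarrow> (complex \<Rightarrow> complex) \<Rightarrow> complex \<Rightarrow> complex" where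
  "psi h g = remove_sings (\<lambda>w. deriv h w / deriv g w)"

definition Nset :: "(complex \<Rightarrow> complex) \<Rightarrow> (complex \<Rightarrow> complex) \<Rightarrow> complex set" where
  "Nset h g = {z \<in> crit_set (\<lambda>z. h z + cnj (g z)). norm (psi h g z) \<noteq> 1}"

definition Gamma_set :: "(complex \<Rightarrow> complex) \<Rightarrow> (complex \<Rightarrow> complex) \<Rightarrow> complex set" where
  "Gamma_set h g = crit_set (\<lambda>z. h z + cnj (g z)) - Nset h g"

definition real_analytic_path :: "(real \<Rightarrow> complex) \<Rightarrow> bool" where
  "real_analytic_path p \<longleftrightarrow> (\<exists>Z U. open U \<and> complex_of_real ` {0..1} \<subseteq> U \<and> Z holomorphic_on U \<and>
      (\<forall>t\<in>{0..1}. p t = Z (complex_of_real t)))"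

definition sign_change_at :: "(real \<Rightarrow> real) \<Rightarrow> real \<Rightarrow> bool" where
  "sign_change_at r t0 \<longleftrightarrow>
     ((\<forall>\<^sub>F t in at_left t0. r t > 0) \<and> (\<forall>\<^sub>F t in at_right t0. r t < 0)) \<or>
     ((\<forall>\<^sub>F t in at_left t0. r t < 0) \<and> (\<forall>\<^sub>F t in at_right t0. r t > 0))"

definition F1 :: "(complex \<Rightarrow> complex) \<Rightarrow> (complex \<Rightarrow> complex) \<Rightarrow> complex set" where
  "F1 h g = {z0 \<in> Gamma_set h g. deriv (psi h g) z0 \<noteq> 0 \<and>
     (\<exists>(zc :: real \<Rightarrow> complex) (\<phi> :: real \<Rightarrow> real) t0.
        arc zc \<and> path_image zc \<subseteq> Gamma_set h g \<and> real_analytic_path zc \<and>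
        t0 \<in> {0<..<1} \<and> zc t0 = z0 \<and>
        continuous_on {0..1} \<phi> \<and> mono_on {0..1} \<phi> \<and>
        (\<forall>t\<in>{0..1}. psi h g (zc t) = exp (\<i> * complex_of_real (\<phi> t))) \<and>
        sign_change_at (\<lambda>t. Re (deriv h (zc t) * vector_derivative zc (at t)
                                 * exp (- \<i> * complex_of_real (\<phi> t) / 2))) t0)}"

definition F2 :: "(complex \<Rightarrow> complex) \<Rightarrow> (complex \<Rightarrow> complex) \<Rightarrow> complex set" where
  "F2 h g = {z0 \<in> Gamma_set h g. deriv (psi h g) z0 \<noteq> 0 \<and> z0 \<notin> F1 h g \<and> deriv h z0 = 0}"

definition F3 :: "(complex \<Rightarrow> complex) \<Rightarrow> (complex \<Rightarrow> complex) \<Rightarrow> complex set" where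
  "F3 h g = {z0 \<in> Gamma_set h g. deriv (psi h g) z0 = 0}"

definition Fset :: "(complex \<Rightarrow> complex) \<Rightarrow> (complex \<Rightarrow> complex) \<Rightarrow> complex set" where
  "Fset h g = F1 h g \<union> F2 h g \<union> F3 h g"

definition tangent_to :: "complex set \<Rightarrow> complex \<Rightarrow> complex \<Rightarrow> bool" where
  "tangent_to B w0 T \<longleftrightarrow> T \<noteq> 0 \<and> (\<exists>p s0. arc p \<and> path_image p = B \<and> s0 \<in> {0<..<1} \<and>
      p s0 = w0 \<and> (p has_vector_derivative T) (at s0))"

end

theory Submission
  imports Defs
begin

text \<open>Near a nondegenerate critical point a rotation and the holomorphic
  coordinate \<open>\<zeta> = H z\<close> bring \<open>f\<close> into the form \<open>\<zeta> \<mapsto> Re \<zeta> + \<i> Im (K \<zeta>)\<close> with \<open>Im K'' < 0\<close>. On every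
  vertical line \<open>Im K\<close> is then strictly convex, so \<open>f\<close> covers the points above the graph of its
  minimum twice and those below not at all; since \<open>Im K\<close> is strictly concave along the horizontal
  line, the graph lies below its tangent and the tangent is on the doubly covered side.

  The points of \<open>F \<union> N\<close>, and more generally those where the fold direction is tangent to the
  critical set, form a closed countable set, because an accumulation point would yield a curve on
  which \<open>f\<close> is constant. Hence some subarc of \<open>\<beta>0\<close> avoids their images, and it may be chosen with
  the least number of critical preimages. By semicontinuity that number is constant along
  the subarc, so all fold curves through its points coincide with it locally and their contributions
  \<open>0\<close> or \<open>2\<close> add up. Properness off \<open>C(f,\<infinity>)\<close> makes the valence constant on components.\<close>

section \<open>Local counting of preimages\<close>

text \<open>Convexity across a fold and concavity along it are one inequality, because
  \<open>Im K\<close> is harmonic: its second derivative is \<open>- Im K''\<close> on vertical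
  lines and \<open>Im K''\<close> on horizontal ones.

  The charts at the several critical preimages of \<open>w0\<close> are rotated independently of
  each other, so it has to be shown that their folds open to the same side. The doubly covered side
  of each fold contains the points of the punctured tangent near \<open>w0\<close>; this ties all of
  them to one component.

  The set \<open>F\<close> is given by parametrized arcs and sign changes, from which closedness
  cannot be read off. It is therefore enclosed in \<open>degenerate\<close>, a closed condition on
  \<open>h'\<close>, \<open>g'\<close> and their derivatives. Closedness leaves an open set of arc
  parameters, countability a nonempty one. A curve on which \<open>f\<close> is constant is
  impossible by finite valence, but it is obtained only away from the zeros of \<open>h'\<close> and
  \<open>wronsk\<close>; these zeros are countable unless one of the functions vanishes identically,
  which is a separate case.\<close>

locale harmonic_map =
  fixes h g f :: "complex \<Rightarrow> complex"
  assumes h_holo: "h holomorphic_on UNIV" and g_holo: "g holomorphic_on UNIV"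
    and f_eq: "f = (\<lambda>z. h z + cnj (g z))"
begin

lemma h_deriv: "(h has_field_derivative deriv h z) (at z within A)"
  using h_holo holomorphic_derivI open_UNIV by blast

lemma g_deriv: "(g has_field_derivative deriv g z) (at z within A)"
  using g_holo holomorphic_derivI open_UNIV by blast

lemma f_has_derivative:
  "(f has_derivative (\<lambda>v. deriv h z * v + cnj (deriv g z * v))) (at z)"
  unfolding f_eq
  by (intro derivative_intros bounded_linear.has_derivative[OF bounded_linear_cnj]
      h_deriv[unfolded has_field_derivative_def] g_deriv[unfolded has_field_derivative_def])

lemma jac_eq: "jac f z = (cmod (deriv h z))\<^sup>2 - (cmod (deriv g z))\<^sup>2"
  unfolding jac_def frechet_derivative_at[OF f_has_derivative, symmetric] Let_def cmod_power2
  by (simp add: algebra_simps power2_eq_square)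

lemma crit_iff: "z \<in> crit_set f \<longleftrightarrow> cmod (deriv h z) = cmod (deriv g z)"
  by (simp add: crit_set_def jac_eq)

lemma continuous_f [continuous_intros]: "continuous_on A f"
  unfolding f_eq
  by (intro continuous_intros holomorphic_on_imp_continuous_on
      holomorphic_on_subset[OF h_holo] holomorphic_on_subset[OF g_holo]) auto

lemma holo_derivs:
  "deriv h holomorphic_on A" "deriv g holomorphic_on A"
  "deriv (deriv h) holomorphic_on A" "deriv (deriv g) holomorphic_on A"
  by (meson holomorphic_deriv holomorphic_on_subset h_holo g_holo open_UNIV subset_UNIV)+

lemma continuous_derivs [continuous_intros]:
  "continuous_on A (deriv h)" "continuous_on A (deriv g)"
  "continuous_on A (deriv (deriv h))" "continuous_on A (deriv (deriv g))"
  by (intro holomorphic_on_imp_continuous_on holo_derivs)+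

lemma closed_crit: "closed (crit_set f)"
proof -
  have "crit_set f = {z. cmod (deriv h z) = cmod (deriv g z)}"
    by (auto simp: crit_iff)
  then show ?thesis
    by (auto intro!: closed_Collect_eq continuous_intros)
qed

text \<open>The differential \<open>v |-> a * v + cnj (b * v)\<close> stretches every vector by at
  least \<open>\<bar>cmod a - cmod b\<bar>\<close>, which is positive off the critical set. On a
  small ball \<open>h\<close> and \<open>g\<close> differ from their linear parts by maps with small
  Lipschitz constants, so injectivity survives.\<close>

lemma locally_injective_off_crit:
  assumes "z0 \<notin> crit_set f" and "e > 0"
  obtains r where "0 < r" "r \<le> e" "inj_on f (ball z0 r)" "ball z0 r \<inter> crit_set f = {}"
proof -
  define a b where "a = deriv h z0" and "b = deriv g z0"
  \<comment> \<open>A third of the lower bound: the errors of \<open>h\<close> and \<open>g\<close>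
    use up two thirds, and the remaining third gives the contradiction.\<close>
  define d where "d = \<bar>cmod a - cmod b\<bar> / 3"
  have d: "d > 0"
    using assms(1) by (simp add: d_def a_def b_def crit_iff)
  have "isCont (deriv h) z0" "isCont (deriv g) z0"
    using continuous_derivs(1,2)[of UNIV] by (simp_all add: continuous_on_eq_continuous_at)
  then obtain r1 r2 where r: "r1 > 0" "\<And>z. dist z z0 < r1 \<Longrightarrow> dist (deriv h z) a < d"
      "r2 > 0" "\<And>z. dist z z0 < r2 \<Longrightarrow> dist (deriv g z) b < d"
    unfolding continuous_at_eps_delta a_def b_def using d by metis
  obtain r3 where r3: "r3 > 0" "ball z0 r3 \<subseteq> - crit_set f"
    using closed_crit assms(1) by (meson ComplI open_Compl openE)
  define R where "R = Min {r1, r2, r3, e}"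
  have R: "R > 0" "R \<le> r1" "R \<le> r2" "R \<le> r3" "R \<le> e"
    using r r3 assms by (auto simp: R_def)
  have lin: "norm ((F z - c * z) - (F w - c * w)) \<le> d * norm (z - w)"
    if "z \<in> ball z0 R" "w \<in> ball z0 R"
      and F: "\<And>x. (F has_field_derivative deriv F x) (at x within ball z0 R)"
      and Fc: "\<And>x. x \<in> ball z0 R \<Longrightarrow> dist (deriv F x) c < d" for F c z w
  proof (rule field_differentiable_bound[of "ball z0 R" "\<lambda>z. F z - c * z" "\<lambda>x. deriv F x - c"])
    show "((\<lambda>z. F z - c * z) has_field_derivative deriv F x - c) (at x within ball z0 R)" for x
      using F by (auto intro!: derivative_eq_intros)
    show "norm (deriv F x - c) \<le> d" if "x \<in> ball z0 R" for x
      using Fc[OF that] by (simp add: dist_norm)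
  qed (use that in auto)
  have "inj_on f (ball z0 R)"
  proof (rule inj_onI, rule ccontr)
    fix z w assume zw: "z \<in> ball z0 R" "w \<in> ball z0 R" "f z = f w" "z \<noteq> w"
    let ?\<alpha> = "(h z - a * z) - (h w - a * w)" and ?\<beta> = "(g z - b * z) - (g w - b * w)"
    have 1: "norm ?\<alpha> \<le> d * norm (z - w)"
      by (rule lin) (use zw R r h_deriv in \<open>auto simp: dist_commute\<close>)
    have 2: "norm ?\<beta> \<le> d * norm (z - w)"
      by (rule lin) (use zw R r g_deriv in \<open>auto simp: dist_commute\<close>)
    have "a * (z - w) + ?\<alpha> + cnj (b * (z - w) + ?\<beta>) = 0"
      using zw(3) by (simp add: f_eq algebra_simps)
    then have "a * (z - w) + ?\<alpha> = - cnj (b * (z - w) + ?\<beta>)"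
      by (simp add: add_eq_0_iff2)
    then have eq: "norm (a * (z - w) + ?\<alpha>) = norm (b * (z - w) + ?\<beta>)"
      by (simp only: norm_minus_cancel complex_mod_cnj)
    have "norm (a * (z - w)) = norm ((a * (z - w) + ?\<alpha>) - ?\<alpha>)"
      by simp
    then have 3: "norm (a * (z - w)) \<le> norm (a * (z - w) + ?\<alpha>) + norm ?\<alpha>"
      using norm_triangle_ineq4 by metis
    have 4: "norm (a * (z - w) + ?\<alpha>) \<le> norm (a * (z - w)) + norm ?\<alpha>"
      by (rule norm_triangle_ineq)
    have "norm (b * (z - w)) = norm ((b * (z - w) + ?\<beta>) - ?\<beta>)"
      by simp
    then have 5: "norm (b * (z - w)) \<le> norm (b * (z - w) + ?\<beta>) + norm ?\<beta>"
      using norm_triangle_ineq4 by metis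
    have 6: "norm (b * (z - w) + ?\<beta>) \<le> norm (b * (z - w)) + norm ?\<beta>"
      by (rule norm_triangle_ineq)
    have "\<bar>norm (a * (z - w)) - norm (b * (z - w))\<bar> \<le> 2 * d * norm (z - w)"
      using 1 2 3 4 5 6 eq by linarith
    then have "\<bar>cmod a - cmod b\<bar> * norm (z - w) \<le> 2 * d * norm (z - w)"
      by (simp add: norm_mult abs_mult flip: left_diff_distrib)
    then have "\<bar>cmod a - cmod b\<bar> \<le> 2 * d"
      using zw(4) by simp
    then show False
      using d by (simp add: d_def)
  qed
  moreover have "ball z0 R \<inter> crit_set f = {}"
    using r3(2) subset_ball[OF R(4), of z0] by blast
  ultimately show ?thesis
    using R that by blast
qed

text \<open>This is properness of \<open>f\<close> over a neighbourhood of \<open>w0\<close>: its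
  failure for every radius would produce points whose norms tend to infinity and whose values tend
  to \<open>w0\<close>.\<close>

lemma preimages_bounded_off_cluster:
  assumes "w0 \<notin> cluster_inf f"
  obtains R \<rho> where "\<rho> > 0" "\<And>z. f z \<in> ball w0 \<rho> \<Longrightarrow> z \<in> cball 0 R"
proof (rule ccontr)
  assume neg: "\<not> thesis"
  have "\<exists>z. dist w0 (f z) < inverse (Suc n) \<and> norm z > real n" for n
  proof (rule ccontr)
    assume "\<nexists>z. dist w0 (f z) < inverse (Suc n) \<and> norm z > real n"
    then have "\<And>z. f z \<in> ball w0 (inverse (Suc n)) \<Longrightarrow> z \<in> cball 0 (real n)"
      by (meson mem_ball mem_cball_0 not_less)
    then show False
      using that[of "inverse (Suc n)" "real n"] neg by simp
  qed
  then obtain z where z: "\<And>n. dist w0 (f (z n)) < inverse (Suc n)" "\<And>n. norm (z n) > real n"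
    by metis
  have "filterlim (\<lambda>n. norm (z n)) at_top sequentially"
    by (rule filterlim_at_top_mono[OF filterlim_real_sequentially])
      (use z(2) less_imp_le in \<open>auto intro!: always_eventually\<close>)
  moreover have "(\<lambda>n. f (z n)) \<longlonglongrightarrow> w0"
  proof (rule metric_tendsto_imp_tendsto[OF LIMSEQ_inverse_real_of_nat])
    show "\<forall>\<^sub>F n in sequentially. dist (f (z n)) w0 \<le> dist (inverse (real (Suc n))) 0"
      using z(1) by (auto intro!: always_eventually less_imp_le simp: dist_commute)
  qed
  ultimately show False
    using assms by (auto simp: cluster_inf_def)
qed

text \<open>The part of the large disc outside \<open>U\<close> is compact, so its image is closed
  and keeps a positive distance from \<open>w0\<close>. Thus nearby fibres cannot contain points far
  from the fibre over \<open>w0\<close>.\<close>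

lemma preimages_near:
  assumes "w0 \<notin> cluster_inf f" and "open U" and "f -` {w0} \<subseteq> U"
  obtains \<rho> where "\<rho> > 0" "f -` ball w0 \<rho> \<subseteq> U"
proof -
  obtain R \<rho> where R: "\<rho> > 0" "\<And>z. f z \<in> ball w0 \<rho> \<Longrightarrow> z \<in> cball 0 R"
    using preimages_bounded_off_cluster[OF assms(1)] by metis
  have "compact (cball 0 R - U)"
    using assms(2) by (simp add: compact_diff)
  then have "compact (f ` (cball 0 R - U))"
    by (intro compact_continuous_image continuous_intros)
  then have "open (- (f ` (cball 0 R - U)))"
    by (simp add: compact_imp_closed open_Compl)
  moreover have "w0 \<in> - (f ` (cball 0 R - U))"
    using assms(3) by auto
  ultimately obtain e where e: "e > 0" "ball w0 e \<subseteq> - (f ` (cball 0 R - U))"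
    by (meson openE)
  have "f -` ball w0 (min e \<rho>) \<subseteq> U"
    using R(2) e(2) by fastforce
  then show ?thesis
    using that[of "min e \<rho>"] e R by simp
qed

lemma closed_cluster_inf: "closed (cluster_inf f)"
proof -
  have "\<exists>T. open T \<and> w0 \<in> T \<and> T \<subseteq> - cluster_inf f" if w0: "w0 \<in> - cluster_inf f" for w0
  proof -
    obtain R \<rho> where R: "\<rho> > 0" "\<And>z. f z \<in> ball w0 \<rho> \<Longrightarrow> z \<in> cball 0 R"
      using preimages_bounded_off_cluster w0 by (metis ComplD)
    have "w \<notin> cluster_inf f" if "w \<in> ball w0 \<rho>" for w
    proof
      assume "w \<in> cluster_inf f"
      then obtain z where z: "filterlim (\<lambda>n. norm (z n)) at_top sequentially" "(\<lambda>n. f (z n)) \<longlonglongrightarrow> w"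
        by (auto simp: cluster_inf_def)
      have "\<forall>\<^sub>F n in sequentially. f (z n) \<in> ball w0 \<rho>"
        by (rule topological_tendstoD[OF z(2) open_ball that])
      moreover have "\<forall>\<^sub>F n in sequentially. norm (z n) > R"
        using z(1) by (simp add: filterlim_at_top_dense)
      ultimately have "\<forall>\<^sub>F n in sequentially. False"
        by eventually_elim (use R(2) in fastforce)
      then show False
        by simp
    qed
    then show ?thesis
      using R(1) by (intro exI[of _ "ball w0 \<rho>"]) auto
  qed
  then show ?thesis
    unfolding closed_def by (subst open_subopen) blast
qed

lemma image_closed_off_cluster:
  assumes "closed S" and "w0 \<notin> cluster_inf f" and "w0 \<notin> f ` S"
  obtains \<rho> where "\<rho> > 0" "ball w0 \<rho> \<inter> (f ` S \<union> cluster_inf f) = {}"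
proof -
  obtain r where r: "r > 0" "f -` ball w0 r \<subseteq> - S"
    using preimages_near[OF assms(2), of "- S"] assms by (auto simp: open_Compl)
  obtain r' where r': "r' > 0" "ball w0 r' \<subseteq> - cluster_inf f"
    using closed_cluster_inf assms(2) by (meson ComplI open_Compl openE)
  show ?thesis
    using that[of "min r r'"] r r' by fastforce
qed

text \<open>Adding the cluster set restores the closedness that is lost where \<open>f\<close> fails
  to be proper. Applied to \<open>degenerate\<close>, it makes the arc parameters to be avoided a
  relatively closed set.\<close>

lemma closed_image_Un_cluster:
  assumes "closed S"
  shows "closed (f ` S \<union> cluster_inf f)"
proof -
  have "\<exists>T. open T \<and> w0 \<in> T \<and> T \<subseteq> - (f ` S \<union> cluster_inf f)"
    if "w0 \<in> - (f ` S \<union> cluster_inf f)" for w0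
  proof -
    have "w0 \<notin> cluster_inf f" "w0 \<notin> f ` S"
      using that by auto
    then obtain \<rho> where "\<rho> > 0" "ball w0 \<rho> \<inter> (f ` S \<union> cluster_inf f) = {}"
      using image_closed_off_cluster[OF assms] by metis
    then show ?thesis
      by (intro exI[of _ "ball w0 \<rho>"]) auto
  qed
  then show ?thesis
    unfolding closed_def by (subst open_subopen) blast
qed

end

section \<open>Finite fibres and local constancy of the valence\<close>

locale finite_harmonic_map = harmonic_map +
  assumes fin_val: "finite_valence f"
begin

lemma finite_preimage: "finite {z. f z = w}"
proof -
  obtain M where "\<And>w. Val f w \<le> enat M"
    using fin_val by (auto simp: finite_valence_def)
  then show ?thesis
    by (metis Val_def enat_ord_simps(5) infinity_ne_i1 enat.distinct(1))
qed

text \<open>The points of a finite fibre have disjoint neighbourhoods; by properness these catch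
  every nearby fibre, so counts become sums over the points of the fibre. \<open>Q\<close> leaves
  open which kind of neighbourhood is taken at each point, and \<open>A\<close> allows critical
  preimages to be counted separately.\<close>

lemma local_counting:
  assumes w0: "w0 \<notin> cluster_inf f"
    and nbhd: "\<And>z e. f z = w0 \<Longrightarrow> e > 0 \<Longrightarrow> \<exists>U. open U \<and> z \<in> U \<and> U \<subseteq> ball z e \<and> Q z U"
  obtains U \<rho> where "\<rho> > 0" "\<And>z. f z = w0 \<Longrightarrow> open (U z) \<and> z \<in> U z \<and> Q z (U z)"
    "\<And>w. w \<in> ball w0 \<rho> \<Longrightarrow> {z. f z = w} \<subseteq> (\<Union>z\<in>{z. f z = w0}. U z)"
    "\<And>w A. w \<in> ball w0 \<rho> \<Longrightarrow>
        card {z\<in>A. f z = w} = (\<Sum>z\<in>{z. f z = w0}. card {x \<in> U z \<inter> A. f x = w})"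
proof -
  let ?Z = "{z. f z = w0}"
  have fin: "finite ?Z"
    by (rule finite_preimage)
  obtain e where e: "e > 0" "\<And>x y. x \<in> ?Z \<Longrightarrow> y \<in> ?Z \<Longrightarrow> x \<noteq> y \<Longrightarrow> e \<le> dist x y"
  proof -
    have "uniform_discrete ?Z"
      using fin uniform_discrete_finite_iff by blast
    then show ?thesis
      using that unfolding uniform_discrete_def by (metis not_less)
  qed
  have "\<exists>U. open U \<and> z \<in> U \<and> U \<subseteq> ball z (e/2) \<and> Q z U" if "z \<in> ?Z" for z
    using nbhd[of z "e/2"] that e by auto
  then obtain U where U: "\<And>z. z \<in> ?Z \<Longrightarrow> open (U z) \<and> z \<in> U z \<and> U z \<subseteq> ball z (e/2) \<and> Q z (U z)"
    by metis
  have disj: "U x \<inter> U y = {}" if "x \<in> ?Z" "y \<in> ?Z" "x \<noteq> y" for x y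
  proof -
    have "ball x (e/2) \<inter> ball y (e/2) = {}"
      using e(2)[OF that] by (intro disjoint_ballI) auto
    then show ?thesis
      using U[OF that(1)] U[OF that(2)] by blast
  qed
  obtain \<rho> where \<rho>: "\<rho> > 0" "f -` ball w0 \<rho> \<subseteq> (\<Union>z\<in>?Z. U z)"
  proof (rule preimages_near[OF w0])
    show "open (\<Union>z\<in>?Z. U z)"
      using U by blast
    show "f -` {w0} \<subseteq> (\<Union>z\<in>?Z. U z)"
      using U by fastforce
  qed
  have "card {z\<in>A. f z = w} = (\<Sum>z\<in>?Z. card {x \<in> U z \<inter> A. f x = w})" if "w \<in> ball w0 \<rho>" for w A
  proof -
    have "{z\<in>A. f z = w} = (\<Union>z\<in>?Z. {x \<in> U z \<inter> A. f x = w})"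
      using \<rho>(2) that by fastforce
    moreover have "card (\<Union>z\<in>?Z. {x \<in> U z \<inter> A. f x = w}) = (\<Sum>z\<in>?Z. card {x \<in> U z \<inter> A. f x = w})"
    proof (rule card_UN_disjoint[OF fin])
      show "\<forall>z\<in>?Z. finite {x \<in> U z \<inter> A. f x = w}"
        using finite_preimage[of w] by (auto intro: finite_subset[rotated])
      show "\<forall>x\<in>?Z. \<forall>y\<in>?Z. x \<noteq> y \<longrightarrow>
          {u \<in> U x \<inter> A. f u = w} \<inter> {u \<in> U y \<inter> A. f u = w} = {}"
        using disj by blast
    qed
    ultimately show ?thesis
      by simp
  qed
  moreover have "{z. f z = w} \<subseteq> (\<Union>z\<in>?Z. U z)" if "w \<in> ball w0 \<rho>" for w
    using \<rho>(2) that by auto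
  ultimately show ?thesis
    using that[of \<rho> U] \<rho>(1) U by blast
qed

definition local_homeo_nbhd :: "complex set \<Rightarrow> bool" where
  "local_homeo_nbhd U \<longleftrightarrow> U \<inter> crit_set f = {} \<and> inj_on f U \<and> open (f ` U)"

text \<open>Openness of the image comes from invariance of domain, applied to the continuous
  injective \<open>f\<close> on a ball.\<close>

lemma local_homeo_nbhd_exists:
  assumes "z \<notin> crit_set f" "e > 0"
  shows "\<exists>U. open U \<and> z \<in> U \<and> U \<subseteq> ball z e \<and> local_homeo_nbhd U"
proof -
  obtain r where r: "0 < r" "r \<le> e" "inj_on f (ball z r)" "ball z r \<inter> crit_set f = {}"
    using locally_injective_off_crit[OF assms] by metis
  have "open (f ` ball z r)"
    by (rule invariance_of_domain) (use r in \<open>auto intro: continuous_intros\<close>)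
  then show ?thesis
    using r by (intro exI[of _ "ball z r"]) (auto simp: local_homeo_nbhd_def)
qed

lemma local_homeo_count:
  assumes "local_homeo_nbhd U"
  shows "w \<in> f ` U \<Longrightarrow> card {x\<in>U. f x = w} = 1" "{x \<in> U \<inter> crit_set f. f x = w} = {}"
proof -
  assume "w \<in> f ` U"
  then obtain z where "z \<in> U" "f z = w"
    by blast
  then have "{x\<in>U. f x = w} = {z}"
    using assms by (auto simp: local_homeo_nbhd_def inj_on_def)
  then show "card {x\<in>U. f x = w} = 1"
    by simp
qed (use assms in \<open>auto simp: local_homeo_nbhd_def\<close>)

lemma Val_eq: "Val f w = enat (card {z. f z = w})"
  by (simp add: Val_def finite_preimage)

text \<open>Every preimage of \<open>w0\<close> is noncritical, hence has a neighbourhood mapped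
  bijectively onto an open set around \<open>w0\<close>. On the intersection of these finitely many
  open sets each neighbourhood contributes exactly one preimage.\<close>

lemma valence_locally_constant:
  assumes "w0 \<notin> f ` crit_set f \<union> cluster_inf f"
  obtains \<rho> where "\<rho> > 0" "\<And>w. w \<in> ball w0 \<rho> \<Longrightarrow> card {z. f z = w} = card {z. f z = w0}"
proof -
  have ex: "\<exists>U. open U \<and> z \<in> U \<and> U \<subseteq> ball z e \<and> local_homeo_nbhd U" if "f z = w0" "e > 0" for z e
    using assms that by (intro local_homeo_nbhd_exists) auto
  have w0: "w0 \<notin> cluster_inf f"
    using assms by blast
  obtain U \<rho> where \<rho>: "\<rho> > 0"
    and U: "\<And>z. f z = w0 \<Longrightarrow> open (U z) \<and> z \<in> U z \<and> local_homeo_nbhd (U z)"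
    and cnt: "\<And>w A. w \<in> ball w0 \<rho> \<Longrightarrow>
        card {z\<in>A. f z = w} = (\<Sum>z\<in>{z. f z = w0}. card {x \<in> U z \<inter> A. f x = w})"
    by (rule local_counting[OF w0, of "\<lambda>z. local_homeo_nbhd"]) (use ex in blast)+
  let ?V = "(\<Inter>z\<in>{z. f z = w0}. f ` U z) \<inter> ball w0 \<rho>"
  have "open ?V"
    using U finite_preimage[of w0] by (intro open_Int open_INT) (auto simp: local_homeo_nbhd_def)
  moreover have "w0 \<in> ?V"
    using U \<rho> by force
  ultimately obtain r where r: "r > 0" "ball w0 r \<subseteq> ?V"
    by (meson openE)
  have *: "card {z. f z = w} = card {z. f z = w0}" if "w \<in> ball w0 r" for w
  proof -
    have "card {z. f z = w} = (\<Sum>z\<in>{z. f z = w0}. card {x \<in> U z. f x = w})"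
      using cnt[of w UNIV] that r by auto
    also have "\<dots> = (\<Sum>z\<in>{z. f z = w0}. 1)"
    proof (rule sum.cong[OF refl])
      fix z assume z: "z \<in> {z. f z = w0}"
      then have "w \<in> f ` U z"
        using r that by blast
      then show "card {x \<in> U z. f x = w} = 1"
        using local_homeo_count(1) U z by blast
    qed
    finally show ?thesis
      by simp
  qed
  show ?thesis
    by (rule that[OF r(1) *])
qed

text \<open>A locally constant count is constant on a connected set. The supremum can therefore be
  evaluated at any single point, and one test point on each side of the arc suffices later.\<close>

lemma Val_on_component:
  assumes "\<Omega> \<in> components (- (f ` crit_set f \<union> cluster_inf f))" and "w \<in> \<Omega>"
  shows "Val_on f \<Omega> = enat (card {z. f z = w})"
proof -
  have "card {z. f z = v} = card {z. f z = w}" if "v \<in> \<Omega>" for v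
  proof (rule connected_local_const[of \<Omega> v w "\<lambda>w. card {z. f z = w}"])
    show "connected \<Omega>"
      using assms in_components_connected by blast
    show "\<forall>a\<in>\<Omega>. \<forall>\<^sub>F b in at a within \<Omega>. card {z. f z = a} = card {z. f z = b}"
    proof
      fix a assume "a \<in> \<Omega>"
      then have "a \<notin> f ` crit_set f \<union> cluster_inf f"
        using assms(1) in_components_subset by blast
      then obtain \<rho> where \<rho>: "\<rho> > 0" "\<And>w. w \<in> ball a \<rho> \<Longrightarrow> card {z. f z = w} = card {z. f z = a}"
        by (rule valence_locally_constant) blast
      then show "\<forall>\<^sub>F b in at a within \<Omega>. card {z. f z = a} = card {z. f z = b}"
        unfolding eventually_at by (intro exI[of _ \<rho>] conjI ballI impI \<rho>(1) \<rho>(2)[symmetric]) (simp add: dist_commute)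
    qed
  qed (use assms that in auto)
  then have "Val_on f \<Omega> = (SUP v\<in>\<Omega>. enat (card {z. f z = w}))"
    unfolding Val_on_def by (intro SUP_cong) (auto simp: Val_eq)
  then show ?thesis
    using assms(2) by (simp add: cSUP_const[of \<Omega>] ex_in_conv[symmetric] exI[of _ w])
qed

end

section \<open>Fold normal form\<close>

lemma convex_strict_min:
  fixes k k' :: "real \<Rightarrow> real"
  assumes der: "\<And>y. y \<in> {a..b} \<Longrightarrow> (k has_real_derivative k' y) (at y)"
    and mono: "\<And>x y. a \<le> x \<Longrightarrow> x < y \<Longrightarrow> y \<le> b \<Longrightarrow> k' x < k' y"
    and y0: "y0 \<in> {a..b}" "k' y0 = 0"
  shows convex_decreasing: "\<And>x y. a \<le> x \<Longrightarrow> x < y \<Longrightarrow> y \<le> y0 \<Longrightarrow> k y < k x"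
    and convex_increasing: "\<And>x y. y0 \<le> x \<Longrightarrow> x < y \<Longrightarrow> y \<le> b \<Longrightarrow> k x < k y"
    and convex_min: "\<And>y. y \<in> {a..b} \<Longrightarrow> y \<noteq> y0 \<Longrightarrow> k y0 < k y"
proof -
  have cont: "continuous_on {x..y} k" if "a \<le> x" "y \<le> b" for x y
    by (intro continuous_at_imp_continuous_on ballI, rule DERIV_isCont[OF der]) (use that in auto)
  show dec: "k y < k x" if "a \<le> x" "x < y" "y \<le> y0" for x y
  proof (rule DERIV_neg_imp_decreasing_open[OF \<open>x < y\<close>])
    show "\<exists>l. (k has_real_derivative l) (at t) \<and> l < 0" if "x < t" "t < y" for t
      using der[of t] mono[of t y0] that \<open>a \<le> x\<close> \<open>y \<le> y0\<close> y0 by fastforce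
  qed (use cont that y0 in auto)
  show inc: "k x < k y" if "y0 \<le> x" "x < y" "y \<le> b" for x y
  proof (rule DERIV_pos_imp_increasing_open[OF \<open>x < y\<close>])
    show "\<exists>l. (k has_real_derivative l) (at t) \<and> l > 0" if "x < t" "t < y" for t
      using der[of t] mono[of y0 t] that \<open>y0 \<le> x\<close> \<open>y \<le> b\<close> y0 by fastforce
  qed (use cont that y0 in auto)
  show "k y0 < k y" if "y \<in> {a..b}" "y \<noteq> y0" for y
    using dec[of y y0] inc[of y0 y] that y0 by (cases "y < y0") auto
qed

text \<open>The signs of \<open>k'\<close> at the ends push the minimum into the interior. Two
  solutions are claimed for \<open>v\<close> below both end values, since both monotone branches
  have to reach \<open>v\<close> before the interval stops.\<close>

lemma convex_critical_point:
  fixes k k' :: "real \<Rightarrow> real"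
  assumes \<eta>: "\<eta> > 0"
    and der: "\<And>y. y \<in> {-\<eta>..\<eta>} \<Longrightarrow> (k has_real_derivative k' y) (at y)"
    and mono: "\<And>x y. -\<eta> \<le> x \<Longrightarrow> x < y \<Longrightarrow> y \<le> \<eta> \<Longrightarrow> k' x < k' y"
    and cont: "continuous_on {-\<eta>..\<eta>} k'"
    and ends: "k' (-\<eta>) < 0" "0 < k' \<eta>"
  obtains y0 where "\<bar>y0\<bar> < \<eta>" "\<And>y. \<bar>y\<bar> < \<eta> \<Longrightarrow> k' y = 0 \<longleftrightarrow> y = y0"
    "\<And>y. \<bar>y\<bar> < \<eta> \<Longrightarrow> k y0 \<le> k y"
    "\<And>v. k y0 < v \<Longrightarrow> v < k (-\<eta>) \<Longrightarrow> v < k \<eta> \<Longrightarrow> card {y. \<bar>y\<bar> < \<eta> \<and> k y = v} = 2"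
proof -
  obtain y0 where y0: "-\<eta> \<le> y0" "y0 \<le> \<eta>" "k' y0 = 0"
    using IVT'[of k' "-\<eta>" 0 \<eta>] ends cont \<eta> by auto
  then have "y0 \<noteq> \<eta>" "y0 \<noteq> -\<eta>"
    using ends by auto
  then have abs: "\<bar>y0\<bar> < \<eta>"
    using y0 by auto
  have y0': "y0 \<in> {-\<eta>..\<eta>}"
    using y0 by simp
  note dec = convex_decreasing[OF der mono y0' y0(3)]
   and inc = convex_increasing[OF der mono y0' y0(3)]
   and min = convex_min[OF der mono y0' y0(3)]
  have k_cont: "continuous_on {x..y} k" if "-\<eta> \<le> x" "y \<le> \<eta>" for x y
    by (intro continuous_at_imp_continuous_on ballI, rule DERIV_isCont[OF der]) (use that in auto)
  have "k' y = 0 \<longleftrightarrow> y = y0" if "\<bar>y\<bar> < \<eta>" for y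
    using mono[of y y0] mono[of y0 y] y0 that by (cases y y0 rule: linorder_cases) (auto simp: abs_less_iff)
  moreover have "k y0 \<le> k y" if "\<bar>y\<bar> < \<eta>" for y
    using min[of y] that by (cases "y = y0") (auto simp: abs_if split: if_splits)
  moreover have "card {y. \<bar>y\<bar> < \<eta> \<and> k y = v} = 2" if v: "k y0 < v" "v < k (-\<eta>)" "v < k \<eta>" for v
  proof -
    obtain y1 where y1: "-\<eta> \<le> y1" "y1 \<le> y0" "k y1 = v"
      using IVT2'[of k y0 v "-\<eta>"] v y0 k_cont by auto
    obtain y2 where y2: "y0 \<le> y2" "y2 \<le> \<eta>" "k y2 = v"
      using IVT'[of k y0 v \<eta>] v y0 k_cont by auto
    have ne: "y1 \<noteq> -\<eta>" "y2 \<noteq> \<eta>" "y1 \<noteq> y0" "y2 \<noteq> y0"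
      using v y1 y2 by auto
    have "y = y1 \<or> y = y2" if "\<bar>y\<bar> < \<eta>" "k y = v" for y
    proof (cases "y \<le> y0")
      case True
      then have "y = y1"
        using dec[of y y1] dec[of y1 y] y1 that by (cases y y1 rule: linorder_cases) (auto simp: abs_less_iff)
      then show ?thesis ..
    next
      case False
      then have "y = y2"
        using inc[of y y2] inc[of y2 y] y2 that by (cases y y2 rule: linorder_cases) (auto simp: abs_less_iff)
      then show ?thesis ..
    qed
    then have "{y. \<bar>y\<bar> < \<eta> \<and> k y = v} = {y1, y2}"
      using y1 y2 ne by auto
    moreover have "y1 \<noteq> y2"
      using y1 y2 ne by auto
    ultimately show ?thesis
      by simp
  qed
  ultimately show ?thesis
    using that abs by blast
qed

lemma has_real_derivative_along_line:
  assumes "(F has_field_derivative F') (at (p + of_real t * b))"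
  shows "((\<lambda>t. Re (F (p + of_real t * b))) has_real_derivative Re (F' * b)) (at t)"
    and "((\<lambda>t. Im (F (p + of_real t * b))) has_real_derivative Im (F' * b)) (at t)"
proof -
  have "((\<lambda>t. p + of_real t * b) has_vector_derivative b) (at t)"
    by (auto intro!: derivative_eq_intros simp: has_vector_derivative_def scaleR_conv_of_real)
  then have "(F \<circ> (\<lambda>t. p + of_real t * b) has_vector_derivative b * F') (at t)"
    by (rule field_vector_diff_chain_at) (use assms in simp)
  then have *: "((\<lambda>t. F (p + of_real t * b)) has_vector_derivative F' * b) (at t)"
    by (simp add: o_def mult.commute)
  show "((\<lambda>t. Re (F (p + of_real t * b))) has_real_derivative Re (F' * b)) (at t)"
    "((\<lambda>t. Im (F (p + of_real t * b))) has_real_derivative Im (F' * b)) (at t)"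
    using has_vector_derivative_complex_iff[of "\<lambda>t. F (p + of_real t * b)" "F' * b" "at t"] *
    by auto
qed

section \<open>Directions at critical points and construction of fold charts\<close>

context harmonic_map
begin

text \<open>Since \<open>\<psi>' = wronsk / g'\<^sup>2\<close>, the zeros of \<open>wronsk\<close> on the critical set are those of \<open>\<psi>'\<close> and of
  \<open>h' = g' = 0\<close>. The vector \<open>dir c\<close> is the derivative of the coordinate \<open>c h + cnj c g\<close>; at a critical
  point all \<open>dir c\<close> lie on one real line, and \<open>degenerate\<close> consists of the critical points at which
  the kernel of the derivative of \<open>f\<close> is tangent to the critical set or \<open>wronsk\<close> vanishes.\<close>

definition wronsk :: "complex \<Rightarrow> complex" where
  "wronsk z = deriv (deriv h) z * deriv g z - deriv h z * deriv (deriv g) z"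

definition dir :: "complex \<Rightarrow> complex \<Rightarrow> complex" where
  "dir c z = c * deriv h z + cnj c * deriv g z"

definition degenerate :: "complex set" where
  "degenerate = {z \<in> crit_set f. \<forall>c. Im (wronsk z * cnj (dir c z) ^ 3) = 0}"

text \<open>For the differential \<open>df\<close> of \<open>f\<close> one has
  \<open>Re (c * df v) = Re (dir c z * v)\<close>, so kernel vectors are orthogonal to every
  \<open>cnj (dir c z)\<close>; at a critical point the kernel is nontrivial, which leaves one real
  line. In the computation, equality of the moduli of \<open>h'\<close> and \<open>g'\<close> turns
  the product into a sum of conjugate pairs.\<close>

lemma dir_collinear:
  assumes "z \<in> crit_set f"
  shows "Im (dir c' z * cnj (dir c z)) = 0"
proof -
  let ?a = "deriv h z" and ?b = "deriv g z"
  have "?a * cnj ?a = ?b * cnj ?b"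
    using assms by (simp add: crit_iff complex_norm_square[symmetric])
  then have "dir c' z * cnj (dir c z) =
      (c' * cnj c + cnj (c' * cnj c)) * (?a * cnj ?a) + (c' * c * ?a * cnj ?b + cnj (c' * c * ?a * cnj ?b))"
    by (simp add: dir_def algebra_simps)
  moreover have "?a * cnj ?a = of_real ((cmod ?a)\<^sup>2)"
    by (rule complex_norm_square[symmetric])
  ultimately show ?thesis
    by (simp only: complex_add_cnj) simp
qed

text \<open>All \<open>dir c' z\<close> are real multiples, by some \<open>t\<close>, of a nonzero
  \<open>dir c z\<close>, and the cubic expression scales by \<open>t ^ 3\<close>. So the quantifier
  over \<open>c\<close> in \<open>degenerate\<close> can be tested at one nonzero direction; in the
  definition it makes the set closed and includes the points where all directions vanish.\<close>

lemma degenerate_dir: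
  assumes z: "z \<in> crit_set f" and nz: "dir c z \<noteq> 0"
    and zero: "Im (wronsk z * cnj (dir c z) ^ 3) = 0"
  shows "z \<in> degenerate"
proof -
  have "Im (wronsk z * cnj (dir c' z) ^ 3) = 0" for c'
  proof -
    define t where "t = Re (dir c' z * cnj (dir c z)) / (cmod (dir c z))\<^sup>2"
    have "dir c' z * cnj (dir c z) = of_real (Re (dir c' z * cnj (dir c z)))"
      using dir_collinear[OF z, of c' c] by (simp only: complex_eq_iff) simp
    then have "dir c' z * cnj (dir c z) * dir c z = of_real (Re (dir c' z * cnj (dir c z))) * dir c z"
      by simp
    moreover have "dir c' z * cnj (dir c z) * dir c z = dir c' z * of_real ((cmod (dir c z))\<^sup>2)"
      by (simp only: complex_norm_square mult_ac)
    ultimately have "dir c' z = of_real t * dir c z"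
      using nz by (simp add: t_def field_simps)
    then have "wronsk z * cnj (dir c' z) ^ 3 = of_real (t ^ 3) * (wronsk z * cnj (dir c z) ^ 3)"
      by (simp add: power_mult_distrib mult_ac)
    then show ?thesis
      using zero by (metis Im_complex_of_real Re_complex_of_real mult_zero_right mult_zero_left add_0 times_complex.sel(2))
  qed
  then show ?thesis
    using z by (simp add: degenerate_def)
qed

text \<open>The equation says \<open>c\<^sup>2 = g' / h'\<close>, a unimodular number at a critical
  point. With this \<open>c\<close> the rotated differential is
  \<open>v |-> 2 * Re (c * h' * v)\<close>, so the image direction at \<open>z\<close> becomes the
  real axis.\<close>

lemma crit_unit_dir:
  assumes "z \<in> crit_set f" "deriv h z \<noteq> 0"
  obtains c where "cmod c = 1" "c * deriv h z = cnj c * deriv g z"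
proof -
  define c where "c = csqrt (deriv g z / deriv h z)"
  have sq: "c\<^sup>2 = deriv g z / deriv h z"
    by (simp add: c_def)
  have c1: "cmod c = 1"
    using assms unfolding c_def crit_iff by (auto simp: norm_divide)
  then have cc: "cnj c * c = 1"
    by (metis complex_norm_square mult.commute of_real_1 one_power2)
  have "cnj c * deriv g z = cnj c * (c\<^sup>2 * deriv h z)"
    using assms(2) by (simp add: sq)
  also have "\<dots> = (cnj c * c) * (c * deriv h z)"
    by (simp only: power2_eq_square mult_ac)
  finally show ?thesis
    using that c1 cc by simp
qed

text \<open>With \<open>\<zeta> = H z\<close> as local coordinate, the rotated map becomes
  \<open>\<zeta> \<mapsto> Re \<zeta> + \<i> Im (K \<zeta>)\<close> with \<open>K\<close> holomorphic; its folds are the zeros of \<open>Re K'\<close>.\<close>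

lemma straightening:
  assumes z0: "z0 \<in> crit_set f" and nz: "deriv h z0 \<noteq> 0"
    and c: "cmod c = 1" "c * deriv h z0 = cnj c * deriv g z0" and "e > 0"
  obtains r H G K where "0 < r" "r \<le> e" "open (H ` ball z0 r)" "inj_on H (ball z0 r)" "continuous_on UNIV H"
    "K holomorphic_on H ` ball z0 r" "\<And>z. z \<in> ball z0 r \<Longrightarrow> G (H z) = z"
    "\<And>z. Re (c * f z) = Re (H z)"
    "\<And>z. z \<in> ball z0 r \<Longrightarrow> Im (c * f z) = Im (K (H z))"
    "\<And>z. z \<in> ball z0 r \<Longrightarrow> dir c z \<noteq> 0"
    "\<And>z. z \<in> ball z0 r \<Longrightarrow> z \<in> crit_set f \<longleftrightarrow> Re (deriv K (H z)) = 0"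
    "\<And>z. z \<in> ball z0 r \<Longrightarrow> deriv (deriv K) (H z) = 2 * wronsk z / dir c z ^ 3"
    "deriv K (H z0) = 0"
proof -
  \<comment> \<open>Since \<open>c * f = c * h + cnj (cnj c * g)\<close>, the real part of
    \<open>c * f\<close> is that of \<open>H\<close> and its imaginary part is that of
    \<open>L\<close>. Hence \<open>K\<close> is \<open>L\<close> read in the coordinate
    \<open>H\<close>.\<close>
  define H where "H = (\<lambda>z. c * h z + cnj c * g z)"
  define L where "L = (\<lambda>z. c * h z - cnj c * g z)"
  define L' where "L' = (\<lambda>z. c * deriv h z - cnj c * deriv g z)"
  have cc: "c * cnj c = 1"
    using c(1) by (metis complex_norm_square of_real_1 one_power2)
  have H': "(H has_field_derivative dir c z) (at z)" for z
    unfolding H_def dir_def by (auto intro!: derivative_eq_intros h_deriv g_deriv)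
  have L_der: "(L has_field_derivative L' z) (at z)" for z
    unfolding L_def L'_def by (auto intro!: derivative_eq_intros h_deriv g_deriv)
  have dh: "(deriv h has_field_derivative deriv (deriv h) z) (at z)"
       "(deriv g has_field_derivative deriv (deriv g) z) (at z)" for z
    using holo_derivs(1,2)[of UNIV] holomorphic_derivI by blast+
  have holH: "H holomorphic_on A" for A
    using H' by (auto simp: holomorphic_on_def field_differentiable_def intro: has_field_derivative_at_within)
  have holL: "L holomorphic_on A" for A
    using L_der by (auto simp: holomorphic_on_def field_differentiable_def intro: has_field_derivative_at_within)
  have "dir c z0 = 2 * (c * deriv h z0)"
    using c(2) by (simp add: dir_def)
  then have d0: "dir c z0 \<noteq> 0"
    using nz cc by auto
  have "isCont (dir c) z0"
    unfolding dir_def using continuous_derivs(1,2)[of UNIV]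
    by (auto intro!: continuous_intros simp: continuous_on_eq_continuous_at)
  then obtain r1 where r1: "r1 > 0" "\<And>z. dist z0 z < r1 \<Longrightarrow> dir c z \<noteq> 0"
    using continuous_at_avoid[of z0 "dir c" 0] d0 by auto
  have "open (ball z0 (min e r1))" "z0 \<in> ball z0 (min e r1)"
    using r1 \<open>e > 0\<close> by auto
  then obtain r where r: "r > 0" "ball z0 r \<subseteq> ball z0 (min e r1)" "open (H ` ball z0 r)" "inj_on H (ball z0 r)"
    using has_complex_derivative_locally_invertible[OF holH, of z0 "ball z0 (min e r1)"] d0
      DERIV_imp_deriv[OF H'] by metis
  then have rle: "r \<le> e" "r \<le> r1"
    using ball_subset_ball_iff[of z0 r z0 "min e r1"] by auto
  have nzd: "dir c z \<noteq> 0" if "z \<in> ball z0 r" for z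
    using r1(2) that rle by auto
  obtain G where G: "G holomorphic_on (H ` ball z0 r)"
      "\<And>z. z \<in> ball z0 r \<Longrightarrow> deriv H z * deriv G (H z) = 1"
      "\<And>z. z \<in> ball z0 r \<Longrightarrow> G (H z) = z"
    using holomorphic_has_inverse[OF holH open_ball r(4)] by metis
  have G_der: "(G has_field_derivative 1 / dir c z) (at (H z))" if "z \<in> ball z0 r" for z
  proof -
    have "deriv G (H z) = 1 / dir c z"
      using G(2)[OF that] nzd[OF that] DERIV_imp_deriv[OF H'[of z]] by (simp add: field_simps)
    moreover have "(G has_field_derivative deriv G (H z)) (at (H z))"
      using G(1) r(3) that holomorphic_derivI by blast
    ultimately show ?thesis
      by simp
  qed
  define K where "K = L \<circ> G"
  have K_der: "(K has_field_derivative L' z / dir c z) (at (H z))" if "z \<in> ball z0 r" for z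
    using DERIV_chain[of L "L' z" G "H z" "1 / dir c z"] L_der G_der[OF that] G(3)[OF that]
    by (simp add: K_def)
  have K': "deriv K \<zeta> = L' (G \<zeta>) / dir c (G \<zeta>)" if "\<zeta> \<in> H ` ball z0 r" for \<zeta>
    using that DERIV_imp_deriv[OF K_der] G(3) by auto
  have holK: "K holomorphic_on H ` ball z0 r"
    unfolding K_def by (intro holomorphic_on_compose G holL)
  have fH: "Re (c * f z) = Re (H z)" "Im (c * f z) = Im (L z)" for z
    by (simp_all add: f_eq H_def L_def algebra_simps)
  have crit: "z \<in> crit_set f \<longleftrightarrow> Re (deriv K (H z)) = 0" if "z \<in> ball z0 r" for z
  proof -
    let ?a = "c * deriv h z" and ?b = "cnj c * deriv g z"
    have "Re (L' z / dir c z) = Re (L' z * cnj (dir c z)) / (cmod (dir c z))\<^sup>2"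
      by (subst complex_div_cnj) (simp only: Re_divide_of_real flip: of_real_power)
    also have "Re (L' z * cnj (dir c z)) = (cmod ?a)\<^sup>2 - (cmod ?b)\<^sup>2"
    proof -
      have "Re ((A - B) * cnj (A + B)) = (cmod A)\<^sup>2 - (cmod B)\<^sup>2" for A B
        by (simp only: cmod_power2) (simp add: power2_eq_square algebra_simps)
      then show ?thesis
        unfolding L'_def dir_def .
    qed
    finally have "Re (deriv K (H z)) = ((cmod (deriv h z))\<^sup>2 - (cmod (deriv g z))\<^sup>2) / (cmod (dir c z))\<^sup>2"
      using K'[of "H z"] that G(3) c(1) by (simp add: norm_mult)
    then show ?thesis
      using nzd[OF that] by (simp add: crit_iff)
  qed
  \<comment> \<open>In the quotient rule the numerator collapses to
    \<open>2 * (c * cnj c) * wronsk z\<close>; the chain rule through \<open>G\<close> supplies the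
    third factor \<open>1 / dir c z\<close>.\<close>
  have K'': "deriv (deriv K) (H z) = 2 * wronsk z / dir c z ^ 3" if z: "z \<in> ball z0 r" for z
  proof -
    let ?D = "\<lambda>z. c * deriv (deriv h) z + cnj c * deriv (deriv g) z"
    let ?E = "\<lambda>z. c * deriv (deriv h) z - cnj c * deriv (deriv g) z"
    have "((\<lambda>z. L' z / dir c z) has_field_derivative (?E z * dir c z - L' z * ?D z) / (dir c z * dir c z)) (at z)"
      unfolding L'_def dir_def using nzd[OF z]
      by (auto intro!: derivative_eq_intros dh simp: dir_def mult.commute)
    also have "?E z * dir c z - L' z * ?D z = 2 * (c * cnj c) * wronsk z"
      by (simp add: L'_def dir_def wronsk_def algebra_simps)
    finally have "((\<lambda>z. L' z / dir c z) has_field_derivative 2 * wronsk z / (dir c z)\<^sup>2) (at (G (H z)))"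
      using cc G(3)[OF z] by (simp add: power2_eq_square)
    from DERIV_chain[OF this G_der[OF z]]
    have "((\<lambda>\<zeta>. L' (G \<zeta>) / dir c (G \<zeta>)) has_field_derivative 2 * wronsk z / dir c z ^ 3) (at (H z))"
      by (simp add: o_def power2_eq_square power3_eq_cube)
    then have "(deriv K has_field_derivative 2 * wronsk z / dir c z ^ 3) (at (H z))"
      by (rule has_field_derivative_transform_within_open[OF _ r(3)]) (use z K' in auto)
    then show ?thesis
      by (rule DERIV_imp_deriv)
  qed
  show ?thesis
  proof (rule that[of r H K G])
    show "continuous_on UNIV H"
      by (rule holomorphic_on_imp_continuous_on[OF holH])
    show "deriv K (H z0) = 0"
      using K'[of "H z0"] r(1) G(3) c(2) by (simp add: L'_def)
    show "Im (c * f z) = Im (K (H z))" if "z \<in> ball z0 r" for z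
      using fH(2) G(3)[OF that] by (simp add: K_def)
  qed (use r rle holK G fH nzd crit K'' in auto)
qed

text \<open>In the rotated coordinates \<open>c (w - f z0)\<close> the image of the fold is part of the graph of \<open>m\<close>,
  tangent to the real axis at \<open>0\<close>; the sign of \<open>c\<close> is chosen so that the doubly covered side is above.\<close>

definition fold_chart :: "complex \<Rightarrow> complex set \<Rightarrow> complex \<Rightarrow> (real \<Rightarrow> real) \<Rightarrow> real \<Rightarrow> bool" where
  "fold_chart z0 U c m \<delta> \<longleftrightarrow> cmod c = 1 \<and> \<delta> > 0 \<and>
     (\<forall>x. 0 < \<bar>x\<bar> \<and> \<bar>x\<bar> < \<delta> \<longrightarrow> m x < 0) \<and> (\<exists>C. \<forall>x. \<bar>x\<bar> < \<delta> \<longrightarrow> \<bar>m x\<bar> \<le> C * x\<^sup>2) \<and>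
     (\<forall>w. \<bar>Re (c * (w - f z0))\<bar> < \<delta> \<and> \<bar>Im (c * (w - f z0))\<bar> < \<delta> \<longrightarrow>
        (m (Re (c * (w - f z0))) < Im (c * (w - f z0)) \<longrightarrow> card {z\<in>U. f z = w} = 2) \<and>
        (Im (c * (w - f z0)) < m (Re (c * (w - f z0))) \<longrightarrow> {z\<in>U. f z = w} = {}) \<and>
        (\<forall>z \<in> U \<inter> crit_set f. f z = w \<longrightarrow> Im (c * (w - f z0)) = m (Re (c * (w - f z0)))) \<and>
        card {z \<in> U \<inter> crit_set f. f z = w} \<le> 1)"

text \<open>Near \<open>H z0\<close> one has \<open>- Im K'' > \<kappa>\<close> and
  \<open>cmod K'' \<le> M\<close>. The first bound makes \<open>Im K\<close> uniformly convex on
  vertical segments of half-length \<open>\<eta>\<close>; the second keeps \<open>K\<close> and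
  \<open>K'\<close> small along the horizontal line. Over an interval
  \<open>\<bar>x\<bar> < \<delta>\<close> that is short compared with \<open>\<eta>\<close>,
  convexity wins: the minimum on each vertical segment is interior, and its value defines
  \<open>m x\<close>.\<close>

lemma fold_chart_exists:
  assumes z0: "z0 \<in> crit_set f" "z0 \<notin> degenerate" and e: "e > 0"
  shows "\<exists>U. open U \<and> z0 \<in> U \<and> U \<subseteq> ball z0 e \<and> (\<exists>c m \<delta>. fold_chart z0 U c m \<delta>)"
proof -
  have nz: "deriv h z0 \<noteq> 0"
  proof
    assume "deriv h z0 = 0"
    then have "dir c z0 = 0" for c
      using z0(1) by (simp add: crit_iff dir_def)
    then show False
      using z0 by (simp add: degenerate_def)
  qed
  \<comment> \<open>The equation for \<open>c\<close> also holds for \<open>- c\<close>, which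
    changes the sign of \<open>dir c z0 ^ 3\<close>. Nondegeneracy makes the imaginary part nonzero,
    so one of the two choices has the wanted sign.\<close>
  obtain c where c: "cmod c = 1" "c * deriv h z0 = cnj c * deriv g z0" "Im (wronsk z0 / dir c z0 ^ 3) < 0"
  proof -
    obtain c where c: "cmod c = 1" "c * deriv h z0 = cnj c * deriv g z0"
      using crit_unit_dir[OF z0(1) nz] by metis
    have "dir c z0 = 2 * (c * deriv h z0)"
      using c(2) by (simp add: dir_def)
    then have d0: "dir c z0 \<noteq> 0"
      using nz c(1) by auto
    have "wronsk z0 / dir c z0 ^ 3 = wronsk z0 * cnj (dir c z0) ^ 3 / of_real ((cmod (dir c z0) ^ 3)\<^sup>2)"
      by (subst complex_div_cnj) (simp add: norm_power)
    then have "Im (wronsk z0 / dir c z0 ^ 3) = Im (wronsk z0 * cnj (dir c z0) ^ 3) / (cmod (dir c z0) ^ 3)\<^sup>2"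
      by (simp only: Im_divide_of_real)
    then have ne: "Im (wronsk z0 / dir c z0 ^ 3) \<noteq> 0"
      using degenerate_dir[OF z0(1) d0] z0(2) d0 by auto
    have dm: "dir (- c) z0 ^ 3 = - (dir c z0 ^ 3)"
      by (simp add: dir_def power3_eq_cube algebra_simps)
    show ?thesis
    proof (cases "Im (wronsk z0 / dir c z0 ^ 3) < 0")
      case False
      then have "Im (wronsk z0 / dir (- c) z0 ^ 3) < 0"
        using ne unfolding dm by simp
      then show ?thesis
        using that[of "- c"] c by simp
    qed (use that c in blast)
  qed
  obtain r H G K where r: "0 < r" "r \<le> e" "open (H ` ball z0 r)" "inj_on H (ball z0 r)" "continuous_on UNIV H"
    and K: "K holomorphic_on H ` ball z0 r" and G: "\<And>z. z \<in> ball z0 r \<Longrightarrow> G (H z) = z"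
    and ReH: "\<And>z. Re (c * f z) = Re (H z)"
    and ImK: "\<And>z. z \<in> ball z0 r \<Longrightarrow> Im (c * f z) = Im (K (H z))"
    and crit: "\<And>z. z \<in> ball z0 r \<Longrightarrow> z \<in> crit_set f \<longleftrightarrow> Re (deriv K (H z)) = 0"
    and K'': "\<And>z. z \<in> ball z0 r \<Longrightarrow> deriv (deriv K) (H z) = 2 * wronsk z / dir c z ^ 3"
    and K'0: "deriv K (H z0) = 0"
    by (rule straightening[OF z0(1) nz c(1,2) e]) blast
  define k0 where "k0 = H z0"
  define V where "V = H ` ball z0 r"
  have k0V: "k0 \<in> V" "open V"
    using r by (auto simp: k0_def V_def)
  have hK: "K holomorphic_on V" "deriv K holomorphic_on V" "deriv (deriv K) holomorphic_on V"
    using K k0V holomorphic_deriv unfolding V_def by blast+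
  \<comment> \<open>Half of \<open>- Im K''\<close> at the centre, so that perturbing
    \<open>K''\<close> by less than \<open>\<kappa>\<close> still leaves more than
    \<open>\<kappa>\<close>.\<close>
  define \<kappa> where "\<kappa> = - Im (deriv (deriv K) k0) / 2"
  have kpos: "\<kappa> > 0"
  proof -
    define u where "u = wronsk z0 / dir c z0 ^ 3"
    have "deriv (deriv K) k0 = 2 * u"
      using K''[of z0] r(1) by (simp add: k0_def u_def)
    moreover have "Im u < 0"
      using c(3) by (simp add: u_def)
    ultimately show ?thesis
      by (simp add: \<kappa>_def)
  qed
  define M where "M = cmod (deriv (deriv K) k0) + \<kappa>"
  have Mpos: "M > 0"
    using kpos by (simp add: M_def add_nonneg_pos)
  obtain R where R: "R > 0" "ball k0 R \<subseteq> V" "\<And>\<zeta>. \<zeta> \<in> ball k0 R \<Longrightarrow> cmod (deriv (deriv K) \<zeta> - deriv (deriv K) k0) < \<kappa>"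
  proof -
    have "isCont (deriv (deriv K)) k0"
      using hK(3) k0V holomorphic_on_imp_continuous_on continuous_on_eq_continuous_at by blast
    then obtain d where d: "d > 0" "\<And>\<zeta>. dist \<zeta> k0 < d \<Longrightarrow> dist (deriv (deriv K) \<zeta>) (deriv (deriv K) k0) < \<kappa>"
      unfolding continuous_at_eps_delta using kpos by blast
    obtain d' where d': "d' > 0" "ball k0 d' \<subseteq> V"
      using k0V openE by blast
    show ?thesis
      by (rule that[of "min d d'"]) (use d d' in \<open>auto simp: dist_commute dist_norm[symmetric]\<close>)
  qed
  have K2_im: "- Im (deriv (deriv K) \<zeta>) > \<kappa>" and K2_norm: "cmod (deriv (deriv K) \<zeta>) \<le> M" if "\<zeta> \<in> ball k0 R" for \<zeta>
  proof -
    have "\<bar>Im (deriv (deriv K) \<zeta> - deriv (deriv K) k0)\<bar> < \<kappa>"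
      using R(3)[OF that] abs_Im_le_cmod order_le_less_trans by blast
    then show "- Im (deriv (deriv K) \<zeta>) > \<kappa>"
      by (simp add: \<kappa>_def)
    have "cmod (deriv (deriv K) \<zeta>) \<le> cmod (deriv (deriv K) k0) + cmod (deriv (deriv K) \<zeta> - deriv (deriv K) k0)"
      by (rule norm_triangle_sub)
    then show "cmod (deriv (deriv K) \<zeta>) \<le> M"
      using R(3)[OF that] by (simp add: M_def)
  qed
  have K_der: "(K has_field_derivative deriv K \<zeta>) (at \<zeta> within A)"
       "(deriv K has_field_derivative deriv (deriv K) \<zeta>) (at \<zeta> within A)" if "\<zeta> \<in> ball k0 R" for \<zeta> A
    using hK k0V R(2) that holomorphic_derivI by blast+
  have K1_norm: "cmod (deriv K \<zeta>) \<le> M * cmod (\<zeta> - k0)" if "\<zeta> \<in> ball k0 R" for \<zeta>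
  proof -
    have "cmod (deriv K \<zeta> - deriv K k0) \<le> M * cmod (\<zeta> - k0)"
      by (rule field_differentiable_bound[of "ball k0 R" _ "deriv (deriv K)"])
        (use that R(1) K_der K2_norm in auto)
    then show ?thesis
      using K'0 by (simp add: k0_def)
  qed
  have K0_norm: "cmod (K \<zeta> - K k0) \<le> M * (cmod (\<zeta> - k0))\<^sup>2" if "\<zeta> \<in> ball k0 R" for \<zeta>
  proof -
    let ?\<rho> = "cmod (\<zeta> - k0)"
    have sub: "cball k0 ?\<rho> \<subseteq> ball k0 R"
      using that by (auto simp: dist_norm norm_minus_commute)
    have "cmod (deriv K \<xi>) \<le> M * ?\<rho>" if "\<xi> \<in> cball k0 ?\<rho>" for \<xi>
    proof -
      have "cmod (deriv K \<xi>) \<le> M * cmod (\<xi> - k0)"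
        using K1_norm sub that by blast
      also have "\<dots> \<le> M * ?\<rho>"
        using that Mpos by (simp add: dist_norm norm_minus_commute)
      finally show ?thesis .
    qed
    then have "cmod (K \<zeta> - K k0) \<le> M * ?\<rho> * cmod (\<zeta> - k0)"
      by (intro field_differentiable_bound[of "cball k0 ?\<rho>" _ "deriv K"] K_der(1)[OF subsetD[OF sub]])
        (auto simp: dist_norm norm_minus_commute)
    then show ?thesis
      by (simp add: power2_eq_square mult.assoc)
  qed
  \<comment> \<open>With \<open>R / 2\<close> the rectangle \<open>\<bar>x\<bar> < \<eta>\<close>,
    \<open>\<bar>y\<bar> \<le> \<eta>\<close> fits into the disc, because
    \<open>\<bar>x\<bar> + \<bar>y\<bar> < R\<close>.\<close>
  define \<eta> where "\<eta> = R / 2"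
  have eta: "\<eta> > 0"
    using R by (simp add: \<eta>_def)
  define P where "P = (\<lambda>x y. k0 + of_real x + of_real y * \<i>)"
  have P_ball: "P x y \<in> ball k0 R" if "\<bar>x\<bar> < \<eta>" "\<bar>y\<bar> \<le> \<eta>" for x y
  proof -
    have "cmod (of_real x + of_real y * \<i>) \<le> \<bar>x\<bar> + \<bar>y\<bar>"
      by (rule order_trans[OF norm_triangle_ineq]) (simp add: norm_mult)
    also have "\<dots> < R"
      using that by (simp add: \<eta>_def)
    finally show ?thesis
      unfolding P_def mem_ball dist_commute[of k0] by (simp add: dist_norm add.assoc)
  qed
  define k where "k = (\<lambda>x y. Im (K (P x y)) - Im (K k0))"
  \<comment> \<open>The vertical derivative of \<open>Im K\<close> is
    \<open>Im (K' * \<i>) = Re K'\<close>. It vanishes exactly at the critical points of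
    \<open>f\<close>, so the folds are the critical points of \<open>k x\<close>.\<close>
  define k' where "k' = (\<lambda>x y. Re (deriv K (P x y)))"
  have k_der: "(k x has_real_derivative k' x y) (at y)" 
    and k'_der: "(k' x has_real_derivative - Im (deriv (deriv K) (P x y))) (at y)"
    if "\<bar>x\<bar> < \<eta>" "\<bar>y\<bar> \<le> \<eta>" for x y
  proof -
    have "((\<lambda>t. Im (K (k0 + of_real x + of_real t * \<i>))) has_real_derivative Im (deriv K (P x y) * \<i>)) (at y)"
      by (rule has_real_derivative_along_line) (use K_der(1)[OF P_ball[OF that]] in \<open>simp add: P_def\<close>)
    from DERIV_diff[OF this DERIV_const[of "Im (K k0)"]] show "(k x has_real_derivative k' x y) (at y)"
      unfolding k_def k'_def P_def by simp
    have "((\<lambda>t. Re (deriv K (k0 + of_real x + of_real t * \<i>))) has_real_derivative Re (deriv (deriv K) (P x y) * \<i>)) (at y)"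
      by (rule has_real_derivative_along_line) (use K_der(2)[OF P_ball[OF that]] in \<open>simp add: P_def\<close>)
    then show "(k' x has_real_derivative - Im (deriv (deriv K) (P x y))) (at y)"
      unfolding k'_def P_def by simp
  qed
  have k'_mono: "\<kappa> * (y2 - y1) \<le> k' x y2 - k' x y1" if x: "\<bar>x\<bar> < \<eta>" and y: "-\<eta> \<le> y1" "y1 \<le> y2" "y2 \<le> \<eta>" for x y1 y2
  proof -
    have "k' x y1 - \<kappa> * y1 \<le> k' x y2 - \<kappa> * y2"
    proof (rule DERIV_nonneg_imp_nondecreasing[OF y(2)])
      fix t assume "y1 \<le> t" "t \<le> y2"
      then have t: "\<bar>t\<bar> \<le> \<eta>"
        using y by auto
      have "((\<lambda>t. k' x t - \<kappa> * t) has_real_derivative - Im (deriv (deriv K) (P x t)) - \<kappa>) (at t)"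
        by (auto intro!: derivative_eq_intros k'_der x t)
      then show "\<exists>l. ((\<lambda>t. k' x t - \<kappa> * t) has_real_derivative l) (at t) \<and> 0 \<le> l"
        using K2_im[OF P_ball[OF x t]] by (intro exI conjI) auto
    qed
    then show ?thesis
      by (simp add: algebra_simps)
  qed
  have k'_strict: "k' x y1 < k' x y2" if "\<bar>x\<bar> < \<eta>" "-\<eta> \<le> y1" "y1 < y2" "y2 \<le> \<eta>" for x y1 y2
    using k'_mono[of x y1 y2] that kpos mult_pos_pos[of \<kappa> "y2 - y1"] by linarith
  \<comment> \<open>The uniform growth of \<open>k'\<close> integrates to a quadratic minorant of
    \<open>k x\<close>.\<close>
  have k_lower: "k x 0 + k' x 0 * y + \<kappa> / 2 * y\<^sup>2 \<le> k x y" if x: "\<bar>x\<bar> < \<eta>" and y: "\<bar>y\<bar> \<le> \<eta>" for x y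
  proof -
    define q where "q = (\<lambda>t. k x t - k' x 0 * t - \<kappa> / 2 * t\<^sup>2)"
    have q_der: "(q has_real_derivative k' x t - k' x 0 - \<kappa> * t) (at t)" if "\<bar>t\<bar> \<le> \<eta>" for t
      unfolding q_def by (auto intro!: derivative_eq_intros k_der x that)
    have "q 0 \<le> q y"
    proof (cases "0 \<le> y")
      case True
      then show ?thesis
      proof (rule DERIV_nonneg_imp_nondecreasing)
        fix t assume "0 \<le> t" "t \<le> y"
        then show "\<exists>l. (q has_real_derivative l) (at t) \<and> 0 \<le> l"
          using q_der[of t] k'_mono[OF x, of 0 t] y by (intro exI[of _ "k' x t - k' x 0 - \<kappa> * t"]) auto
      qed
    next
      case False
      then have "y \<le> 0"
        by simp
      then show ?thesis
      proof (rule DERIV_nonpos_imp_nonincreasing)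
        fix t assume "y \<le> t" "t \<le> 0"
        then show "\<exists>l. (q has_real_derivative l) (at t) \<and> l \<le> 0"
          using q_der[of t] k'_mono[OF x, of t 0] y by (intro exI[of _ "k' x t - k' x 0 - \<kappa> * t"]) auto
      qed
    qed
    then show ?thesis
      by (simp add: q_def)
  qed
  have P0: "cmod (P x 0 - k0) = \<bar>x\<bar>" for x
    by (simp add: P_def)
  have k0_abs: "\<bar>k x 0\<bar> \<le> M * x\<^sup>2" if "\<bar>x\<bar> < \<eta>" for x
  proof -
    have "\<bar>k x 0\<bar> \<le> cmod (K (P x 0) - K k0)"
      unfolding k_def by (metis abs_Im_le_cmod minus_complex.sel(2))
    also have "\<dots> \<le> M * x\<^sup>2"
      using K0_norm[OF P_ball[OF that, of 0]] eta P0 by simp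
    finally show ?thesis .
  qed
  have k'0_abs: "\<bar>k' x 0\<bar> \<le> M * \<bar>x\<bar>" if "\<bar>x\<bar> < \<eta>" for x
  proof -
    have "\<bar>k' x 0\<bar> \<le> cmod (deriv K (P x 0))"
      unfolding k'_def by (rule abs_Re_le_cmod)
    also have "\<dots> \<le> M * \<bar>x\<bar>"
      using K1_norm[OF P_ball[OF that, of 0]] eta P0 by simp
    finally show ?thesis .
  qed
  \<comment> \<open>Here harmonicity enters: along the horizontal line \<open>- Im K\<close> has the
    second derivative \<open>- Im K'' > 0\<close>, and its first derivative vanishes at
    \<open>k0\<close> because \<open>K'\<close> does.\<close>
  have k_neg: "k x 0 < 0" if x: "0 < \<bar>x\<bar>" "\<bar>x\<bar> < \<eta>" for x
  proof -
    define a where "a = \<bar>x\<bar>"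
    have ba: "k0 + of_real t * 1 \<in> ball k0 R" if "t \<in> {-a..a}" for t
      using that x P_ball[of t 0] eta by (auto simp: a_def P_def)
    define p p' where "p = (\<lambda>t. - Im (K (k0 + of_real t * 1)))" and "p' = (\<lambda>t. - Im (deriv K (k0 + of_real t * 1)))"
    have p_der: "(p has_real_derivative p' t) (at t)" 
      and p'_der: "(p' has_real_derivative - Im (deriv (deriv K) (k0 + of_real t * 1))) (at t)" if "t \<in> {-a..a}" for t
      unfolding p_def p'_def
      using has_real_derivative_along_line(2)[of K "deriv K (k0 + of_real t * 1)" k0 t 1]
         has_real_derivative_along_line(2)[of "deriv K" "deriv (deriv K) (k0 + of_real t * 1)" k0 t 1]
         K_der[OF ba[OF that]] by (auto intro!: DERIV_minus)
    have p'_mono: "p' s < p' t" if "-a \<le> s" "s < t" "t \<le> a" for s t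
    proof (rule DERIV_pos_imp_increasing[OF \<open>s < t\<close>])
      fix u assume "s \<le> u" "u \<le> t"
      then show "\<exists>l. (p' has_real_derivative l) (at u) \<and> 0 < l"
        using p'_der[of u] K2_im[OF ba[of u]] kpos that
        by (intro exI[of _ "- Im (deriv (deriv K) (k0 + of_real u * 1))"]) auto
    qed
    have "p 0 < p x"
      by (rule convex_min[of "-a" a p p'])
        (use p_der p'_mono x K'0 in \<open>auto simp: a_def p'_def k0_def\<close>)
    then show ?thesis
      by (simp add: p_def k_def P_def)
  qed
  have k'00: "k' 0 0 = 0" and k00: "k 0 0 = 0"
    using K'0 by (simp_all add: k'_def k_def P_def k0_def)
  \<comment> \<open>\<open>M * \<delta> < \<kappa> * \<eta>\<close> fixes the signs of
    \<open>k'\<close> at the ends of each vertical segment. The last inequality lifts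
    \<open>k x\<close> above \<open>\<delta>\<close> at both ends, so every \<open>v\<close> with
    \<open>\<bar>v\<bar> < \<delta>\<close> lies below both end values.\<close>
  obtain \<delta> where \<delta>: "\<delta> > 0" "\<delta> \<le> \<eta>" "M * \<delta> < \<kappa> * \<eta>" "\<delta> + M * \<delta>\<^sup>2 + M * \<delta> * \<eta> < \<kappa> / 2 * \<eta>\<^sup>2"
  proof -
    have "((\<lambda>\<delta>. \<delta> + M * \<delta>\<^sup>2 + M * \<delta> * \<eta>) \<longlongrightarrow> 0 + M * 0\<^sup>2 + M * 0 * \<eta>) (at_right 0)"
      by (intro tendsto_intros)
    then have 1: "\<forall>\<^sub>F \<delta> in at_right 0. \<delta> + M * \<delta>\<^sup>2 + M * \<delta> * \<eta> < \<kappa> / 2 * \<eta>\<^sup>2"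
      by (rule order_tendstoD(2)) (use kpos eta in simp)
    have "((\<lambda>\<delta>. M * \<delta>) \<longlongrightarrow> M * 0) (at_right 0)"
      by (intro tendsto_intros)
    then have 2: "\<forall>\<^sub>F \<delta> in at_right 0. M * \<delta> < \<kappa> * \<eta>"
      by (rule order_tendstoD(2)) (use kpos eta in simp)
    have 3: "\<forall>\<^sub>F \<delta> in at_right 0. \<delta> \<in> {0<..<\<eta>}"
      by (rule eventually_at_right_real[OF eta])
    from 1 2 3 have "\<forall>\<^sub>F \<delta> in at_right 0. \<delta> > 0 \<and> \<delta> \<le> \<eta> \<and> M * \<delta> < \<kappa> * \<eta> \<and> \<delta> + M * \<delta>\<^sup>2 + M * \<delta> * \<eta> < \<kappa> / 2 * \<eta>\<^sup>2"
      by eventually_elim auto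
    then show ?thesis
      using that eventually_happens trivial_limit_at_right_real by blast
  qed
  have small: "\<bar>x\<bar> < \<eta>" if "\<bar>x\<bar> < \<delta>" for x
    using that \<delta> by simp
  have ends: "\<delta> < k x (-\<eta>) \<and> \<delta> < k x \<eta> \<and> k' x (-\<eta>) < 0 \<and> 0 < k' x \<eta>" if x: "\<bar>x\<bar> < \<delta>" for x
  proof -
    have "M * x\<^sup>2 \<le> M * \<delta>\<^sup>2"
      using Mpos x by (intro mult_left_mono) (auto simp: abs_le_square_iff[symmetric])
    then have 1: "- (M * \<delta>\<^sup>2) \<le> k x 0"
      using k0_abs[OF small[OF x]] by linarith
    have 2: "\<bar>k' x 0\<bar> \<le> M * \<delta>"
      using k'0_abs[OF small[OF x]] mult_left_mono[of "\<bar>x\<bar>" \<delta> M] Mpos x by linarith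
    then have 3: "\<bar>k' x 0 * \<eta>\<bar> \<le> M * \<delta> * \<eta>"
      using eta by (simp add: abs_mult)
    have "k x 0 - k' x 0 * \<eta> + \<kappa> / 2 * \<eta>\<^sup>2 \<le> k x (-\<eta>)" "k x 0 + k' x 0 * \<eta> + \<kappa> / 2 * \<eta>\<^sup>2 \<le> k x \<eta>"
      using k_lower[OF small[OF x], of "-\<eta>"] k_lower[OF small[OF x], of \<eta>] eta by auto
    moreover have "\<kappa> * \<eta> \<le> k' x \<eta> - k' x 0" "\<kappa> * \<eta> \<le> k' x 0 - k' x (-\<eta>)"
      using k'_mono[OF small[OF x], of 0 \<eta>] k'_mono[OF small[OF x], of "-\<eta>" 0] eta by auto
    ultimately show ?thesis
      using 1 2 3 \<delta> by linarith
  qed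
  define fold_at where "fold_at = (\<lambda>x y0. \<bar>y0\<bar> < \<eta> \<and> (\<forall>y. \<bar>y\<bar> < \<eta> \<longrightarrow> (k' x y = 0 \<longleftrightarrow> y = y0)) \<and> (\<forall>y. \<bar>y\<bar> < \<eta> \<longrightarrow> k x y0 \<le> k x y) \<and>
      (\<forall>v. k x y0 < v \<and> v < k x (-\<eta>) \<and> v < k x \<eta> \<longrightarrow> card {y. \<bar>y\<bar> < \<eta> \<and> k x y = v} = 2))"
  have "\<exists>y0. fold_at x y0"
    if x: "\<bar>x\<bar> < \<delta>" for x
  proof -
    have k'_cont: "continuous_on {-\<eta>..\<eta>} (k' x)"
      by (intro continuous_at_imp_continuous_on ballI, rule DERIV_isCont[OF k'_der[OF small[OF x]]]) auto
    have x_der: "(k x has_real_derivative k' x y) (at y)" if "y \<in> {-\<eta>..\<eta>}" for y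
      using that by (intro k_der small[OF x]) auto
    have x_ends: "k' x (-\<eta>) < 0" "0 < k' x \<eta>"
      using ends[OF x] by auto
    show ?thesis
      unfolding fold_at_def
      by (rule convex_critical_point[OF eta x_der k'_strict[OF small[OF x]] k'_cont x_ends]) blast+
  qed
  then obtain ys where "\<And>x. \<bar>x\<bar> < \<delta> \<Longrightarrow> fold_at x (ys x)"
    by metis
  then have ys: "\<bar>ys x\<bar> < \<eta>" "\<bar>y\<bar> < \<eta> \<Longrightarrow> k' x y = 0 \<longleftrightarrow> y = ys x"
      "\<bar>y\<bar> < \<eta> \<Longrightarrow> k x (ys x) \<le> k x y"
      "k x (ys x) < v \<Longrightarrow> v < k x (-\<eta>) \<Longrightarrow> v < k x \<eta> \<Longrightarrow> card {y. \<bar>y\<bar> < \<eta> \<and> k x y = v} = 2"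
    if "\<bar>x\<bar> < \<delta>" for x y v
    using that unfolding fold_at_def by blast+
  define m where "m = (\<lambda>x. k x (ys x))"
  have m_le: "m x \<le> k x 0" if "\<bar>x\<bar> < \<delta>" for x
    unfolding m_def using ys(3)[OF that, of 0] eta by simp
  have m_neg: "m x < 0" if "0 < \<bar>x\<bar>" "\<bar>x\<bar> < \<delta>" for x
    using m_le[of x] k_neg[of x] that small by force
  \<comment> \<open>Completing the square, the quadratic minorant is at least
    \<open>k x 0 - (k' x 0)\<^sup>2 / (2 * \<kappa>)\<close>, where \<open>k' x 0\<close> is at most
    \<open>M * \<bar>x\<bar>\<close> in modulus. This bound later identifies the direction of the
    tangent.\<close>
  have m_bound: "\<bar>m x\<bar> \<le> (M + M\<^sup>2 / (2 * \<kappa>)) * x\<^sup>2" if x: "\<bar>x\<bar> < \<delta>" for x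
  proof -
    let ?y = "ys x" and ?d = "k' x 0"
    have "k x 0 + ?d * ?y + \<kappa> / 2 * ?y\<^sup>2 \<le> m x"
      unfolding m_def using k_lower[OF small[OF x], of ?y] ys(1)[OF x] by simp
    moreover have "?d * ?y + \<kappa> / 2 * ?y\<^sup>2 = \<kappa> / 2 * (?y + ?d / \<kappa>)\<^sup>2 - ?d\<^sup>2 / (2 * \<kappa>)"
      using kpos by (simp add: field_simps power2_eq_square)
    moreover have "\<kappa> / 2 * (?y + ?d / \<kappa>)\<^sup>2 \<ge> 0"
      using kpos by simp
    ultimately have 1: "k x 0 - ?d\<^sup>2 / (2 * \<kappa>) \<le> m x"
      by linarith
    have "?d\<^sup>2 \<le> M\<^sup>2 * x\<^sup>2"
      using power_mono[OF k'0_abs[OF small[OF x]], of 2] by (simp add: power_mult_distrib)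
    then have "?d\<^sup>2 / (2 * \<kappa>) \<le> M\<^sup>2 / (2 * \<kappa>) * x\<^sup>2"
      using kpos by (simp add: divide_right_mono)
    moreover have "m x \<le> M * x\<^sup>2" "- (M * x\<^sup>2) \<le> k x 0"
      using m_le[OF x] k0_abs[OF small[OF x]] by linarith+
    moreover have "0 \<le> M\<^sup>2 / (2 * \<kappa>) * x\<^sup>2"
      using kpos by simp
    ultimately show ?thesis
      using 1 by (simp add: algebra_simps abs_le_iff)
  qed
  define U where "U = ball z0 r \<inter> {z. \<bar>Re (H z - k0)\<bar> < \<delta> \<and> \<bar>Im (H z - k0)\<bar> < \<eta>}"
  have "open {z. \<bar>Re (H z - k0)\<bar> < \<delta> \<and> \<bar>Im (H z - k0)\<bar> < \<eta>}"
    by (intro open_Collect_conj open_Collect_less continuous_intros r(5))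
  then have "open U"
    unfolding U_def by (intro open_Int open_ball)
  moreover have "z0 \<in> U"
    using r(1) \<delta>(1) eta by (simp add: U_def k0_def)
  moreover have "U \<subseteq> ball z0 e"
    using r(2) by (auto simp: U_def)
  moreover have "fold_chart z0 U c m \<delta>"
  proof -
    have c0: "c \<noteq> 0"
      using c(1) by auto
    \<comment> \<open>In coordinates, the fibre of \<open>f\<close> in \<open>U\<close> over
      \<open>w\<close> is the level set \<open>k x y = v\<close> on the vertical segment over
      \<open>x\<close>; a critical point in it can only sit at the zero \<open>ys x\<close> of
      \<open>k' x\<close>.\<close>
    have cnt: "(m x < v \<longrightarrow> card {z\<in>U. f z = w} = 2) \<and> (v < m x \<longrightarrow> {z\<in>U. f z = w} = {}) \<and>
        (\<forall>z \<in> U \<inter> crit_set f. f z = w \<longrightarrow> v = m x) \<and> card {z \<in> U \<inter> crit_set f. f z = w} \<le> 1"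
      if w: "\<bar>x\<bar> < \<delta>" "\<bar>v\<bar> < \<delta>" "x = Re (c * (w - f z0))" "v = Im (c * (w - f z0))" for w x v
    proof -
      have f_w: "f z = w \<longleftrightarrow> Re (H z - k0) = x \<and> Im (K (H z)) - Im (K k0) = v" if "z \<in> ball z0 r" for z
      proof -
        have "f z = w \<longleftrightarrow> c * (f z - f z0) = c * (w - f z0)"
          using c0 by simp
        also have "\<dots> \<longleftrightarrow> Re (c * f z) - Re (c * f z0) = x \<and> Im (c * f z) - Im (c * f z0) = v"
          unfolding w(3,4) complex_eq_iff by (simp only: right_diff_distrib minus_complex.sel)
        finally show ?thesis
          using ReH ImK that r(1) by (simp add: k0_def)
      qed
      have HP: "H z = P (Re (H z - k0)) (Im (H z - k0))" for z
        by (simp add: P_def complex_eq_iff)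
      have fib: "\<bar>Im (H z - k0)\<bar> < \<eta>" "k x (Im (H z - k0)) = v" "z = G (P x (Im (H z - k0)))" 
           "H z = P x (Im (H z - k0))"
        if "z \<in> U" "f z = w" for z
      proof -
        have z: "z \<in> ball z0 r" "Re (H z - k0) = x" "Im (K (H z)) - Im (K k0) = v" "\<bar>Im (H z - k0)\<bar> < \<eta>"
          using that f_w by (auto simp: U_def)
        show "\<bar>Im (H z - k0)\<bar> < \<eta>"
          by (rule z(4))
        show eq: "H z = P x (Im (H z - k0))"
          using HP[of z] z(2) by simp
        show "k x (Im (H z - k0)) = v"
          using z(3) eq by (simp add: k_def)
        show "z = G (P x (Im (H z - k0)))"
          using G[OF z(1)] eq by simp
      qed
      have GP: "G (P x y) \<in> U \<and> f (G (P x y)) = w" if y: "\<bar>y\<bar> < \<eta>" "k x y = v" for y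
      proof -
        have "P x y \<in> V"
          using P_ball[of x y] small[OF w(1)] y R(2) by auto
        then obtain z where z: "z \<in> ball z0 r" "P x y = H z"
          unfolding V_def by auto
        then have Gz: "G (P x y) = z"
          using G by simp
        have RI: "Re (H z - k0) = x" "Im (H z - k0) = y"
          unfolding z(2)[symmetric] by (simp_all add: P_def)
        have "Im (K (H z)) - Im (K k0) = v"
          using y(2) z(2) by (simp add: k_def)
        then have "f z = w"
          using f_w[OF z(1)] RI(1) by blast
        moreover have "z \<in> U"
          using z(1) w(1) y(1) unfolding U_def mem_Collect_eq Int_iff RI by blast
        ultimately show ?thesis
          unfolding Gz by blast
      qed
      have "bij_betw (\<lambda>y. G (P x y)) {y. \<bar>y\<bar> < \<eta> \<and> k x y = v} {z\<in>U. f z = w}"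
      proof (rule bij_betw_byWitness[where f' = "\<lambda>z. Im (H z - k0)"])
        show "\<forall>y\<in>{y. \<bar>y\<bar> < \<eta> \<and> k x y = v}. Im (H (G (P x y)) - k0) = y"
        proof
          fix y assume y: "y \<in> {y. \<bar>y\<bar> < \<eta> \<and> k x y = v}"
          have "P x y \<in> V"
            using P_ball[of x y] small[OF w(1)] y R(2) by auto
          then have "H (G (P x y)) = P x y"
            unfolding V_def using G by auto
          then show "Im (H (G (P x y)) - k0) = y"
            by (simp add: P_def)
        qed
      qed (use fib GP in auto)
      then have card_eq: "card {z\<in>U. f z = w} = card {y. \<bar>y\<bar> < \<eta> \<and> k x y = v}"
        by (simp add: bij_betw_same_card)
      have crit_ys: "Im (H z - k0) = ys x" if "z \<in> U \<inter> crit_set f" "f z = w" for z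
      proof -
        have "Re (deriv K (H z)) = 0"
          using crit that by (auto simp: U_def)
        then have "k' x (Im (H z - k0)) = 0"
          using fib(4)[of z] that unfolding k'_def by simp
        then show ?thesis
          using ys(2)[OF w(1)] fib(1)[of z] that by auto
      qed
      have "card {z \<in> U \<inter> crit_set f. f z = w} \<le> card {G (P x (ys x))}"
      proof (rule card_mono)
        show "{z \<in> U \<inter> crit_set f. f z = w} \<subseteq> {G (P x (ys x))}"
          using crit_ys fib(3) by fastforce
      qed simp
      moreover have "v = m x" if "z \<in> U \<inter> crit_set f" "f z = w" for z
        using crit_ys[OF that] fib(2)[of z] that by (simp add: m_def)
      moreover have "card {z\<in>U. f z = w} = 2" if "m x < v"
        using ys(4)[OF w(1), of v] that ends[OF w(1)] w(2) unfolding card_eq m_def by linarith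
      moreover have "{z\<in>U. f z = w} = {}" if "v < m x"
        using fib(1,2) ys(3)[OF w(1)] that unfolding m_def by force
      ultimately show ?thesis
        by simp
    qed
    have "\<exists>C. \<forall>x. \<bar>x\<bar> < \<delta> \<longrightarrow> \<bar>m x\<bar> \<le> C * x\<^sup>2"
      using m_bound by blast
    then show ?thesis
      unfolding fold_chart_def using cnt[OF _ _ refl refl] m_neg c(1) \<delta>(1) by blast
  qed
  ultimately show ?thesis
    by blast
qed

end

section \<open>Degenerate critical points\<close>

text \<open>\<open>\<phi>\<close> is merely continuous, so its derivative has to be produced.
  Dividing by \<open>q t1\<close> brings the values near 1, where \<open>Ln\<close> is
  differentiable, and \<open>\<bar>\<phi> t - \<phi> t1\<bar> < pi\<close> selects the branch on
  which \<open>Im (Ln (q t / q t1))\<close> equals \<open>\<phi> t - \<phi> t1\<close>.\<close>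

lemma phase_derivative:
  fixes \<phi> :: "real \<Rightarrow> real" and q :: "real \<Rightarrow> complex"
  assumes q: "(q has_vector_derivative q') (at t1)" and \<phi>: "isCont \<phi> t1"
    and eq: "\<forall>\<^sub>F t in nhds t1. q t = exp (\<i> * of_real (\<phi> t))"
  obtains d where "(\<phi> has_real_derivative d) (at t1)" "q' = \<i> * of_real d * q t1"
proof -
  have q1: "q t1 = exp (\<i> * of_real (\<phi> t1))"
    using eq by (rule eventually_nhds_x_imp_x)
  then have q1nz: "q t1 \<noteq> 0"
    by simp
  have "((\<lambda>t. q t / q t1) has_vector_derivative q' / q t1) (at t1)"
    using q by (rule has_vector_derivative_divide)
  then have "(Ln \<circ> (\<lambda>t. q t / q t1) has_vector_derivative q' / q t1 * 1) (at t1)"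
    by (rule field_vector_diff_chain_at)
      (use q1nz in \<open>auto intro!: derivative_eq_intros\<close>)
  then have "((\<lambda>t. Im (Ln (q t / q t1))) has_real_derivative Im (q' / q t1)) (at t1)"
    using has_vector_derivative_complex_iff[of "Ln \<circ> (\<lambda>t. q t / q t1)" "q' / q t1" "at t1"]
    by (simp add: o_def)
  from DERIV_add[OF DERIV_const[of "\<phi> t1"] this]
  have der: "((\<lambda>t. \<phi> t1 + Im (Ln (q t / q t1))) has_real_derivative Im (q' / q t1)) (at t1)"
    by simp
  have "\<forall>\<^sub>F t in nhds t1. dist (\<phi> t) (\<phi> t1) < pi"
    using \<phi> by (intro tendstoD) (auto simp: tendsto_at_iff_tendsto_nhds isCont_def)
  with eq have "\<forall>\<^sub>F t in nhds t1. \<phi> t1 + Im (Ln (q t / q t1)) = \<phi> t"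
  proof eventually_elim
    case (elim t)
    have "q t / q t1 = exp (\<i> * of_real (\<phi> t - \<phi> t1))"
      by (simp add: elim q1 exp_diff right_diff_distrib)
    then have "Ln (q t / q t1) = \<i> * of_real (\<phi> t - \<phi> t1)"
      using elim(2) by (simp add: dist_real_def abs_less_iff)
    then show ?case
      by simp
  qed
  from iffD1[OF DERIV_cong_ev[OF refl this refl] der]
  have \<phi>_der: "(\<phi> has_real_derivative Im (q' / q t1)) (at t1)" .
  then have "((\<lambda>t. exp (\<i> * of_real (\<phi> t))) has_vector_derivative \<i> * of_real (Im (q' / q t1)) * q t1) (at t1)"
  proof -
    have "((\<lambda>t. \<i> * of_real (\<phi> t)) has_vector_derivative \<i> * of_real (Im (q' / q t1))) (at t1)"
      using \<phi>_der by (intro has_vector_derivative_mult_right has_vector_derivative_of_real)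
        (simp add: has_real_derivative_iff_has_vector_derivative)
    from field_vector_diff_chain_at[OF this DERIV_exp] show ?thesis
      by (simp add: o_def q1)
  qed
  moreover have "((\<lambda>t. exp (\<i> * of_real (\<phi> t))) has_vector_derivative q') (at t1)"
    using q eq q1 by (subst (asm) has_vector_derivative_cong_ev[where g = "\<lambda>t. exp (\<i> * of_real (\<phi> t))"])
      auto
  ultimately have "q' = \<i> * of_real (Im (q' / q t1)) * q t1"
    using vector_derivative_unique_at by blast
  with \<phi>_der show ?thesis
    by (rule that)
qed

lemma entire_zeros_countable:
  assumes "F holomorphic_on UNIV" and "F z1 \<noteq> (0::complex)"
  shows "countable {z. F z = 0}"
proof (cases "F constant_on UNIV")
  case True
  then have "{z. F z = 0} = {}"
    using assms(2) by (auto simp: constant_on_def)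
  then show ?thesis
    by simp
next
  case False
  then have "countable {z\<in>UNIV. F z = 0}"
    by (intro holomorphic_countable_zeros assms) (auto simp: fsigma_UNIV)
  then show ?thesis
    by simp
qed

section \<open>Comparison of \<open>F\<close> and \<open>N\<close> with the degenerate set\<close>

context harmonic_map
begin

lemma wronsk_holo: "wronsk holomorphic_on A"
  unfolding wronsk_def by (intro holomorphic_intros holo_derivs)

lemma closed_degenerate: "closed degenerate"
proof -
  have "degenerate = crit_set f \<inter> (\<Inter>c. {z. Im (wronsk z * cnj (dir c z) ^ 3) = 0})"
    by (auto simp: degenerate_def)
  moreover have "closed {z. Im (wronsk z * cnj (dir c z) ^ 3) = 0}" for c
    unfolding wronsk_def dir_def
    by (intro closed_Collect_eq continuous_intros)
  ultimately show ?thesis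
    using closed_crit by (metis (no_types, lifting) closed_INT closed_Int)
qed

lemma nondegenerate_nonzero:
  assumes "z \<in> crit_set f" "z \<notin> degenerate"
  shows "deriv h z \<noteq> 0" "deriv g z \<noteq> 0" "wronsk z \<noteq> 0"
  using assms by (auto simp: degenerate_def crit_iff dir_def)

lemma psi_deriv:
  assumes "deriv g z \<noteq> 0"
  shows "psi h g z = deriv h z / deriv g z"
    and "(psi h g has_field_derivative wronsk z / (deriv g z)\<^sup>2) (at z)"
proof -
  let ?q = "\<lambda>w. deriv h w / deriv g w"
  have U: "open {w. deriv g w \<noteq> 0}"
    by (intro open_Collect_neq continuous_intros)
  have holo: "?q holomorphic_on {w. deriv g w \<noteq> 0}"
    by (intro holomorphic_intros holo_derivs) auto
  have psi: "psi h g w = ?q w" if "deriv g w \<noteq> 0" for w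
  proof -
    have "?q analytic_on {w}"
      using holo U that analytic_at by blast
    then show ?thesis
      unfolding psi_def by (rule remove_sings_at_analytic)
  qed
  then show "psi h g z = ?q z"
    using assms .
  have dh: "(deriv h has_field_derivative deriv (deriv h) z) (at z)"
       "(deriv g has_field_derivative deriv (deriv g) z) (at z)"
    using holo_derivs(1,2)[of UNIV] holomorphic_derivI by blast+
  have "(?q has_field_derivative wronsk z / (deriv g z)\<^sup>2) (at z)"
    using assms by (auto intro!: derivative_eq_intros dh simp: wronsk_def power2_eq_square)
  then show "(psi h g has_field_derivative wronsk z / (deriv g z)\<^sup>2) (at z)"
    by (rule has_field_derivative_transform_within_open[OF _ U]) (use assms psi in auto)
qed

text \<open>At a nondegenerate point, differentiating the phase equation gives
  \<open>zc' = i * \<phi>' * h' * g' / wronsk\<close>. Hence the function whose sign matters is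
  \<open>\<phi>' * E\<close> with \<open>E\<close> continuous at \<open>t0\<close>, and
  \<open>E t0\<close> is a positive multiple of \<open>Im (wronsk z0 * cnj (dir c z0) ^ 3)\<close>,
  so it is nonzero. As \<open>\<phi>' \<ge> 0\<close>, the product keeps a weak sign near
  \<open>t0\<close>, which rules out a strict change.\<close>

lemma F1_subset_degenerate: "F1 h g \<subseteq> degenerate"
proof
  fix z0 assume "z0 \<in> F1 h g"
  then obtain zc \<phi> t0 where zc: "arc zc" "path_image zc \<subseteq> Gamma_set h g" "real_analytic_path zc"
    and t0: "t0 \<in> {0<..<1}" "zc t0 = z0"
    and \<phi>: "continuous_on {0..1} \<phi>" "mono_on {0..1} \<phi>"
       "\<And>t. t \<in> {0..1} \<Longrightarrow> psi h g (zc t) = exp (\<i> * of_real (\<phi> t))"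
    and sc: "sign_change_at (\<lambda>t. Re (deriv h (zc t) * vector_derivative zc (at t)
                                 * exp (- \<i> * of_real (\<phi> t) / 2))) t0"
    unfolding F1_def by blast
  have crit: "zc t \<in> crit_set f" if "t \<in> {0..1}" for t
    using subsetD[OF zc(2), of "zc t"] that by (auto simp: Gamma_set_def f_eq path_image_def)
  show "z0 \<in> degenerate"
  proof (rule ccontr)
    assume nd: "z0 \<notin> degenerate"
    have z0: "z0 \<in> crit_set f"
      using crit[of t0] t0 by auto
    note nz = nondegenerate_nonzero[OF z0 nd]
    obtain Z U where Z: "open U" "of_real ` {0..1} \<subseteq> U" "Z holomorphic_on U"
        "\<And>t. t \<in> {0..1} \<Longrightarrow> zc t = Z (of_real t)"
      using zc(3) unfolding real_analytic_path_def by blast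
    define zc' where "zc' = (\<lambda>t. deriv Z (complex_of_real t))"
    have zc_der: "(zc has_vector_derivative zc' t) (at t)" if t: "t \<in> {0<..<1}" for t
    proof -
      have "(of_real has_vector_derivative (1::complex)) (at t)"
        using has_vector_derivative_of_real[of "\<lambda>t. t" 1 "at t"] by simp
      moreover have "(Z has_field_derivative zc' t) (at (of_real t))"
        unfolding zc'_def using Z(1-3) t by (intro holomorphic_derivI[of Z U]) auto
      ultimately have "(Z \<circ> of_real has_vector_derivative 1 * zc' t) (at t)"
        by (rule field_vector_diff_chain_at)
      then have "(Z \<circ> of_real has_vector_derivative zc' t) (at t)"
        by simp
      then show ?thesis
        by (rule has_vector_derivative_transform_within_open[where S = "{0<..<1}"]) (use t Z(4) in auto)
    qed
    have zc_cont: "isCont zc t0"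
      using has_vector_derivative_continuous[OF zc_der[OF t0(1)]] .
    have \<phi>_cont: "isCont \<phi> t" if "t \<in> {0<..<1}" for t
      using continuous_on_interior[OF \<phi>(1)] that by simp
    have d_cont: "isCont (deriv h) z" "isCont (deriv g) z" "isCont wronsk z" for z
      using continuous_derivs(1,2)[of UNIV] holomorphic_on_imp_continuous_on[OF wronsk_holo[of UNIV]]
      by (auto simp: continuous_on_eq_continuous_at)
    define E where "E = (\<lambda>t. Re (\<i> * (deriv h (zc t))\<^sup>2 * deriv g (zc t) * exp (- \<i> * of_real (\<phi> t) / 2) / wronsk (zc t)))"
    have "isCont (\<lambda>t. deriv h (zc t)) t0" "isCont (\<lambda>t. deriv g (zc t)) t0" "isCont (\<lambda>t. wronsk (zc t)) t0"
      by (intro isCont_o2[OF zc_cont] d_cont)+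
    moreover have "wronsk (zc t0) \<noteq> 0"
      using nz t0 by simp
    ultimately have "isCont E t0"
      unfolding E_def by (intro isCont_Re continuous_intros \<phi>_cont t0(1)) auto
    then have E_lim: "(E \<longlongrightarrow> E t0) (at t0)"
      by (simp add: isCont_def)
    have "E t0 \<noteq> 0"
    proof -
      \<comment> \<open>This is the square root of \<open>g' / h'\<close> singled out by the phase,
        so \<open>c * h'\<close> and \<open>cnj c * g'\<close> agree at \<open>z0\<close> and
        \<open>dir c z0\<close> is twice \<open>c * h'\<close>.\<close>
      define c where "c = exp (- \<i> * of_real (\<phi> t0) / 2)"
      have c: "cmod c = 1"
        by (simp add: c_def norm_exp_eq_Re)
      then have cc: "c * cnj c = 1"
        by (metis complex_norm_square of_real_1 one_power2)
      have "exp (\<i> * of_real (\<phi> t0)) * (c * c) = exp (\<i> * of_real (\<phi> t0) + (- \<i> * of_real (\<phi> t0) / 2 + - \<i> * of_real (\<phi> t0) / 2))"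
        unfolding c_def exp_add ..
      then have e1: "exp (\<i> * of_real (\<phi> t0)) * (c * c) = 1"
        by simp
      have "deriv h z0 / deriv g z0 = exp (\<i> * of_real (\<phi> t0))"
        using \<phi>(3)[of t0] t0 psi_deriv(1)[OF nz(2)] by simp
      then have "deriv h z0 = exp (\<i> * of_real (\<phi> t0)) * deriv g z0"
        using nz(2) by (simp add: field_simps)
      then have "deriv h z0 * (c * c) = (exp (\<i> * of_real (\<phi> t0)) * (c * c)) * deriv g z0"
        by (simp add: mult_ac)
      then have g_c: "deriv g z0 = c\<^sup>2 * deriv h z0"
        unfolding e1 by (simp only: power2_eq_square mult_ac mult_1)
      have "cnj c * deriv g z0 = (c * cnj c) * (c * deriv h z0)"
        unfolding g_c by (simp only: power2_eq_square mult_ac)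
      then have dir: "dir c z0 = 2 * (c * deriv h z0)"
        using cc by (simp add: dir_def)
      define A where "A = c * deriv h z0"
      have "A \<noteq> 0"
        using nz c by (auto simp: A_def)
      then have "Im (wronsk z0 * cnj (2 * A) ^ 3) \<noteq> 0"
        using degenerate_dir[OF z0, of c] nd dir by (auto simp: A_def)
      moreover have "wronsk z0 * cnj (2 * A) ^ 3 = of_real 8 * (wronsk z0 * cnj A ^ 3)"
        by (simp add: power_mult_distrib)
      ultimately have 1: "Im (wronsk z0 * cnj A ^ 3) \<noteq> 0"
        by auto
      have "E t0 = Re (\<i> * (A ^ 3 / wronsk z0))"
        unfolding E_def t0(2) c_def[symmetric] g_c A_def
        by (simp only: power_mult_distrib) (simp add: power2_eq_square power3_eq_cube mult_ac)
      also have "\<dots> = - Im (A ^ 3 / wronsk z0)"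
        by (simp only: times_complex.sel) simp
      also have "A ^ 3 / wronsk z0 = cnj (wronsk z0 * cnj A ^ 3) / of_real ((cmod (wronsk z0))\<^sup>2)"
        by (subst complex_div_cnj) (simp add: mult_ac)
      also have "- Im \<dots> = Im (wronsk z0 * cnj A ^ 3) / (cmod (wronsk z0))\<^sup>2"
        by (simp only: Im_divide_of_real cnj.sel minus_divide_left minus_minus)
      finally show ?thesis
        using 1 nz(3) by simp
    qed
    have ev01: "\<forall>\<^sub>F t in at t0. t \<in> {0<..<1}"
      using t0(1) by (intro eventually_at_in_open') auto
    have evg: "\<forall>\<^sub>F t in at t0. deriv g (zc t) \<noteq> 0 \<and> wronsk (zc t) \<noteq> 0"
    proof -
      have "((\<lambda>t. deriv g (zc t)) \<longlongrightarrow> deriv g z0) (at t0)" "((\<lambda>t. wronsk (zc t)) \<longlongrightarrow> wronsk z0) (at t0)"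
        using isCont_o2[OF zc_cont d_cont(2)] isCont_o2[OF zc_cont d_cont(3)] t0(2)
        by (auto simp: isCont_def)
      then show ?thesis
        using nz tendsto_imp_eventually_ne by (intro eventually_conj) blast+
    qed
    define \<omega> where "\<omega> = (\<lambda>t. Re (deriv h (zc t) * vector_derivative zc (at t) * exp (- \<i> * of_real (\<phi> t) / 2)))"
    have \<omega>: "\<forall>\<^sub>F t in at t0. \<exists>d\<ge>0. \<omega> t = d * E t"
      using ev01 evg
    proof eventually_elim
      case (elim t)
      have gnz: "deriv g (zc t) \<noteq> 0" and wnz: "wronsk (zc t) \<noteq> 0"
        using elim by auto
      have hnz: "deriv h (zc t) \<noteq> 0"
        using crit[of t] elim(1) gnz by (auto simp: crit_iff)
      have q: "((\<lambda>t. psi h g (zc t)) has_vector_derivative zc' t * (wronsk (zc t) / (deriv g (zc t))\<^sup>2)) (at t)"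
        using field_vector_diff_chain_at[OF zc_der[OF elim(1)] psi_deriv(2)[OF gnz]] by (simp add: o_def)
      have ev: "\<forall>\<^sub>F s in nhds t. psi h g (zc s) = exp (\<i> * of_real (\<phi> s))"
        using eventually_nhds_in_open[of "{0<..<1}" t] elim(1) \<phi>(3) by (auto elim!: eventually_mono)
      obtain d where d: "(\<phi> has_real_derivative d) (at t)"
          "zc' t * (wronsk (zc t) / (deriv g (zc t))\<^sup>2) = \<i> * of_real d * psi h g (zc t)"
        using phase_derivative[OF q \<phi>_cont[OF elim(1)] ev] by metis
      have "d \<ge> 0"
        using mono_on_imp_deriv_nonneg[OF \<phi>(2) d(1)] elim(1) by simp
      moreover have "\<omega> t = d * E t"
      proof -
        have "zc' t = \<i> * of_real d * (deriv h (zc t) * deriv g (zc t) / wronsk (zc t))"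
          using d(2) gnz wnz psi_deriv(1)[OF gnz] by (simp add: field_simps power2_eq_square)
        moreover have "vector_derivative zc (at t) = zc' t"
          using zc_der[OF elim(1)] by (rule vector_derivative_at)
        ultimately have "deriv h (zc t) * vector_derivative zc (at t) * exp (- \<i> * of_real (\<phi> t) / 2) =
            of_real d * (\<i> * (deriv h (zc t))\<^sup>2 * deriv g (zc t) * exp (- \<i> * of_real (\<phi> t) / 2) / wronsk (zc t))"
          by (simp add: power2_eq_square mult_ac)
        moreover have "Re (of_real d * X) = d * Re X" for X
          by simp
        ultimately show ?thesis
          unfolding \<omega>_def E_def by (simp only:)
      qed
      ultimately show ?case
        by blast
    qed
    have incompat: False if "\<forall>\<^sub>F t in F. P t" "\<forall>\<^sub>F t in F. \<not> P t" "F \<noteq> bot" for F :: "real filter" and P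
    proof -
      have "\<forall>\<^sub>F t in F. False"
        using that(1,2) by eventually_elim blast
      then show False
        using that(3) by simp
    qed
    have "(\<forall>\<^sub>F t in at t0. \<omega> t \<ge> 0) \<or> (\<forall>\<^sub>F t in at t0. \<omega> t \<le> 0)"
    proof (cases "E t0 > 0")
      case True
      then have "\<forall>\<^sub>F t in at t0. E t > 0"
        using E_lim order_tendstoD(1) by blast
      with \<omega> have "\<forall>\<^sub>F t in at t0. \<omega> t \<ge> 0"
        by eventually_elim auto
      then show ?thesis ..
    next
      case False
      then have "\<forall>\<^sub>F t in at t0. E t < 0"
        using E_lim order_tendstoD(2)[of E "E t0" "at t0" 0] \<open>E t0 \<noteq> 0\<close> by auto
      with \<omega> have "\<forall>\<^sub>F t in at t0. \<omega> t \<le> 0"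
        by eventually_elim (auto simp: mult_nonneg_nonpos)
      then show ?thesis ..
    qed
    then show False
    proof
      assume "\<forall>\<^sub>F t in at t0. \<omega> t \<ge> 0"
      then have *: "\<forall>\<^sub>F t in at_left t0. \<not> \<omega> t < 0" "\<forall>\<^sub>F t in at_right t0. \<not> \<omega> t < 0"
        by (auto simp: eventually_at_split not_less)
      from sc consider "\<forall>\<^sub>F t in at_left t0. \<omega> t < 0" | "\<forall>\<^sub>F t in at_right t0. \<omega> t < 0"
        unfolding sign_change_at_def \<omega>_def[symmetric] by blast
      then show False
      proof cases
        case 1
        from incompat[OF this *(1)] show False by simp
      next
        case 2
        from incompat[OF this *(2)] show False by simp
      qed
    next
      assume "\<forall>\<^sub>F t in at t0. \<omega> t \<le> 0"
      then have *: "\<forall>\<^sub>F t in at_left t0. \<not> \<omega> t > 0" "\<forall>\<^sub>F t in at_right t0. \<not> \<omega> t > 0"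
        by (auto simp: eventually_at_split not_less)
      from sc consider "\<forall>\<^sub>F t in at_left t0. \<omega> t > 0" | "\<forall>\<^sub>F t in at_right t0. \<omega> t > 0"
        unfolding sign_change_at_def \<omega>_def[symmetric] by blast
      then show False
      proof cases
        case 1
        from incompat[OF this *(1)] show False by simp
      next
        case 2
        from incompat[OF this *(2)] show False by simp
      qed
    qed
  qed
qed

text \<open>At critical points outside \<open>degenerate\<close> the values \<open>h'\<close>,
  \<open>g'\<close> and \<open>wronsk\<close> are nonzero. This contradicts \<open>h' = 0\<close>
  for \<open>F2\<close>, the vanishing of \<open>psi' = wronsk / g'\<^sup>2\<close> for
  \<open>F3\<close>, and \<open>cmod psi = cmod h' / cmod g' \<noteq> 1\<close> for
  \<open>N\<close>.\<close>

lemma F_N_subset_degenerate: "Fset h g \<union> Nset h g \<subseteq> degenerate"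
proof -
  have crit: "Gamma_set h g \<subseteq> crit_set f" "Nset h g \<subseteq> crit_set f"
    by (auto simp: Gamma_set_def Nset_def f_eq)
  have "F2 h g \<subseteq> degenerate"
    using nondegenerate_nonzero(1) crit by (fastforce simp: F2_def)
  moreover have "F3 h g \<subseteq> degenerate"
  proof
    fix z assume z: "z \<in> F3 h g"
    show "z \<in> degenerate"
    proof (rule ccontr)
      assume "z \<notin> degenerate"
      then have nz: "deriv g z \<noteq> 0" "wronsk z \<noteq> 0"
        using nondegenerate_nonzero crit z by (auto simp: F3_def)
      then have "deriv (psi h g) z \<noteq> 0"
        using DERIV_imp_deriv[OF psi_deriv(2)] by simp
      then show False
        using z by (simp add: F3_def)
    qed
  qed
  moreover have "Nset h g \<subseteq> degenerate"
  proof
    fix z assume z: "z \<in> Nset h g"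
    show "z \<in> degenerate"
    proof (rule ccontr)
      assume nd: "z \<notin> degenerate"
      have "z \<in> crit_set f"
        using crit z by auto
      then have "norm (psi h g z) = 1"
        using psi_deriv(1)[of z] nondegenerate_nonzero[OF _ nd] by (simp add: crit_iff norm_divide)
      then show False
        using z by (simp add: Nset_def)
    qed
  qed
  ultimately show ?thesis
    using F1_subset_degenerate by (auto simp: Fset_def)
qed

end

section \<open>Countability of the degenerate set\<close>

context finite_harmonic_map
begin

lemma infinite_fibre_False: "infinite A \<Longrightarrow> (\<And>z. z \<in> A \<Longrightarrow> f z = w) \<Longrightarrow> False"
  using finite_subset[OF _ finite_preimage[of w]] by blast

text \<open>Since \<open>K'' \<noteq> 0\<close>, \<open>K'\<close> is a local coordinate with
  inverse \<open>\<kappa>\<close>, and the critical set is the curve \<open>\<kappa> (i t)\<close>.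
  Its points are degenerate where \<open>\<kappa>' (i t)\<close> is real, that is, where the curve
  runs vertically. Accumulation makes this hold for all small \<open>t\<close>, so the real part is
  constant along the curve; \<open>K (\<kappa> (i t))\<close> then has the real derivative
  \<open>- t * \<kappa>' (i t)\<close>, so its imaginary part is constant too. Thus \<open>f\<close>
  takes one value on an infinite set.\<close>

lemma degenerate_isolated:
  assumes z0: "z0 \<in> degenerate" and nz: "deriv h z0 \<noteq> 0" "wronsk z0 \<noteq> 0"
  shows "\<not> z0 islimpt degenerate"
proof
  assume lim: "z0 islimpt degenerate"
  have crit0: "z0 \<in> crit_set f"
    using z0 by (simp add: degenerate_def)
  obtain c where c: "cmod c = 1" "c * deriv h z0 = cnj c * deriv g z0"
    using crit_unit_dir[OF crit0 nz(1)] by metis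
  obtain r H G K where r: "0 < r" "r \<le> 1" "open (H ` ball z0 r)" "inj_on H (ball z0 r)" "continuous_on UNIV H"
    and K: "K holomorphic_on H ` ball z0 r" and G: "\<And>z. z \<in> ball z0 r \<Longrightarrow> G (H z) = z"
    and ReH: "\<And>z. Re (c * f z) = Re (H z)"
    and ImK: "\<And>z. z \<in> ball z0 r \<Longrightarrow> Im (c * f z) = Im (K (H z))"
    and dnz: "\<And>z. z \<in> ball z0 r \<Longrightarrow> dir c z \<noteq> 0"
    and crit: "\<And>z. z \<in> ball z0 r \<Longrightarrow> z \<in> crit_set f \<longleftrightarrow> Re (deriv K (H z)) = 0"
    and K'': "\<And>z. z \<in> ball z0 r \<Longrightarrow> deriv (deriv K) (H z) = 2 * wronsk z / dir c z ^ 3"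
    and K'0: "deriv K (H z0) = 0"
    by (rule straightening[OF crit0 nz(1) c zero_less_one]) blast
  define k0 where "k0 = H z0"
  define V where "V = H ` ball z0 r"
  have k0V: "k0 \<in> V" "open V"
    using r by (auto simp: k0_def V_def)
  have hK: "K holomorphic_on V" "deriv K holomorphic_on V"
    using K k0V holomorphic_deriv unfolding V_def by blast+
  have "deriv (deriv K) k0 \<noteq> 0"
    using K''[of z0] r(1) nz(2) dnz[of z0] by (simp add: k0_def)
  then obtain \<rho> where \<rho>: "\<rho> > 0" "ball k0 \<rho> \<subseteq> V" "open (deriv K ` ball k0 \<rho>)" "inj_on (deriv K) (ball k0 \<rho>)"
    using has_complex_derivative_locally_invertible[OF hK(2) k0V] by metis
  have "deriv K holomorphic_on ball k0 \<rho>"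
    using hK(2) \<rho>(2) holomorphic_on_subset by blast
  then obtain \<kappa> where \<kappa>: "\<kappa> holomorphic_on deriv K ` ball k0 \<rho>"
      "\<And>\<zeta>. \<zeta> \<in> ball k0 \<rho> \<Longrightarrow> deriv (deriv K) \<zeta> * deriv \<kappa> (deriv K \<zeta>) = 1"
      "\<And>\<zeta>. \<zeta> \<in> ball k0 \<rho> \<Longrightarrow> \<kappa> (deriv K \<zeta>) = \<zeta>"
    using holomorphic_has_inverse[OF _ open_ball \<rho>(4)] by metis
  define W where "W = deriv K ` ball k0 \<rho>"
  have "0 \<in> W" "open W"
    using \<rho> K'0 by (auto simp: W_def k0_def intro!: rev_image_eqI[of "H z0"])
  then obtain s where s: "s > 0" "ball 0 s \<subseteq> W"
    by (meson openE)
  have hk: "\<kappa> holomorphic_on W" "deriv \<kappa> holomorphic_on W"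
    using \<kappa>(1) \<open>open W\<close> holomorphic_deriv unfolding W_def by blast+
  have KW: "\<kappa> \<sigma> \<in> ball k0 \<rho> \<and> deriv K (\<kappa> \<sigma>) = \<sigma>" if "\<sigma> \<in> W" for \<sigma>
    using that \<kappa>(3) by (auto simp: W_def)
  define \<kappa>1 where "\<kappa>1 = (\<lambda>\<sigma>. deriv \<kappa> (\<i> * \<sigma>))"
  \<comment> \<open>On real \<open>\<sigma>\<close> this is
    \<open>2 * i * Im (\<kappa>' (i \<sigma>))\<close>. Subtracting the reflected function turns a
    real-analytic condition into the zeros of a holomorphic function, to which the identity theorem
    applies.\<close>
  define D where "D = (\<lambda>\<sigma>. \<kappa>1 \<sigma> - (cnj \<circ> \<kappa>1 \<circ> cnj) \<sigma>)"
  have k1: "\<kappa>1 holomorphic_on ball 0 s"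
  proof -
    have "(deriv \<kappa> \<circ> (*) \<i>) holomorphic_on ball 0 s"
    proof (rule holomorphic_on_compose_gen[of _ _ _ W])
      show "(*) \<i> ` ball 0 s \<subseteq> W"
        using s(2) by (auto simp: norm_mult)
    qed (auto intro: holomorphic_intros hk)
    then show ?thesis
      by (simp add: \<kappa>1_def o_def)
  qed
  have D_holo: "D holomorphic_on ball 0 s"
  proof -
    have "cnj ` ball 0 s \<subseteq> ball 0 s"
      by auto
    then have "(cnj \<circ> \<kappa>1 \<circ> cnj) holomorphic_on ball 0 s"
      by (intro holomorphic_on_compose_cnj_cnj open_ball) (use k1 holomorphic_on_subset in auto)
    then show ?thesis
      unfolding D_def using k1 by (intro holomorphic_on_diff) (auto simp: o_def)
  qed
  have D_Im: "D (of_real t) = 0 \<longleftrightarrow> Im (deriv \<kappa> (\<i> * of_real t)) = 0" for t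
    by (simp add: D_def \<kappa>1_def complex_eq_iff)
  have lim0: "0 islimpt {\<sigma> \<in> ball 0 s. D \<sigma> = 0}"
    unfolding islimpt_approachable
  proof (intro allI impI)
    fix e :: real assume e: "e > 0"
    \<comment> \<open>For critical \<open>z\<close> near \<open>z0\<close>,
      \<open>\<Theta> z\<close> is the real \<open>t\<close> with
      \<open>H z = \<kappa> (i t)\<close>. It tends to 0 at \<open>z0\<close>, and injectivity of
      \<open>K'\<close> and \<open>H\<close> keeps it nonzero for
      \<open>z \<noteq> z0\<close>.\<close>
    define \<Theta> where "\<Theta> = (\<lambda>z. - \<i> * deriv K (H z))"
    have "isCont H z0"
      using r(5) by (simp add: continuous_on_eq_continuous_at)
    moreover have "isCont (deriv K) k0"
      using hK(2) k0V holomorphic_on_imp_continuous_on continuous_on_eq_continuous_at by blast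
    ultimately have "isCont (\<lambda>z. deriv K (H z)) z0"
      unfolding k0_def by (rule isCont_o2)
    then have "(\<Theta> \<longlongrightarrow> - \<i> * deriv K (H z0)) (at z0)"
      unfolding \<Theta>_def isCont_def by (rule tendsto_mult_left)
    then have "(\<Theta> \<longlongrightarrow> 0) (at z0)"
      using K'0 by simp
    then have "\<forall>\<^sub>F z in at z0. dist (\<Theta> z) 0 < min e s"
      using e s by (intro tendstoD) auto
    moreover have "\<forall>\<^sub>F z in at z0. dist (H z) k0 < \<rho>"
      using \<open>isCont H z0\<close> \<rho>(1) unfolding k0_def isCont_def by (intro tendstoD) auto
    moreover have "\<forall>\<^sub>F z in at z0. z \<in> ball z0 r"
      using r(1) by (intro eventually_at_in_open') auto
    ultimately have "\<forall>\<^sub>F z in at z0. dist (\<Theta> z) 0 < min e s \<and> dist (H z) k0 < \<rho> \<and> z \<in> ball z0 r"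
      by eventually_elim blast
    then obtain d where d: "d > 0" "\<And>z. z \<noteq> z0 \<Longrightarrow> dist z z0 < d \<Longrightarrow>
        dist (\<Theta> z) 0 < min e s \<and> dist (H z) k0 < \<rho> \<and> z \<in> ball z0 r"
      unfolding eventually_at by blast
    obtain z where z0d: "z \<in> degenerate" "z \<noteq> z0" "dist z z0 < d"
      using lim d(1) unfolding islimpt_approachable by blast
    have z: "z \<in> degenerate" "z \<noteq> z0" "cmod (\<Theta> z) < min e s" "dist (H z) k0 < \<rho>" "z \<in> ball z0 r"
      using z0d d(2)[OF z0d(2,3)] by auto
    define t where "t = Im (deriv K (H z))"
    have zc: "z \<in> crit_set f" and z_im: "Im (wronsk z * cnj (dir c z) ^ 3) = 0"
      using z(1) by (auto simp: degenerate_def)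
    have Kt: "deriv K (H z) = \<i> * of_real t"
      using crit[OF z(5)] zc by (simp add: t_def complex_eq_iff)
    then have \<Theta>t: "\<Theta> z = of_real t"
      by (simp add: \<Theta>_def)
    have Hz: "H z \<in> ball k0 \<rho>"
      using z(4) by (simp add: dist_commute)
    have "t \<noteq> 0"
    proof
      assume "t = 0"
      then have "deriv K (H z) = deriv K k0"
        using Kt K'0 by (simp add: k0_def)
      then have "H z = k0"
        using \<rho>(4,1) Hz by (auto simp: inj_on_def)
      then show False
        using z(2,5) r(1,4) by (auto simp: inj_on_def k0_def)
    qed
    moreover have "D (of_real t) = 0"
    proof -
      \<comment> \<open>\<open>\<kappa>'\<close> is the reciprocal of \<open>K'' = 2 * u\<close>,
        and degeneracy of \<open>z\<close> says that \<open>u\<close> is real.\<close>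
      define u where "u = wronsk z * cnj (dir c z) ^ 3 / of_real ((cmod (dir c z) ^ 3)\<^sup>2)"
      have "wronsk z / dir c z ^ 3 = u"
        unfolding u_def by (subst complex_div_cnj) (simp add: norm_power)
      then have "deriv (deriv K) (H z) = 2 * u"
        using K''[OF z(5)] by (metis times_divide_eq_right)
      then have "deriv \<kappa> (deriv K (H z)) = 1 / (2 * u)"
        using \<kappa>(2)[OF Hz] by (cases "u = 0") (simp_all add: eq_divide_eq mult_ac)
      moreover have "Im u = 0"
        unfolding u_def using z_im by (simp only: Im_divide_of_real)
      ultimately show ?thesis
        unfolding D_Im Kt[symmetric] by (simp add: Im_divide)
    qed
    ultimately show "\<exists>x'\<in>{\<sigma> \<in> ball 0 s. D \<sigma> = 0}. x' \<noteq> 0 \<and> dist x' 0 < e"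
      using z(3) \<Theta>t by (intro bexI[of _ "of_real t"]) auto
  qed
  have D0: "D \<sigma> = 0" if "\<sigma> \<in> ball 0 s" for \<sigma>
    by (rule analytic_continuation[OF D_holo open_ball connected_ball, of "{\<sigma> \<in> ball 0 s. D \<sigma> = 0}" 0])
      (use lim0 s that in auto)
  define I where "I = {-s<..<s}"
  have cvx: "convex I"
    by (simp add: I_def)
  have tW: "\<i> * of_real t \<in> W" if "t \<in> I" for t
    using s(2) that by (auto simp: I_def norm_mult)
  have k_der: "(\<kappa> has_field_derivative deriv \<kappa> (\<i> * of_real t)) (at (0 + of_real t * \<i>))" if "t \<in> I" for t
    using holomorphic_derivI[OF hk(1) \<open>open W\<close> tW[OF that]] by (simp add: mult.commute)
  have Im0: "Im (deriv \<kappa> (\<i> * of_real t)) = 0" if "t \<in> I" for t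
    using D0[of "of_real t"] that unfolding D_Im by (simp add: I_def abs_less_iff)
  have "((\<lambda>t. Re (\<kappa> (0 + of_real t * \<i>))) has_real_derivative 0) (at t within I)" if "t \<in> I" for t
    using has_real_derivative_along_line(1)[OF k_der[OF that]] Im0[OF that]
    by (auto intro: has_field_derivative_at_within)
  from has_field_derivative_zero_constant[OF cvx this]
  obtain a where a: "\<And>t. t \<in> I \<Longrightarrow> Re (\<kappa> (0 + of_real t * \<i>)) = a"
    by blast
  have "((\<lambda>t. Im (K (\<kappa> (0 + of_real t * \<i>)))) has_real_derivative 0) (at t within I)" if t: "t \<in> I" for t
  proof -
    have "\<kappa> (\<i> * of_real t) \<in> V"
      using KW[OF tW[OF t]] \<rho>(2) by blast
    then have "(K has_field_derivative \<i> * of_real t) (at (\<kappa> (0 + of_real t * \<i>)))"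
      using holomorphic_derivI[OF hK(1) k0V(2)] KW[OF tW[OF t]] by (metis add_0 mult.commute)
    from DERIV_chain[OF this k_der[OF t]]
    have "((\<lambda>\<sigma>. K (\<kappa> \<sigma>)) has_field_derivative \<i> * of_real t * deriv \<kappa> (\<i> * of_real t)) (at (0 + of_real t * \<i>))"
      by (simp add: o_def)
    from has_real_derivative_along_line(2)[OF this] Im0[OF t] show ?thesis
      by (auto intro: has_field_derivative_at_within)
  qed
  from has_field_derivative_zero_constant[OF cvx this]
  obtain b where b: "\<And>t. t \<in> I \<Longrightarrow> Im (K (\<kappa> (0 + of_real t * \<i>))) = b"
    by blast
  let ?p = "\<lambda>t. G (\<kappa> (\<i> * of_real t))"
  have Hp: "?p t \<in> ball z0 r \<and> H (?p t) = \<kappa> (\<i> * of_real t)" if "t \<in> I" for t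
  proof -
    have "\<kappa> (\<i> * of_real t) \<in> H ` ball z0 r"
      using KW[OF tW[OF that]] \<rho>(2) V_def by blast
    then show ?thesis
      using G by auto
  qed
  have "inj_on ?p I"
  proof (rule inj_onI)
    fix t t' assume t: "t \<in> I" "t' \<in> I" "?p t = ?p t'"
    then have "deriv K (\<kappa> (\<i> * of_real t)) = deriv K (\<kappa> (\<i> * of_real t'))"
      using Hp by metis
    then show "t = t'"
      using KW[OF tW[OF t(1)]] KW[OF tW[OF t(2)]] by simp
  qed
  moreover have "infinite I"
    using s by (simp add: I_def)
  ultimately have "infinite (?p ` I)"
    using finite_imageD by blast
  moreover have "f z = Complex a b / c" if z: "z \<in> ?p ` I" for z
  proof -
    obtain t where t: "t \<in> I" "z = ?p t"
      using z by blast
    have "Re (c * f z) = a" "Im (c * f z) = b"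
      using ReH[of z] ImK[of z] Hp[OF t(1)] a[OF t(1)] b[OF t(1)] t(2) by (simp_all add: mult.commute)
    then have "c * f z = Complex a b"
      by (simp only: complex_eq_iff complex.sel simp_thms)
    moreover have "c \<noteq> 0"
      using c(1) by auto
    ultimately show ?thesis
      by (simp add: field_simps)
  qed
  ultimately show False
    by (rule infinite_fibre_False)
qed

lemma deriv_not_both_zero:
  obtains z where "deriv h z \<noteq> 0 \<or> deriv g z \<noteq> 0"
proof (rule ccontr)
  assume "\<not> thesis"
  then have "deriv h z = 0" "deriv g z = 0" for z
    using that by blast+
  then have "(h has_field_derivative 0) (at z)" "(g has_field_derivative 0) (at z)" for z
    using h_deriv[of z UNIV] g_deriv[of z UNIV] by simp_all
  then have "h z = h 0" "g z = g 0" for z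
    using has_field_derivative_zero_constant[of UNIV h] has_field_derivative_zero_constant[of UNIV g] by auto
  then have "\<And>z. z \<in> UNIV \<Longrightarrow> f z = f 0"
    unfolding f_eq by metis
  then show False
    using infinite_fibre_False[OF infinite_UNIV_char_0] by blast
qed

text \<open>If none of \<open>h'\<close>, \<open>g'\<close>, \<open>wronsk\<close> vanishes
  identically, the set is covered by the countable zero sets of \<open>h'\<close> and
  \<open>wronsk\<close> and a set of isolated points. Otherwise every critical point is a common
  zero of \<open>h'\<close> and \<open>g'\<close>: this is immediate if one of these vanishes
  identically. If \<open>wronsk\<close> does, then \<open>h' = c * g'\<close> with a constant
  \<open>c\<close>; \<open>cmod c \<noteq> 1\<close> forces \<open>g' = 0\<close> at critical
  points, and \<open>cmod c = 1\<close> contradicts finite valence.\<close>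

lemma countable_degenerate: "countable degenerate"
proof (cases "\<exists>z1 z2 z3. deriv h z1 \<noteq> 0 \<and> deriv g z2 \<noteq> 0 \<and> wronsk z3 \<noteq> 0")
  case True
  then have "countable {z. deriv h z = 0}" "countable {z. wronsk z = 0}"
    using entire_zeros_countable holo_derivs wronsk_holo by metis+
  moreover have "countable ({z. deriv h z \<noteq> 0 \<and> wronsk z \<noteq> 0} \<inter> degenerate)"
  proof -
    have op: "open {z. deriv h z \<noteq> 0 \<and> wronsk z \<noteq> 0}"
      by (intro open_Collect_conj open_Collect_neq continuous_intros
          holomorphic_on_imp_continuous_on wronsk_holo)
    have "\<not> z islimpt degenerate" if "deriv h z \<noteq> 0" "wronsk z \<noteq> 0" for z
      using degenerate_isolated[of z] that closed_degenerate closed_limpt by blast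
    then have "degenerate sparse_in {z. deriv h z \<noteq> 0 \<and> wronsk z \<noteq> 0}"
      using op by (simp add: sparse_in_open)
    then show ?thesis
      by (rule sparse_imp_countable[OF op])
  qed
  ultimately have "countable ({z. deriv h z = 0} \<union> {z. wronsk z = 0} \<union>
      ({z. deriv h z \<noteq> 0 \<and> wronsk z \<noteq> 0} \<inter> degenerate))"
    by simp
  then show ?thesis
    by (rule countable_subset[rotated]) auto
next
  case False
  obtain z where z: "deriv h z \<noteq> 0 \<or> deriv g z \<noteq> 0"
    by (rule deriv_not_both_zero)
  have sub: "degenerate \<subseteq> {z. deriv h z = 0}" "degenerate \<subseteq> {z. deriv g z = 0}"
    if "\<And>z. z \<in> crit_set f \<Longrightarrow> deriv h z = 0"
    using that by (auto simp: degenerate_def crit_iff) (metis norm_eq_zero)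
  from False consider "\<And>z. deriv h z = 0" | "\<And>z. deriv g z = 0" | "\<And>z. wronsk z = 0" "\<exists>z. deriv g z \<noteq> 0"
    by blast
  then have "\<And>z. z \<in> crit_set f \<Longrightarrow> deriv h z = 0"
  proof cases
    case 3
    then obtain z1 where z1: "deriv g z1 \<noteq> 0"
      by blast
    define c where "c = deriv h z1 / deriv g z1"
    have "open {z. deriv g z \<noteq> 0}"
      by (intro open_Collect_neq continuous_intros)
    then obtain e where e: "e > 0" "ball z1 e \<subseteq> {z. deriv g z \<noteq> 0}"
      using z1 openE by (metis mem_Collect_eq)
    have "(psi h g has_field_derivative 0) (at z within ball z1 e)" if "z \<in> ball z1 e" for z
      using psi_deriv(2)[of z] subsetD[OF e(2) that] 3(1)[of z] by (auto intro: has_field_derivative_at_within)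
    then have "psi h g z = psi h g z1" if "z \<in> ball z1 e" for z
      using has_field_derivative_zero_constant[of "ball z1 e" "psi h g"] that e(1) by auto
    then have on_ball: "deriv h z = c * deriv g z" if "z \<in> ball z1 e" for z
      using psi_deriv(1)[of z] psi_deriv(1)[OF z1] e(2) that by (auto simp: c_def field_simps)
    have hc: "deriv h z - c * deriv g z = 0" for z
    proof (rule analytic_continuation[of "\<lambda>z. deriv h z - c * deriv g z" UNIV "ball z1 e" z1 z])
      show "(\<lambda>z. deriv h z - c * deriv g z) holomorphic_on UNIV"
        by (intro holomorphic_intros holo_derivs)
      show "z1 islimpt ball z1 e"
        using e(1) by (simp add: islimpt_ball)
    qed (use on_ball in auto)
    show "deriv h z = 0" if "z \<in> crit_set f" for z
    proof (cases "cmod c = 1")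
      case False
      have "cmod c * cmod (deriv g z) = cmod (deriv g z)"
        using hc[of z] that by (simp add: crit_iff norm_mult)
      then show ?thesis
        using False hc[of z] by auto
    next
      case True
      \<comment> \<open>All points are critical and \<open>K''\<close> vanishes, so
        \<open>K' = 0\<close> and \<open>K\<close> is constant near \<open>k0\<close>:
        \<open>f\<close> collapses a vertical segment to a point.\<close>
      have crit_all: "z \<in> crit_set f" for z
        using hc[of z] True by (simp add: crit_iff norm_mult)
      have h1: "deriv h z1 \<noteq> 0"
        using hc[of z1] True z1 by auto
      obtain c1 where c1: "cmod c1 = 1" "c1 * deriv h z1 = cnj c1 * deriv g z1"
        using crit_unit_dir[OF crit_all h1] by metis
      obtain r H G K where r: "0 < r" "r \<le> 1" "open (H ` ball z1 r)" "inj_on H (ball z1 r)" "continuous_on UNIV H"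
        and K: "K holomorphic_on H ` ball z1 r" and G: "\<And>z. z \<in> ball z1 r \<Longrightarrow> G (H z) = z"
        and ReH: "\<And>z. Re (c1 * f z) = Re (H z)"
        and ImK: "\<And>z. z \<in> ball z1 r \<Longrightarrow> Im (c1 * f z) = Im (K (H z))"
        and K'': "\<And>z. z \<in> ball z1 r \<Longrightarrow> deriv (deriv K) (H z) = 2 * wronsk z / dir c1 z ^ 3"
        and K'0: "deriv K (H z1) = 0"
        by (rule straightening[OF crit_all h1 c1 zero_less_one]) blast
      define k0 where "k0 = H z1"
      obtain s where s: "s > 0" "ball k0 s \<subseteq> H ` ball z1 r"
        using r openE[of "H ` ball z1 r" k0] by (auto simp: k0_def)
      have hK: "K holomorphic_on H ` ball z1 r" "deriv K holomorphic_on H ` ball z1 r"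
        using K r(3) holomorphic_deriv by blast+
      have "(deriv K has_field_derivative 0) (at \<zeta> within ball k0 s)" if \<zeta>: "\<zeta> \<in> ball k0 s" for \<zeta>
      proof -
        obtain z where "z \<in> ball z1 r" "\<zeta> = H z"
          using subsetD[OF s(2) \<zeta>] by blast
        then have "deriv (deriv K) \<zeta> = 0"
          using K''[of z] 3(1) by simp
        then show ?thesis
          using holomorphic_derivI[OF hK(2) r(3), of \<zeta>] that s by auto
      qed
      then have K'z: "deriv K \<zeta> = 0" if "\<zeta> \<in> ball k0 s" for \<zeta>
        using has_field_derivative_zero_constant[of "ball k0 s" "deriv K"] that K'0 s(1)
        by (auto simp: k0_def)
      then have "(K has_field_derivative 0) (at \<zeta> within ball k0 s)" if "\<zeta> \<in> ball k0 s" for \<zeta>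
        using holomorphic_derivI[OF hK(1) r(3), of \<zeta>] that s by fastforce
      then obtain b where b: "\<And>\<zeta>. \<zeta> \<in> ball k0 s \<Longrightarrow> K \<zeta> = b"
        using has_field_derivative_zero_constant[of "ball k0 s" K] by auto
      define p where "p = (\<lambda>t. k0 + \<i> * complex_of_real t)"
      have p: "p t \<in> ball k0 s" if "t \<in> {0<..<s}" for t
        using that by (simp add: p_def dist_norm norm_mult)
      have Hp: "G (p t) \<in> ball z1 r \<and> H (G (p t)) = p t" if "t \<in> {0<..<s}" for t
        using p[OF that] s(2) G by auto
      have "inj_on (\<lambda>t. G (p t)) {0<..<s}"
      proof (rule inj_onI)
        fix t t' assume t: "t \<in> {0<..<s}" "t' \<in> {0<..<s}" "G (p t) = G (p t')"
        then have "p t = p t'"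
          using Hp by metis
        then show "t = t'"
          by (simp add: p_def)
      qed
      then have "infinite ((\<lambda>t. G (p t)) ` {0<..<s})"
        using s(1) finite_imageD infinite_Ioo by blast
      moreover have "f z = Complex (Re k0) (Im b) / c1" if z: "z \<in> (\<lambda>t. G (p t)) ` {0<..<s}" for z
      proof -
        obtain t where t: "t \<in> {0<..<s}" "z = G (p t)"
          using z by blast
        have "Re (c1 * f z) = Re k0" "Im (c1 * f z) = Im b"
          using ReH[of z] ImK[of z] Hp[OF t(1)] b[OF p[OF t(1)]] t(2) by (simp_all add: p_def)
        then have "c1 * f z = Complex (Re k0) (Im b)"
          by (simp only: complex_eq_iff complex.sel simp_thms)
        moreover have "c1 \<noteq> 0"
          using c1(1) by auto
        ultimately show ?thesis
          by (simp add: field_simps)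
      qed
      ultimately show ?thesis
        using infinite_fibre_False by blast
    qed
  qed (auto simp: crit_iff)
  note sub = sub[OF this]
  show ?thesis
    using z
  proof
    assume "deriv h z \<noteq> 0"
    then have "countable {z. deriv h z = 0}"
      by (intro entire_zeros_countable holo_derivs)
    then show ?thesis
      using sub(1) countable_subset by blast
  next
    assume "deriv g z \<noteq> 0"
    then have "countable {z. deriv g z = 0}"
      by (intro entire_zeros_countable holo_derivs)
    then show ?thesis
      using sub(2) countable_subset by blast
  qed
qed

end

section \<open>Valences on both sides of a generic arc\<close>

text \<open>Injectivity makes \<open>x\<close> strictly monotone, so the value at an inner point
  lies strictly between the end values. It is applied to the horizontal coordinate of the arc in a
  fold chart, which therefore runs over a full neighbourhood of 0.\<close>

lemma continuous_inj_covers_nbhd: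
  fixes x :: "real \<Rightarrow> real"
  assumes "a < t0" "t0 < b" "continuous_on {a..b} x" "inj_on x {a..b}"
  obtains e where "e > 0" "\<And>y. \<bar>y - x t0\<bar> < e \<Longrightarrow> \<exists>t\<in>{a..b}. x t = y"
proof -
  define lo hi where "lo = min (x a) (x b)" and "hi = max (x a) (x b)"
  have mono: "lo < x t0" "x t0 < hi"
    using continuous_inj_imp_mono[OF assms] by (auto simp: lo_def hi_def)
  have "connected (x ` {a..b})"
    using assms(3) by (intro connected_continuous_image) auto
  moreover have "lo \<in> x ` {a..b}" "hi \<in> x ` {a..b}"
    using assms(1,2) by (auto simp: lo_def hi_def min_def max_def)
  ultimately have sub: "{lo..hi} \<subseteq> x ` {a..b}"
    by (rule connected_contains_Icc)
  show ?thesis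
  proof (rule that[of "min (x t0 - lo) (hi - x t0)"])
    fix y assume "\<bar>y - x t0\<bar> < min (x t0 - lo) (hi - x t0)"
    then have "y \<in> {lo..hi}"
      by (auto simp: abs_less_iff)
    then have "y \<in> x ` {a..b}"
      using sub by blast
    then show "\<exists>t\<in>{a..b}. x t = y"
      by blast
  qed (use mono in auto)
qed

lemma finite_pos_lower_bound:
  fixes \<epsilon> :: "'a \<Rightarrow> real"
  assumes "finite S" "\<And>z. z \<in> S \<Longrightarrow> \<epsilon> z > 0" "e0 > 0"
  obtains e where "0 < e" "e \<le> e0" "\<And>z. z \<in> S \<Longrightarrow> e \<le> \<epsilon> z"
  by (rule that[of "Min (insert e0 (\<epsilon> ` S))"]) (use assms in auto)

text \<open>The function \<open>m\<close> may be discontinuous, but \<open>m \<le> 0\<close> puts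
  the whole height \<open>\<sigma> / 2\<close> above the graph. Each point is joined vertically to
  that height and then horizontally to the point over 0.\<close>

lemma connected_region_above:
  fixes m :: "real \<Rightarrow> real"
  assumes "cmod c = 1" "\<sigma> > 0" and m: "\<And>x. \<bar>x\<bar> < \<sigma> \<Longrightarrow> m x \<le> 0"
  shows "connected {w. \<bar>Re (c * (w - w0))\<bar> < \<sigma> \<and> \<bar>Im (c * (w - w0))\<bar> < \<sigma> \<and>
                       m (Re (c * (w - w0))) < Im (c * (w - w0))}" (is "connected ?D")
proof -
  define Q where "Q = (\<lambda>x y. w0 + Complex x y / c)"
  have c0: "c \<noteq> 0"
    using assms(1) by auto
  have Q: "c * (Q x y - w0) = Complex x y" for x y
    using c0 by (simp add: Q_def)
  have QD: "Q x y \<in> ?D \<longleftrightarrow> \<bar>x\<bar> < \<sigma> \<and> \<bar>y\<bar> < \<sigma> \<and> m x < y" for x y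
    by (simp add: Q del: times_complex.sel minus_complex.sel)
  have eqQ: "w = Q (Re (c * (w - w0))) (Im (c * (w - w0)))" for w
    using c0 by (simp add: Q_def del: times_complex.sel minus_complex.sel)
  have contQ: "continuous_on S (\<lambda>t. Q (u t) (v t))" if "continuous_on S u" "continuous_on S v" for S :: "real set" and u v
    unfolding Q_def Complex_eq using that c0 by (intro continuous_intros) auto
  have to_top: "\<exists>C. connected C \<and> C \<subseteq> ?D \<and> w \<in> C \<and> Q 0 (\<sigma>/2) \<in> C" if w: "w \<in> ?D" for w
  proof -
    define x y where "x = Re (c * (w - w0))" and "y = Im (c * (w - w0))"
    have wQ: "w = Q x y"
      unfolding x_def y_def by (rule eqQ)
    have xy: "\<bar>x\<bar> < \<sigma>" "\<bar>y\<bar> < \<sigma>" "m x < y"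
      using w unfolding wQ QD by auto
    let ?C1 = "(\<lambda>t. Q x t) ` closed_segment y (\<sigma>/2)" and ?C2 = "(\<lambda>t. Q t (\<sigma>/2)) ` closed_segment x 0"
    have "connected ?C1" "connected ?C2"
      by (intro connected_continuous_image contQ continuous_intros connected_segment)+
    moreover have "Q x (\<sigma>/2) \<in> ?C1 \<inter> ?C2"
      by auto
    ultimately have "connected (?C1 \<union> ?C2)"
      by (intro connected_Un) auto
    moreover have "?C1 \<subseteq> ?D"
    proof (rule image_subsetI)
      fix t assume "t \<in> closed_segment y (\<sigma>/2)"
      then have "min y (\<sigma>/2) \<le> t" "t \<le> max y (\<sigma>/2)"
        by (auto simp: closed_segment_eq_real_ivl split: if_splits)
      then have "\<bar>t\<bar> < \<sigma>" "m x < t"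
        using xy m[OF xy(1)] assms(2) by (auto simp: min_def max_def abs_less_iff split: if_splits)
      then show "Q x t \<in> ?D"
        using xy QD by blast
    qed
    moreover have "?C2 \<subseteq> ?D"
    proof (rule image_subsetI)
      fix t assume "t \<in> closed_segment x 0"
      then have t: "\<bar>t\<bar> < \<sigma>"
        using xy(1) by (auto simp: closed_segment_eq_real_ivl split: if_splits)
      have "m t < \<sigma>/2"
        using m[OF t] assms(2) by simp
      then show "Q t (\<sigma>/2) \<in> ?D"
        using t assms(2) unfolding QD by simp
    qed
    ultimately show ?thesis
      by (intro exI[of _ "?C1 \<union> ?C2"]) (auto simp: wQ)
  qed
  show ?thesis
  proof (subst connected_iff_connected_component, intro ballI)
    fix w w' assume "w \<in> ?D" "w' \<in> ?D"
    then obtain C C' where "connected C \<and> C \<subseteq> ?D \<and> w \<in> C \<and> Q 0 (\<sigma>/2) \<in> C"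
        "connected C' \<and> C' \<subseteq> ?D \<and> w' \<in> C' \<and> Q 0 (\<sigma>/2) \<in> C'"
      using to_top by meson
    then show "connected_component ?D w w'"
      unfolding connected_component_def by (intro exI[of _ "C \<union> C'"]) (auto intro: connected_Un)
  qed
qed

context harmonic_map
begin

lemma fold_chart_side:
  assumes "fold_chart z0 U c m \<delta>" and "w \<in> ball (f z0) \<delta>"
  shows "m (Re (c * (w - f z0))) < Im (c * (w - f z0)) \<Longrightarrow> card {z\<in>U. f z = w} = 2"
    and "Im (c * (w - f z0)) < m (Re (c * (w - f z0))) \<Longrightarrow> {z\<in>U. f z = w} = {}"
    and "z \<in> U \<Longrightarrow> z \<in> crit_set f \<Longrightarrow> f z = w \<Longrightarrow> Im (c * (w - f z0)) = m (Re (c * (w - f z0)))"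
    and "card {z \<in> U \<inter> crit_set f. f z = w} \<le> 1"
proof -
  have "cmod (c * (w - f z0)) < \<delta>"
    using assms by (simp add: fold_chart_def norm_mult dist_norm norm_minus_commute)
  then have "\<bar>Re (c * (w - f z0))\<bar> < \<delta>" "\<bar>Im (c * (w - f z0))\<bar> < \<delta>"
    using abs_Re_le_cmod abs_Im_le_cmod order_le_less_trans by blast+
  then show "m (Re (c * (w - f z0))) < Im (c * (w - f z0)) \<Longrightarrow> card {z\<in>U. f z = w} = 2"
    "Im (c * (w - f z0)) < m (Re (c * (w - f z0))) \<Longrightarrow> {z\<in>U. f z = w} = {}"
    "z \<in> U \<Longrightarrow> z \<in> crit_set f \<Longrightarrow> f z = w \<Longrightarrow> Im (c * (w - f z0)) = m (Re (c * (w - f z0)))"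
    "card {z \<in> U \<inter> crit_set f. f z = w} \<le> 1"
    using assms(1) unfolding fold_chart_def by blast+
qed

end

section \<open>Fold curves through one value and the valences beside them\<close>

context finite_harmonic_map
begin

text \<open>The charts at all preimages of \<open>w0\<close> are shrunk to a common radius. Each
  fold piece contains at most one critical preimage of \<open>w\<close>, which gives semicontinuity;
  if the count equals that at \<open>w0\<close>, every piece contains exactly one, so
  \<open>w\<close> lies on all fold graphs at once. The last two facts add the contributions 2 or 0
  of the folds to the contribution 1 of each noncritical preimage.\<close>

lemma local_picture:
  assumes w0: "w0 \<notin> cluster_inf f" and nd: "f -` {w0} \<inter> degenerate = {}"
  obtains \<rho> c m where "\<rho> > 0"
    and "\<And>z. f z = w0 \<Longrightarrow> z \<in> crit_set f \<Longrightarrow> cmod (c z) = 1"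
    and "\<And>z x. f z = w0 \<Longrightarrow> z \<in> crit_set f \<Longrightarrow> 0 < \<bar>x\<bar> \<Longrightarrow> \<bar>x\<bar> < \<rho> \<Longrightarrow> m z x < (0::real)"
    and "\<And>z. f z = w0 \<Longrightarrow> z \<in> crit_set f \<Longrightarrow> \<exists>C. \<forall>x. \<bar>x\<bar> < \<rho> \<longrightarrow> \<bar>m z x\<bar> \<le> C * x\<^sup>2"
    and "\<And>w. w \<in> ball w0 \<rho> \<Longrightarrow> card {z\<in>crit_set f. f z = w} \<le> card {z\<in>crit_set f. f z = w0}"
    and "\<And>w z. w \<in> ball w0 \<rho> \<Longrightarrow> card {z\<in>crit_set f. f z = w} = card {z\<in>crit_set f. f z = w0} \<Longrightarrow>
        f z = w0 \<Longrightarrow> z \<in> crit_set f \<Longrightarrow> Im (c z * (w - w0)) = m z (Re (c z * (w - w0)))"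
    and "\<And>w. w \<in> ball w0 \<rho> \<Longrightarrow> w \<in> f ` crit_set f \<Longrightarrow>
        \<exists>z\<in>crit_set f. f z = w0 \<and> Im (c z * (w - w0)) = m z (Re (c z * (w - w0)))"
    and "\<And>w. w \<in> ball w0 \<rho> \<Longrightarrow>
        (\<And>z. f z = w0 \<Longrightarrow> z \<in> crit_set f \<Longrightarrow> m z (Re (c z * (w - w0))) < Im (c z * (w - w0))) \<Longrightarrow>
        card {z. f z = w} = card {z. f z = w0 \<and> z \<notin> crit_set f} + 2 * card {z. f z = w0 \<and> z \<in> crit_set f}"
    and "\<And>w. w \<in> ball w0 \<rho> \<Longrightarrow>
        (\<And>z. f z = w0 \<Longrightarrow> z \<in> crit_set f \<Longrightarrow> Im (c z * (w - w0)) < m z (Re (c z * (w - w0)))) \<Longrightarrow>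
        card {z. f z = w} = card {z. f z = w0 \<and> z \<notin> crit_set f}"
proof -
  define Q where "Q = (\<lambda>z U. if z \<in> crit_set f then \<exists>c m \<delta>. fold_chart z U c m \<delta> else local_homeo_nbhd U)"
  have ex: "\<exists>U. open U \<and> z \<in> U \<and> U \<subseteq> ball z e \<and> Q z U" if "f z = w0" "e > 0" for z e
  proof (cases "z \<in> crit_set f")
    case True
    moreover have "z \<notin> degenerate"
      using nd that by auto
    ultimately show ?thesis
      using fold_chart_exists[OF True _ that(2)] by (simp add: Q_def)
  next
    case False
    then show ?thesis
      using local_homeo_nbhd_exists[OF False that(2)] by (simp add: Q_def)
  qed
  obtain U \<rho>0 where \<rho>0: "\<rho>0 > 0" and U: "\<And>z. f z = w0 \<Longrightarrow> open (U z) \<and> z \<in> U z \<and> Q z (U z)"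
    and cover: "\<And>w. w \<in> ball w0 \<rho>0 \<Longrightarrow> {z. f z = w} \<subseteq> (\<Union>z\<in>{z. f z = w0}. U z)"
    and count: "\<And>w A. w \<in> ball w0 \<rho>0 \<Longrightarrow>
        card {z\<in>A. f z = w} = (\<Sum>z\<in>{z. f z = w0}. card {x \<in> U z \<inter> A. f x = w})"
    by (rule local_counting[OF w0, of Q]) (use ex in blast)+
  define Z where "Z = {z. f z = w0}"
  have finZ: "finite Z"
    unfolding Z_def by (rule finite_preimage)
  have "\<forall>z\<in>Z \<inter> crit_set f. \<exists>c m \<delta>. fold_chart z (U z) c m \<delta>"
    using U by (auto simp: Q_def Z_def)
  then obtain c m \<delta> where chart: "\<And>z. z \<in> Z \<Longrightarrow> z \<in> crit_set f \<Longrightarrow> fold_chart z (U z) (c z) (m z) (\<delta> z)"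
    by (metis IntI)
  have homeo: "local_homeo_nbhd (U z)" if "z \<in> Z" "z \<notin> crit_set f" for z
    using U that by (auto simp: Q_def Z_def)
  have "\<exists>e>0. z \<in> crit_set f \<and> e = \<delta> z \<or> z \<notin> crit_set f \<and> ball w0 e \<subseteq> f ` U z" if z: "z \<in> Z" for z
  proof (cases "z \<in> crit_set f")
    case True
    then show ?thesis
      using chart[OF z True] by (auto simp: fold_chart_def)
  next
    case False
    have "w0 \<in> f ` U z" "open (f ` U z)"
      using U z homeo[OF z False] by (auto simp: Z_def local_homeo_nbhd_def)
    then show ?thesis
      using False openE by metis
  qed
  then obtain \<epsilon> where \<epsilon>: "\<And>z. z \<in> Z \<Longrightarrow> \<epsilon> z > 0"
      "\<And>z. z \<in> Z \<Longrightarrow> z \<in> crit_set f \<and> \<epsilon> z = \<delta> z \<or> z \<notin> crit_set f \<and> ball w0 (\<epsilon> z) \<subseteq> f ` U z"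
    by metis
  obtain \<rho> where \<rho>: "0 < \<rho>" "\<rho> \<le> \<rho>0" "\<And>z. z \<in> Z \<Longrightarrow> \<rho> \<le> \<epsilon> z"
    by (rule finite_pos_lower_bound[OF finZ _ \<rho>0, of \<epsilon>]) (use \<epsilon>(1) in blast)+
  have \<rho>\<delta>: "\<rho> \<le> \<delta> z" if "z \<in> Z" "z \<in> crit_set f" for z
    using \<rho>(3)[OF that(1)] \<epsilon>(2)[OF that(1)] that(2) by auto
  have one: "card {x\<in>U z. f x = w} = 1" if "z \<in> Z" "z \<notin> crit_set f" "w \<in> ball w0 \<rho>" for z w
  proof -
    have "w \<in> f ` U z"
      using \<rho>(3)[OF that(1)] \<epsilon>(2)[OF that(1)] that(2,3) by fastforce
    then show ?thesis
      by (rule local_homeo_count(1)[OF homeo[OF that(1,2)]])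
  qed
  have sides: "m z (Re (c z * (w - w0))) < Im (c z * (w - w0)) \<Longrightarrow> card {x\<in>U z. f x = w} = 2"
      "Im (c z * (w - w0)) < m z (Re (c z * (w - w0))) \<Longrightarrow> {x\<in>U z. f x = w} = {}"
      "x \<in> U z \<Longrightarrow> x \<in> crit_set f \<Longrightarrow> f x = w \<Longrightarrow> Im (c z * (w - w0)) = m z (Re (c z * (w - w0)))"
      "card {x \<in> U z \<inter> crit_set f. f x = w} \<le> 1"
    if z: "z \<in> Z" "z \<in> crit_set f" and w: "w \<in> ball w0 \<rho>" for z w x
  proof -
    have fz: "f z = w0"
      using z by (simp add: Z_def)
    have "w \<in> ball (f z) (\<delta> z)"
      using w \<rho>\<delta>[OF z] fz by simp
    note S = fold_chart_side[OF chart[OF z] this, unfolded fz]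
    show "m z (Re (c z * (w - w0))) < Im (c z * (w - w0)) \<Longrightarrow> card {x\<in>U z. f x = w} = 2"
      "Im (c z * (w - w0)) < m z (Re (c z * (w - w0))) \<Longrightarrow> {x\<in>U z. f x = w} = {}"
      "x \<in> U z \<Longrightarrow> x \<in> crit_set f \<Longrightarrow> f x = w \<Longrightarrow> Im (c z * (w - w0)) = m z (Re (c z * (w - w0)))"
      "card {x \<in> U z \<inter> crit_set f. f x = w} \<le> 1"
      by (fact S)+
  qed
  have in_ball: "w \<in> ball w0 \<rho>0" if "w \<in> ball w0 \<rho>" for w
    using that \<rho>(2) by simp
  have crit_count: "card {z\<in>crit_set f. f z = w} = (\<Sum>z\<in>Z \<inter> crit_set f. card {x \<in> U z \<inter> crit_set f. f x = w})"
    if w: "w \<in> ball w0 \<rho>" for w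
  proof -
    have "card {z\<in>crit_set f. f z = w} = (\<Sum>z\<in>Z. card {x \<in> U z \<inter> crit_set f. f x = w})"
      unfolding Z_def by (rule count[OF in_ball[OF w]])
    also have "\<dots> = (\<Sum>z\<in>Z \<inter> crit_set f. card {x \<in> U z \<inter> crit_set f. f x = w})"
    proof (rule sum.mono_neutral_right[OF finZ])
      show "\<forall>z\<in>Z - Z \<inter> crit_set f. card {x \<in> U z \<inter> crit_set f. f x = w} = 0"
        using local_homeo_count(2)[OF homeo] by (metis DiffE IntI card.empty)
    qed auto
    finally show ?thesis .
  qed
  have Zc: "{z\<in>crit_set f. f z = w0} = Z \<inter> crit_set f"
    by (auto simp: Z_def)
  have Zc': "{z. f z = w0 \<and> z \<in> crit_set f} = Z \<inter> crit_set f" "{z. f z = w0 \<and> z \<notin> crit_set f} = Z \<inter> - crit_set f"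
    by (auto simp: Z_def)
  \<comment> \<open>\<open>k\<close> is the common contribution of the folds: 2 above all graphs, 0
    below all of them.\<close>
  have total: "card {z. f z = w} = card (Z \<inter> - crit_set f) + k * card (Z \<inter> crit_set f)"
    if w: "w \<in> ball w0 \<rho>" and k: "\<And>z. z \<in> Z \<Longrightarrow> z \<in> crit_set f \<Longrightarrow> card {x\<in>U z. f x = w} = k" for w k
  proof -
    have "card {z. f z = w} = (\<Sum>z\<in>Z. card {x \<in> U z. f x = w})"
      using count[OF in_ball[OF w], of UNIV] by (simp add: Z_def)
    also have "\<dots> = (\<Sum>z\<in>Z. if z \<in> crit_set f then k else 1)"
      by (rule sum.cong) (use one[OF _ _ w] k in auto)
    also have "\<dots> = k * card (Z \<inter> crit_set f) + card (Z \<inter> - crit_set f)"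
      using finZ by (simp add: sum.If_cases Collect_neg_eq)
    finally show ?thesis
      by simp
  qed
  show ?thesis
  proof (rule that[of \<rho> c m])
    fix z assume z: "f z = w0" "z \<in> crit_set f"
    then have zZ: "z \<in> Z"
      by (simp add: Z_def)
    note ch = chart[OF zZ z(2)]
    show "cmod (c z) = 1"
      using ch by (simp add: fold_chart_def)
    show "m z x < 0" if "0 < \<bar>x\<bar>" "\<bar>x\<bar> < \<rho>" for x
    proof -
      have "\<bar>x\<bar> < \<delta> z"
        using that \<rho>\<delta>[OF zZ z(2)] by simp
      then show ?thesis
        using ch that(1) unfolding fold_chart_def by blast
    qed
    show "\<exists>C. \<forall>x. \<bar>x\<bar> < \<rho> \<longrightarrow> \<bar>m z x\<bar> \<le> C * x\<^sup>2"
    proof -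
      obtain C where "\<And>x. \<bar>x\<bar> < \<delta> z \<Longrightarrow> \<bar>m z x\<bar> \<le> C * x\<^sup>2"
        using ch unfolding fold_chart_def by blast
      then show ?thesis
        using \<rho>\<delta>[OF zZ z(2)] by (meson order_less_le_trans)
    qed
  next
    fix w assume w: "w \<in> ball w0 \<rho>"
    show le: "card {z\<in>crit_set f. f z = w} \<le> card {z\<in>crit_set f. f z = w0}"
    proof -
      have "card {z\<in>crit_set f. f z = w} \<le> (\<Sum>z\<in>Z \<inter> crit_set f. 1)"
        unfolding crit_count[OF w] by (rule sum_mono) (use sides(4)[OF _ _ w] in auto)
      then show ?thesis
        unfolding Zc by simp
    qed
    show "Im (c z * (w - w0)) = m z (Re (c z * (w - w0)))"
      if eq: "card {z\<in>crit_set f. f z = w} = card {z\<in>crit_set f. f z = w0}" and z: "f z = w0" "z \<in> crit_set f" for z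
    proof -
      have zZ: "z \<in> Z"
        using z by (simp add: Z_def)
      let ?k = "\<lambda>z. card {x \<in> U z \<inter> crit_set f. f x = w}"
      have "(\<Sum>z\<in>Z \<inter> crit_set f. ?k z) = (\<Sum>z\<in>Z \<inter> crit_set f. 1)"
        using eq unfolding crit_count[OF w] Zc by simp
      then have "?k z = 1"
        by (rule sum_mono_inv) (use sides(4)[OF _ _ w] finZ zZ z in auto)
      then obtain x where "x \<in> {x \<in> U z \<inter> crit_set f. f x = w}"
        by (metis card.empty ex_in_conv zero_neq_one)
      then show ?thesis
        using sides(3)[OF zZ z(2) w, of x] by simp
    qed
    show "\<exists>z\<in>crit_set f. f z = w0 \<and> Im (c z * (w - w0)) = m z (Re (c z * (w - w0)))" if img: "w \<in> f ` crit_set f"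
    proof -
      obtain x where x: "x \<in> crit_set f" "f x = w"
        using img by auto
      then obtain z where z: "z \<in> Z" "x \<in> U z"
        using cover[OF in_ball[OF w]] by (auto simp: Z_def)
      have zc: "z \<in> crit_set f"
        using homeo[OF z(1)] z(2) x(1) by (auto simp: local_homeo_nbhd_def)
      show ?thesis
        using sides(3)[OF z(1) zc w z(2) x] zc z(1) by (intro bexI[of _ z]) (simp_all add: Z_def)
    qed
    show "card {z. f z = w} = card {z. f z = w0 \<and> z \<notin> crit_set f} + 2 * card {z. f z = w0 \<and> z \<in> crit_set f}"
      if "\<And>z. f z = w0 \<Longrightarrow> z \<in> crit_set f \<Longrightarrow> m z (Re (c z * (w - w0))) < Im (c z * (w - w0))"
      unfolding Zc' by (rule total[OF w]) (use sides(1)[OF _ _ w] that Z_def in blast)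
    show "card {z. f z = w} = card {z. f z = w0 \<and> z \<notin> crit_set f}"
      if below: "\<And>z. f z = w0 \<Longrightarrow> z \<in> crit_set f \<Longrightarrow> Im (c z * (w - w0)) < m z (Re (c z * (w - w0)))"
    proof -
      have "card {z. f z = w} = card (Z \<inter> - crit_set f) + 0 * card (Z \<inter> crit_set f)"
      proof (rule total[OF w])
        fix z assume z: "z \<in> Z" "z \<in> crit_set f"
        then have "{x \<in> U z. f x = w} = {}"
          using sides(2)[OF z w] below Z_def by blast
        then show "card {x \<in> U z. f x = w} = 0"
          by (simp only: card.empty)
      qed
      then show ?thesis
        unfolding Zc' by simp
    qed
  qed (fact \<rho>(1))
qed

text \<open>By the constant count the arc lies on every fold graph at \<open>w0\<close>, and near
  \<open>w0\<close> each graph is in turn contained in the arc. The test point for \<open>A\<close>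
  lies on the tangent, hence above every graph. The test point for \<open>B\<close> is any of its
  points close to \<open>w0\<close>: it is on no graph, being no critical value, and above none,
  because the region above each graph belongs to \<open>A\<close>.\<close>

lemma valences_at_tangent:
  fixes \<beta> :: "real \<Rightarrow> complex"
  assumes arc: "arc \<beta>" and offC: "path_image \<beta> \<inter> cluster_inf f = {}"
    and nd: "f -` path_image \<beta> \<inter> degenerate = {}"
    and const: "\<And>w. w \<in> path_image \<beta> \<Longrightarrow> card {z\<in>crit_set f. f z = w} = n"
    and t0: "t0 \<in> {0<..<1}" and w0_def: "w0 = \<beta> t0"
    and A: "A \<in> components (- (f ` crit_set f \<union> cluster_inf f))"
    and B: "B \<in> components (- (f ` crit_set f \<union> cluster_inf f))"
    and AB: "A \<noteq> B" and frB: "w0 \<in> frontier B"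
    and tan: "tangent_to (path_image \<beta>) w0 T"
    and seg: "\<epsilon> > 0" "\<And>s::real. 0 < \<bar>s\<bar> \<Longrightarrow> \<bar>s\<bar> < \<epsilon> \<Longrightarrow> w0 + of_real s * T \<in> A"
    and pos: "card {z. f z = w0 \<and> z \<in> crit_set f} > 0"
  shows "Val_on f B = enat (card {z. f z = w0 \<and> z \<notin> crit_set f})"
    and "Val_on f A = enat (card {z. f z = w0 \<and> z \<notin> crit_set f} + 2 * card {z. f z = w0 \<and> z \<in> crit_set f})"
proof -
  have w0: "w0 \<in> path_image \<beta>"
    using t0 by (auto simp: w0_def path_image_def)
  have w0C: "w0 \<notin> cluster_inf f" and w0nd: "f -` {w0} \<inter> degenerate = {}"
    using offC nd w0 by auto
  obtain \<rho> c m where \<rho>: "\<rho> > 0"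
    and c: "\<And>z. f z = w0 \<Longrightarrow> z \<in> crit_set f \<Longrightarrow> cmod (c z) = 1"
    and m_neg: "\<And>z x. f z = w0 \<Longrightarrow> z \<in> crit_set f \<Longrightarrow> 0 < \<bar>x\<bar> \<Longrightarrow> \<bar>x\<bar> < \<rho> \<Longrightarrow> m z x < (0::real)"
    and m_sq: "\<And>z. f z = w0 \<Longrightarrow> z \<in> crit_set f \<Longrightarrow> \<exists>C. \<forall>x. \<bar>x\<bar> < \<rho> \<longrightarrow> \<bar>m z x\<bar> \<le> C * x\<^sup>2"
    and on_graph: "\<And>w z. w \<in> ball w0 \<rho> \<Longrightarrow> card {z\<in>crit_set f. f z = w} = card {z\<in>crit_set f. f z = w0} \<Longrightarrow>
        f z = w0 \<Longrightarrow> z \<in> crit_set f \<Longrightarrow> Im (c z * (w - w0)) = m z (Re (c z * (w - w0)))"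
    and some_graph: "\<And>w. w \<in> ball w0 \<rho> \<Longrightarrow> w \<in> f ` crit_set f \<Longrightarrow>
        \<exists>z\<in>crit_set f. f z = w0 \<and> Im (c z * (w - w0)) = m z (Re (c z * (w - w0)))"
    and above: "\<And>w. w \<in> ball w0 \<rho> \<Longrightarrow>
        (\<And>z. f z = w0 \<Longrightarrow> z \<in> crit_set f \<Longrightarrow> m z (Re (c z * (w - w0))) < Im (c z * (w - w0))) \<Longrightarrow>
        card {z. f z = w} = card {z. f z = w0 \<and> z \<notin> crit_set f} + 2 * card {z. f z = w0 \<and> z \<in> crit_set f}"
    and below: "\<And>w. w \<in> ball w0 \<rho> \<Longrightarrow>
        (\<And>z. f z = w0 \<Longrightarrow> z \<in> crit_set f \<Longrightarrow> Im (c z * (w - w0)) < m z (Re (c z * (w - w0)))) \<Longrightarrow>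
        card {z. f z = w} = card {z. f z = w0 \<and> z \<notin> crit_set f}"
    by (rule local_picture[OF w0C w0nd]) blast
  define Zc where "Zc = {z\<in>crit_set f. f z = w0}"
  define X Y where "X = (\<lambda>z w. Re (c z * (w - w0)))" and "Y = (\<lambda>z w. Im (c z * (w - w0)))"
  have Zc: "f z = w0" "z \<in> crit_set f" "cmod (c z) = 1" if "z \<in> Zc" for z
    using that c by (auto simp: Zc_def)
  have finZc: "finite Zc"
    unfolding Zc_def by (rule finite_subset[OF _ finite_preimage[of w0]]) auto
  have n_pos: "n > 0"
  proof -
    have "{z. f z = w0 \<and> z \<in> crit_set f} = {z\<in>crit_set f. f z = w0}"
      by auto
    then show ?thesis
      using pos const[OF w0] by simp
  qed
  have XY_le: "\<bar>X z w\<bar> \<le> dist w0 w" "\<bar>Y z w\<bar> \<le> dist w0 w" if "z \<in> Zc" for z w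
  proof -
    have "cmod (c z * (w - w0)) = dist w0 w"
      using Zc(3)[OF that] by (simp add: norm_mult dist_norm norm_minus_commute)
    then show "\<bar>X z w\<bar> \<le> dist w0 w" "\<bar>Y z w\<bar> \<le> dist w0 w"
      unfolding X_def Y_def by (metis abs_Re_le_cmod, metis abs_Im_le_cmod)
  qed
  have XY_inj: "w = w'" if "z \<in> Zc" "X z w = X z w'" "Y z w = Y z w'" for z w w'
  proof -
    have "c z * (w - w0) = c z * (w' - w0)"
      using that(2,3) unfolding X_def Y_def by (rule complex_eqI)
    then show ?thesis
      using Zc(3)[OF that(1)] by auto
  qed
  have graph: "Y z w = m z (X z w)" if "z \<in> Zc" "w \<in> path_image \<beta>" "w \<in> ball w0 \<rho>" for z w
    unfolding X_def Y_def using that const w0 by (intro on_graph Zc) auto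
  obtain \<tau> where \<tau>: "\<tau> > 0" "0 < t0 - \<tau>" "t0 + \<tau> < 1" "\<And>t. t \<in> {t0-\<tau>..t0+\<tau>} \<Longrightarrow> \<beta> t \<in> ball w0 \<rho>"
  proof -
    have "isCont \<beta> t0"
      using arc_imp_path[OF arc] t0 continuous_on_interior[of "{0..1}" \<beta> t0] by (simp add: path_def)
    then obtain d where d: "d > 0" "\<And>t. dist t t0 < d \<Longrightarrow> dist (\<beta> t) (\<beta> t0) < \<rho>"
      unfolding continuous_at_eps_delta using \<rho> by blast
    define \<tau> where "\<tau> = min (d/2) (min (t0/2) ((1-t0)/2))"
    have pos: "\<tau> > 0" and le: "\<tau> \<le> d/2" "\<tau> \<le> t0/2" "\<tau> \<le> (1-t0)/2"
      using d t0 unfolding \<tau>_def by (simp, linarith+)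
    show ?thesis
    proof (rule that[of \<tau>])
      show "\<beta> t \<in> ball w0 \<rho>" if "t \<in> {t0-\<tau>..t0+\<tau>}" for t
      proof -
        have "dist t t0 < d"
          using that le(1) d(1) by (auto simp: dist_real_def abs_less_iff)
        then show ?thesis
          using d(2) unfolding w0_def mem_ball by (metis dist_commute)
      qed
    qed (use pos le t0 in auto)
  qed
  let ?I = "{t0-\<tau>..t0+\<tau>}"
  have I01: "?I \<subseteq> {0..1}"
    using \<tau> by auto
  have \<beta>I: "\<beta> t \<in> path_image \<beta>" "\<beta> t \<in> ball w0 \<rho>" if "t \<in> ?I" for t
    using \<tau>(4)[OF that] I01 that by (auto simp: path_image_def)
  have "\<exists>e>0. \<forall>x. \<bar>x\<bar> < e \<longrightarrow> (\<exists>t\<in>?I. X z (\<beta> t) = x)" if z: "z \<in> Zc" for z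
  proof -
    have "continuous_on ?I \<beta>"
      using arc_imp_path[OF arc] I01 continuous_on_subset unfolding path_def by blast
    then have "continuous_on ?I (\<lambda>t. X z (\<beta> t))"
      unfolding X_def by (intro continuous_intros)
    moreover have "inj_on (\<lambda>t. X z (\<beta> t)) ?I"
    proof (rule inj_onI)
      fix t t' assume t: "t \<in> ?I" "t' \<in> ?I" "X z (\<beta> t) = X z (\<beta> t')"
      then have "\<beta> t = \<beta> t'"
        using graph[OF z \<beta>I[OF t(1)]] graph[OF z \<beta>I[OF t(2)]] by (intro XY_inj[OF z]) simp_all
      then show "t = t'"
        using arc subsetD[OF I01 t(1)] subsetD[OF I01 t(2)] unfolding arc_def by (blast dest: inj_onD)
    qed
    ultimately obtain e where "e > 0" "\<And>y. \<bar>y - X z (\<beta> t0)\<bar> < e \<Longrightarrow> \<exists>t\<in>?I. X z (\<beta> t) = y"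
      using continuous_inj_covers_nbhd[of "t0-\<tau>" t0 "t0+\<tau>" "\<lambda>t. X z (\<beta> t)"] \<tau>(1) by auto
    moreover have "X z (\<beta> t0) = 0"
      by (simp add: X_def w0_def)
    ultimately show ?thesis
      by (intro exI[of _ e]) simp
  qed
  then obtain \<epsilon>X where \<epsilon>X: "\<And>z. z \<in> Zc \<Longrightarrow> \<epsilon>X z > 0" "\<And>z x. z \<in> Zc \<Longrightarrow> \<bar>x\<bar> < \<epsilon>X z \<Longrightarrow> \<exists>t\<in>?I. X z (\<beta> t) = x"
    by metis
  obtain \<rho>C where \<rho>C: "\<rho>C > 0" "ball w0 \<rho>C \<subseteq> - cluster_inf f"
    using closed_cluster_inf w0C by (meson ComplI open_Compl openE)
  \<comment> \<open>A radius for three purposes: the charts are valid, the cluster set is avoided,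
    and for every fold the arc covers the horizontal range.\<close>
  obtain \<sigma>0 where \<sigma>0: "0 < \<sigma>0" "\<sigma>0 \<le> min \<rho> \<rho>C" "\<And>z. z \<in> Zc \<Longrightarrow> \<sigma>0 \<le> \<epsilon>X z"
    by (rule finite_pos_lower_bound[OF finZc, of \<epsilon>X "min \<rho> \<rho>C"]) (use \<epsilon>X(1) \<rho> \<rho>C(1) in auto)
  \<comment> \<open>A point of the graph shares its horizontal coordinate with a point of the arc;
    both lie on the same graph, so they coincide.\<close>
  have graph_in_\<beta>: "w \<in> path_image \<beta>" if z: "z \<in> Zc" and w: "w \<in> ball w0 \<sigma>0" and eq: "Y z w = m z (X z w)" for z w
  proof -
    have "\<bar>X z w\<bar> < \<epsilon>X z"
      using XY_le(1)[OF z, of w] w \<sigma>0(3)[OF z] by simp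
    then obtain t where t: "t \<in> ?I" "X z (\<beta> t) = X z w"
      using \<epsilon>X(2)[OF z] by blast
    then have "\<beta> t = w"
      using graph[OF z \<beta>I[OF t(1)]] eq by (intro XY_inj[OF z]) auto
    then show ?thesis
      using \<beta>I(1)[OF t(1)] by simp
  qed
  have \<sigma>\<rho>: "w \<in> ball w0 \<rho>" "w \<notin> cluster_inf f" if "w \<in> ball w0 \<sigma>0" for w
    using that \<sigma>0(2) subsetD[OF \<rho>C(2), of w] by auto
  have \<beta>_crit: "w \<in> f ` crit_set f" if "w \<in> path_image \<beta>" for w
  proof -
    have "card {z\<in>crit_set f. f z = w} \<noteq> 0"
      using const[OF that] n_pos by simp
    then have "{z\<in>crit_set f. f z = w} \<noteq> {}"
      by (metis card.empty)
    then show ?thesis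
      by blast
  qed
  \<comment> \<open>A critical value near \<open>w0\<close> lies on some graph, hence on the arc,
    hence on every graph. So a single graph decides for all folds.\<close>
  have off_graph: "w \<notin> f ` crit_set f" if z: "z \<in> Zc" and w: "w \<in> ball w0 \<sigma>0" and ne: "Y z w \<noteq> m z (X z w)" for z w
  proof
    assume "w \<in> f ` crit_set f"
    then obtain z' where "z' \<in> Zc" "Y z' w = m z' (X z' w)"
      using some_graph[OF \<sigma>\<rho>(1)[OF w]] unfolding Zc_def X_def Y_def by blast
    then have "w \<in> path_image \<beta>"
      using graph_in_\<beta> w by blast
    then show False
      using graph[OF z _ \<sigma>\<rho>(1)[OF w]] ne by blast
  qed
  \<comment> \<open>The arc lies on the graph of \<open>m z = O(x\<^sup>2)\<close>, so its tangent is the real axis of the chart.\<close>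
  have ImT: "Im (c z * T) = 0" if z: "z \<in> Zc" for z
  proof -
    obtain p s0 where p: "arc p" "path_image p = path_image \<beta>" "s0 \<in> {0<..<1}" "p s0 = w0"
        "(p has_vector_derivative T) (at s0)"
      using tan unfolding tangent_to_def by blast
    obtain C where C: "\<And>x. \<bar>x\<bar> < \<rho> \<Longrightarrow> \<bar>m z x\<bar> \<le> C * x\<^sup>2"
      using m_sq[OF Zc(1,2)[OF z]] by blast
    have diff: "((\<lambda>s. (p s - p s0) /\<^sub>R (s - s0)) \<longlongrightarrow> T) (at s0)"
    proof -
      have "((\<lambda>s. norm (p s - p s0 - (s - s0) *\<^sub>R T) / norm (s - s0)) \<longlongrightarrow> 0) (at s0)"
        using p(5) by (simp add: has_vector_derivative_def has_derivative_iff_norm)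
      moreover have "\<forall>\<^sub>F s in at s0. norm (p s - p s0 - (s - s0) *\<^sub>R T) / norm (s - s0) =
          norm ((p s - p s0) /\<^sub>R (s - s0) - T)"
      proof (rule eventually_at_filter[THEN iffD2], rule always_eventually, intro allI impI)
        fix s assume "s \<noteq> s0"
        have "norm (a - u *\<^sub>R T) / norm u = norm (a /\<^sub>R u - T)" if "u \<noteq> 0" for a u
        proof -
          have "a /\<^sub>R u - T = (a - u *\<^sub>R T) /\<^sub>R u"
            using that by (simp add: scaleR_right_diff_distrib)
          show ?thesis
            unfolding \<open>a /\<^sub>R u - T = _\<close> norm_scaleR by (simp add: divide_inverse mult.commute)
        qed
        then show "norm (p s - p s0 - (s - s0) *\<^sub>R T) / norm (s - s0) = norm ((p s - p s0) /\<^sub>R (s - s0) - T)"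
          using \<open>s \<noteq> s0\<close> by (metis right_minus_eq)
      qed
      ultimately have "((\<lambda>s. norm ((p s - p s0) /\<^sub>R (s - s0) - T)) \<longlongrightarrow> 0) (at s0)"
        by (rule Lim_transform_eventually)
      then show ?thesis
        by (rule LIM_zero_cancel[OF tendsto_norm_zero_cancel])
    qed
    have "((\<lambda>s. Im (c z * ((p s - p s0) /\<^sub>R (s - s0)))) \<longlongrightarrow> Im (c z * T)) (at s0)"
      by (intro tendsto_intros diff)
    moreover have "((\<lambda>s. Im (c z * ((p s - p s0) /\<^sub>R (s - s0)))) \<longlongrightarrow> 0) (at s0)"
    proof (rule Lim_null_comparison)
      have cont: "(p \<longlongrightarrow> p s0) (at s0)"
        using has_vector_derivative_continuous[OF p(5)] by (simp add: isCont_def)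
      then have "\<forall>\<^sub>F s in at s0. dist (p s) (p s0) < \<rho>"
        using \<rho> by (rule tendstoD)
      moreover have "\<forall>\<^sub>F s in at s0. s \<in> {0<..<1}"
        using p(3) by (intro eventually_at_in_open') auto
      moreover have "\<forall>\<^sub>F s in at s0. s \<noteq> s0"
        by (simp add: eventually_neq_at_within)
      ultimately show "\<forall>\<^sub>F s in at s0. norm (Im (c z * ((p s - p s0) /\<^sub>R (s - s0)))) \<le>
          \<bar>C\<bar> * (norm (p s - p s0) * norm ((p s - p s0) /\<^sub>R (s - s0)))"
      proof eventually_elim
        case (elim s)
        have ps: "p s \<in> path_image \<beta>" "p s \<in> ball w0 \<rho>"
          using elim p(2,4) by (auto simp: path_image_def dist_commute)
        have "\<bar>Y z (p s)\<bar> \<le> C * (X z (p s))\<^sup>2"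
          using C[of "X z (p s)"] graph[OF z ps] XY_le(1)[OF z, of "p s"] ps(2) by simp
        also have "\<dots> \<le> \<bar>C\<bar> * (X z (p s))\<^sup>2"
          by (intro mult_right_mono) auto
        also have "\<dots> \<le> \<bar>C\<bar> * (norm (p s - p s0))\<^sup>2"
        proof (intro mult_left_mono)
          have "\<bar>X z (p s)\<bar> \<le> norm (p s - p s0)"
            using XY_le(1)[OF z, of "p s"] p(4) by (simp add: dist_norm norm_minus_commute)
          then show "(X z (p s))\<^sup>2 \<le> (norm (p s - p s0))\<^sup>2"
            by (metis abs_ge_zero power2_abs power_mono)
        qed simp
        finally have *: "\<bar>Y z (p s)\<bar> \<le> \<bar>C\<bar> * (norm (p s - p s0))\<^sup>2" .
        have "Im (c z * ((p s - p s0) /\<^sub>R (s - s0))) = Y z (p s) / (s - s0)"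
          unfolding Y_def p(4) mult_scaleR_right scaleR_complex.sel divide_inverse by (rule mult.commute)
        then have "norm (Im (c z * ((p s - p s0) /\<^sub>R (s - s0)))) = \<bar>Y z (p s)\<bar> / \<bar>s - s0\<bar>"
          by (simp add: abs_divide)
        also have "\<dots> \<le> \<bar>C\<bar> * (norm (p s - p s0))\<^sup>2 / \<bar>s - s0\<bar>"
          using * by (rule divide_right_mono) simp
        finally show ?case
          by (simp add: power2_eq_square divide_inverse mult_ac)
      qed
      have "((\<lambda>s. norm (p s - p s0)) \<longlongrightarrow> 0) (at s0)"
        using cont by (simp add: LIM_zero tendsto_norm_zero)
      then have "((\<lambda>s. \<bar>C\<bar> * (norm (p s - p s0) * norm ((p s - p s0) /\<^sub>R (s - s0)))) \<longlongrightarrow> \<bar>C\<bar> * (0 * norm T)) (at s0)"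
        by (intro tendsto_intros diff)
      then show "((\<lambda>s. \<bar>C\<bar> * (norm (p s - p s0) * norm ((p s - p s0) /\<^sub>R (s - s0)))) \<longlongrightarrow> 0) (at s0)"
        by simp
    qed
    ultimately show ?thesis
      using tendsto_unique trivial_limit_at by blast
  qed
  have T0: "T \<noteq> 0"
    using tan by (simp add: tangent_to_def)
  \<comment> \<open>\<open>wT\<close> is a point of the tangent other than \<open>w0\<close>; the
    factor 4 places it strictly within \<open>\<sigma>0 / 2\<close> of \<open>w0\<close>.\<close>
  define s where "s = min (\<epsilon> / 2) (\<sigma>0 / (4 * cmod T))"
  define wT where "wT = w0 + of_real s * T"
  have s: "0 < s" "s < \<epsilon>" "s * cmod T < \<sigma>0 / 2"
  proof -
    show "0 < s" "s < \<epsilon>"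
      using seg(1) \<sigma>0(1) T0 by (auto simp: s_def)
    have "s * cmod T \<le> \<sigma>0 / (4 * cmod T) * cmod T"
      by (rule mult_right_mono) (auto simp: s_def)
    then show "s * cmod T < \<sigma>0 / 2"
      using \<sigma>0(1) T0 by simp
  qed
  have wTA: "wT \<in> A"
    unfolding wT_def using seg(2)[of s] s by simp
  have wT_dist: "dist w0 wT < \<sigma>0 / 2"
    using s by (simp add: wT_def dist_norm norm_mult)
  \<comment> \<open>On the tangent the vertical coordinate of every chart is 0, while
    \<open>m z\<close> is negative away from 0.\<close>
  have wT_above: "m z (X z wT) < Y z wT" if z: "z \<in> Zc" for z
  proof -
    have cT: "c z * (wT - w0) = of_real s * (c z * T)"
      by (simp add: wT_def)
    have Y0: "Y z wT = 0"
      unfolding Y_def cT using ImT[OF z] by (simp only: times_complex.sel) simp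
    have "X z wT \<noteq> 0"
    proof
      assume "X z wT = 0"
      then have "wT = w0"
        using Y0 by (intro XY_inj[OF z]) (simp_all add: X_def Y_def)
      then show False
        using s(1) T0 by (simp add: wT_def)
    qed
    moreover have "\<bar>X z wT\<bar> < \<rho>"
      using XY_le(1)[OF z, of wT] wT_dist \<sigma>0 by linarith
    ultimately show ?thesis
      using m_neg[OF Zc(1,2)[OF z]] Y0 by simp
  qed
  \<comment> \<open>Half the radius, so that the square in each chart lies in the disc:
    \<open>\<bar>X z w\<bar> + \<bar>Y z w\<bar> < \<sigma>0\<close>.\<close>
  define \<sigma> where "\<sigma> = \<sigma>0 / 2"
  define D where "D = (\<lambda>z. {w. \<bar>X z w\<bar> < \<sigma> \<and> \<bar>Y z w\<bar> < \<sigma> \<and> m z (X z w) < Y z w})"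
  \<comment> \<open>The doubly covered side of any one fold misses all the other fold curves, hence lies in \<open>A\<close>.\<close>
  have D_A: "D z \<subseteq> A" if z: "z \<in> Zc" for z
  proof (rule components_maximal[OF A])
    have "m z x \<le> 0" if "\<bar>x\<bar> < \<sigma>" for x
    proof (cases "x = 0")
      case True
      obtain C where "\<And>x. \<bar>x\<bar> < \<rho> \<Longrightarrow> \<bar>m z x\<bar> \<le> C * x\<^sup>2"
        using m_sq[OF Zc(1,2)[OF z]] by blast
      from this[of 0] show ?thesis
        using True \<rho> by simp
    next
      case False
      then show ?thesis
        using m_neg[OF Zc(1,2)[OF z], of x] that \<sigma>0 by (simp add: \<sigma>_def)
    qed
    then show "connected (D z)"
      unfolding D_def X_def Y_def
      by (intro connected_region_above Zc(3)[OF z]) (use \<sigma>0(1) in \<open>auto simp: \<sigma>_def\<close>)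
    show "D z \<subseteq> - (f ` crit_set f \<union> cluster_inf f)"
    proof
      fix w assume w: "w \<in> D z"
      have "dist w0 w = cmod (c z * (w - w0))"
        using Zc(3)[OF z] by (simp add: norm_mult dist_norm norm_minus_commute)
      also have "\<dots> \<le> \<bar>X z w\<bar> + \<bar>Y z w\<bar>"
        unfolding X_def Y_def by (rule cmod_le)
      also have "\<dots> < \<sigma>0"
        using w by (simp add: D_def \<sigma>_def)
      finally have "w \<in> ball w0 \<sigma>0"
        by simp
      then show "w \<in> - (f ` crit_set f \<union> cluster_inf f)"
        using off_graph[OF z] \<sigma>\<rho>(2) w by (auto simp: D_def)
    qed
    have "wT \<in> D z"
      using XY_le[OF z, of wT] wT_dist wT_above[OF z] by (simp add: D_def \<sigma>_def)
    then show "A \<inter> D z \<noteq> {}"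
      using wTA by blast
  qed
  have wT_ball: "wT \<in> ball w0 \<rho>"
    using wT_dist \<sigma>0 by simp
  show "Val_on f A = enat (card {z. f z = w0 \<and> z \<notin> crit_set f} + 2 * card {z. f z = w0 \<and> z \<in> crit_set f})"
    unfolding Val_on_component[OF A wTA] using above[OF wT_ball] wT_above
    by (simp add: Zc_def X_def Y_def)
  obtain w where w: "w \<in> B" "dist w w0 < \<sigma>"
  proof -
    have "\<sigma> > 0"
      using \<sigma>0(1) by (simp add: \<sigma>_def)
    moreover have "w0 \<in> closure B"
      using frB by (simp add: frontier_def)
    ultimately show ?thesis
      using that unfolding closure_approachable by blast
  qed
  have w_ball: "w \<in> ball w0 \<sigma>0"
    using w(2) \<sigma>0(1) by (simp add: dist_commute \<sigma>_def)
  have w_crit: "w \<notin> f ` crit_set f"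
    using in_components_subset[OF B] w(1) by blast
  have "Y z w < m z (X z w)" if z: "z \<in> Zc" for z
  proof (rule ccontr)
    assume "\<not> Y z w < m z (X z w)"
    moreover have "Y z w \<noteq> m z (X z w)"
      using graph_in_\<beta>[OF z w_ball] \<beta>_crit w_crit by blast
    ultimately have "w \<in> D z"
      using XY_le[OF z, of w] w(2) by (simp add: D_def dist_commute)
    then have "w \<in> A \<inter> B"
      using D_A[OF z] w(1) by blast
    then show False
      using components_nonoverlap[OF A B] AB by blast
  qed
  then have "card {z. f z = w} = card {z. f z = w0 \<and> z \<notin> crit_set f}"
    using below[OF \<sigma>\<rho>(1)[OF w_ball]] by (simp add: Zc_def X_def Y_def)
  then show "Val_on f B = enat (card {z. f z = w0 \<and> z \<notin> crit_set f})"
    unfolding Val_on_component[OF B w(1)] by simp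
qed

text \<open>The parameters of points outside the cluster set form a nonempty open set, hence an
  uncountable one, whereas the image of \<open>degenerate\<close> is countable and
  \<open>\<beta>0\<close> is injective. That image together with the cluster set is closed, so the
  good parameters are open and leave room for a subarc.\<close>

lemma generic_subarc:
  assumes arc0: "arc \<beta>0" and not_in_C: "\<not> (\<beta>0 ` {0<..<1} \<subseteq> cluster_inf f)"
  obtains \<beta> n where "arc \<beta>" "path_image \<beta> \<subseteq> path_image \<beta>0" "path_image \<beta> \<inter> cluster_inf f = {}"
    "f -` path_image \<beta> \<inter> degenerate = {}"
    "\<And>w. w \<in> path_image \<beta> \<Longrightarrow> card {z\<in>crit_set f. f z = w} = n"
proof -
  have cont: "continuous_on {0<..<1} \<beta>0"
    using arc_imp_path[OF arc0] unfolding path_def by (rule continuous_on_subset) auto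
  have inj: "inj_on \<beta>0 {0<..<1}"
    using arc0 by (auto simp: arc_def inj_on_def)
  define O1 where "O1 = {0<..<1} \<inter> \<beta>0 -` (- cluster_inf f)"
  define O2 where "O2 = {0<..<1} \<inter> \<beta>0 -` (- (f ` degenerate \<union> cluster_inf f))"
  have "open O1" "open O2"
    unfolding O1_def O2_def
    by (intro continuous_open_preimage cont open_greaterThanLessThan open_Compl
        closed_cluster_inf closed_image_Un_cluster closed_degenerate)+
  have "O2 \<noteq> {}"
  proof
    assume "O2 = {}"
    then have "\<beta>0 ` O1 \<subseteq> f ` degenerate"
      by (auto simp: O1_def O2_def)
    then have "countable (\<beta>0 ` O1)"
      by (rule countable_subset) (rule countable_image[OF countable_degenerate])
    moreover have "inj_on \<beta>0 O1"
      using inj by (rule inj_on_subset) (auto simp: O1_def)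
    ultimately have "countable O1"
      by (rule countable_image_inj_on)
    moreover have "O1 \<noteq> {}"
      using not_in_C by (auto simp: O1_def)
    ultimately show False
      using \<open>open O1\<close> uncountable_ball countable_subset by (metis ex_in_conv openE)
  qed
  define N where "N = (\<lambda>t. card {z\<in>crit_set f. f z = \<beta>0 t})"
  \<comment> \<open>At a minimum of the semicontinuous \<open>N\<close> every fold curve through the point contains the nearby
    part of the arc; this excludes crossings and tangencies of distinct fold curves.\<close>
  obtain t2 where t2: "t2 \<in> O2" "\<And>t. t \<in> O2 \<Longrightarrow> N t2 \<le> N t"
    using ex_has_least_nat[of "\<lambda>t. t \<in> O2" _ N] \<open>O2 \<noteq> {}\<close> by blast
  have "\<beta>0 t2 \<notin> cluster_inf f" "f -` {\<beta>0 t2} \<inter> degenerate = {}"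
    using t2(1) by (auto simp: O2_def image_iff)
  then obtain \<rho> where \<rho>: "\<rho> > 0"
      "\<And>w. w \<in> ball (\<beta>0 t2) \<rho> \<Longrightarrow> card {z\<in>crit_set f. f z = w} \<le> card {z\<in>crit_set f. f z = \<beta>0 t2}"
    by (rule local_picture) blast
  have "open (O2 \<inter> \<beta>0 -` ball (\<beta>0 t2) \<rho>)"
    using \<open>open O2\<close> by (intro continuous_open_preimage continuous_on_subset[OF cont]) (auto simp: O2_def)
  moreover have "t2 \<in> O2 \<inter> \<beta>0 -` ball (\<beta>0 t2) \<rho>"
    using t2(1) \<rho>(1) by simp
  ultimately obtain e where e: "e > 0" "cball t2 e \<subseteq> O2 \<inter> \<beta>0 -` ball (\<beta>0 t2) \<rho>"
    by (meson open_contains_cball)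
  have I: "{t2-e..t2+e} = cball t2 e"
    by (rule cball_eq_atLeastAtMost[symmetric])
  have I01: "{t2-e..t2+e} \<subseteq> {0..1}"
    unfolding I using e(2) by (auto simp: O2_def)
  define \<beta> where "\<beta> = subpath (t2-e) (t2+e) \<beta>0"
  have img: "path_image \<beta> = \<beta>0 ` {t2-e..t2+e}"
    unfolding \<beta>_def using e(1) by (simp add: path_image_subpath)
  show ?thesis
  proof (rule that[of \<beta> "N t2"])
    show "arc \<beta>"
      unfolding \<beta>_def by (rule arc_subpath_arc[OF arc0]) (use I01 e(1) in auto)
    show "path_image \<beta> \<subseteq> path_image \<beta>0"
      unfolding img using I01 by (auto simp: path_image_def)
    show "path_image \<beta> \<inter> cluster_inf f = {}" "f -` path_image \<beta> \<inter> degenerate = {}"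
      unfolding img I using e(2) by (force simp: O2_def image_iff)+
    show "card {z\<in>crit_set f. f z = w} = N t2" if "w \<in> path_image \<beta>" for w
    proof -
      obtain t where t: "t \<in> O2" "\<beta>0 t \<in> ball (\<beta>0 t2) \<rho>" "w = \<beta>0 t"
        using \<open>w \<in> path_image \<beta>\<close> e(2) unfolding img I by blast
      then show ?thesis
        using t2(2)[OF t(1)] \<rho>(2)[OF t(2)] by (simp add: N_def)
    qed
  qed
qed

end

text \<open>The labelling of the two components depends on \<open>w0\<close> and is expressed by
  \<open>A\<close> and \<open>B\<close>: \<open>A\<close> is whichever of them contains a punctured
  tangent segment at \<open>w0\<close>. The subarc is fixed beforehand and serves every interior
  point.\<close>

theorem theorem6p7:
  fixes h g f :: "complex \<Rightarrow> complex" and \<Omega>p \<Omega>m :: "complex set" and \<beta>0 :: "real \<Rightarrow> complex"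
  assumes h_entire: "h holomorphic_on UNIV" and g_entire: "g holomorphic_on UNIV"
    and f_def: "f = (\<lambda>z. h z + cnj (g z))"
    and fin_val: "finite_valence f"
    and comp_p: "\<Omega>p \<in> components (- (f ` crit_set f \<union> cluster_inf f))"
    and comp_m: "\<Omega>m \<in> components (- (f ` crit_set f \<union> cluster_inf f))"
    and distinct: "\<Omega>p \<noteq> \<Omega>m"
    and arc0: "arc \<beta>0"
    and common_bd: "path_image \<beta>0 \<subseteq> frontier \<Omega>p \<inter> frontier \<Omega>m"
    and not_in_C: "\<not> (\<beta>0 ` {0<..<1} \<subseteq> cluster_inf f)"
  shows "\<exists>\<beta> :: real \<Rightarrow> complex.
           arc \<beta> \<and> path_image \<beta> \<subseteq> path_image \<beta>0 \<and>
           path_image \<beta> \<inter> cluster_inf f = {} \<and>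
           f -` path_image \<beta> \<inter> (Fset h g \<union> Nset h g) = {} \<and>
           (\<forall>t0\<in>{0<..<1}. \<forall>T A B.
              let w0 = \<beta> t0;
                  N0 = card {z. f z = w0 \<and> z \<notin> crit_set f};
                  N1 = card {z. f z = w0 \<and> z \<in> crit_set f}
              in ({A, B} = {\<Omega>p, \<Omega>m} \<and> A \<noteq> B \<and>
                  tangent_to (path_image \<beta>) w0 T \<and>
                  (\<exists>\<epsilon>>0. \<forall>s::real. 0 < \<bar>s\<bar> \<and> \<bar>s\<bar> < \<epsilon> \<longrightarrow> w0 + complex_of_real s * T \<in> A) \<and>
                  N1 > 0)
                 \<longrightarrow> Val_on f B = enat N0 \<and> Val_on f A = enat (N0 + 2 * N1))"
proof -
  interpret finite_harmonic_map h g f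
    by unfold_locales (fact h_entire g_entire f_def fin_val)+
  obtain \<beta> n where \<beta>: "arc \<beta>" "path_image \<beta> \<subseteq> path_image \<beta>0" "path_image \<beta> \<inter> cluster_inf f = {}"
    "f -` path_image \<beta> \<inter> degenerate = {}"
    and const: "\<And>w. w \<in> path_image \<beta> \<Longrightarrow> card {z\<in>crit_set f. f z = w} = n"
    by (rule generic_subarc[OF arc0 not_in_C]) blast
  show ?thesis
    unfolding Let_def
  proof (intro exI[of _ \<beta>] conjI ballI allI impI; (elim conjE exE)?)
    show "f -` path_image \<beta> \<inter> (Fset h g \<union> Nset h g) = {}"
      using \<beta>(4) F_N_subset_degenerate by blast
  next
    fix t0 T A B \<epsilon>
    assume t0: "t0 \<in> {0<..<1}" and AB: "{A, B} = {\<Omega>p, \<Omega>m}" "A \<noteq> B"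
      and tan: "tangent_to (path_image \<beta>) (\<beta> t0) T"
      and eps: "\<epsilon> > 0" "\<forall>s::real. 0 < \<bar>s\<bar> \<and> \<bar>s\<bar> < \<epsilon> \<longrightarrow> \<beta> t0 + complex_of_real s * T \<in> A"
      and pos: "0 < card {z. f z = \<beta> t0 \<and> z \<in> crit_set f}"
    have "A \<in> {\<Omega>p, \<Omega>m}" "B \<in> {\<Omega>p, \<Omega>m}"
      using AB(1) by blast+
    then have comps: "A \<in> components (- (f ` crit_set f \<union> cluster_inf f))"
        "B \<in> components (- (f ` crit_set f \<union> cluster_inf f))" and fr: "path_image \<beta>0 \<subseteq> frontier B"
      using comp_p comp_m common_bd by auto
    have "\<beta> t0 \<in> path_image \<beta>"
      using t0 by (auto simp: path_image_def)
    then have "\<beta> t0 \<in> frontier B"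
      using \<beta>(2) fr by blast
    note valences = valences_at_tangent[OF \<beta>(1,3,4) const t0 refl comps AB(2) this tan eps(1) _ pos]
    show "Val_on f B = enat (card {z. f z = \<beta> t0 \<and> z \<notin> crit_set f})"
      "Val_on f A = enat (card {z. f z = \<beta> t0 \<and> z \<notin> crit_set f} + 2 * card {z. f z = \<beta> t0 \<and> z \<in> crit_set f})"
      using valences eps(2) by blast+
  qed (use \<beta> in auto)
qed

end
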